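(* Let $K,L\subsetneqq \mathbb{R}^2$ be closed convex sets with interior points. Then the following statements are equivalent. (1) For all orientation preserving congruences $\varphi,\psi:\mathbb{R}^2\to\mathbb{R}^2$ for which $\mathrm{int}\,((\varphi K)\cap(\psi L))\neq\emptyset$, the set $(\varphi K)\cap(\psi L)$ has some non-trivial symmetry. (2) $K$ and $L$ are two circles, or one of them is a circle and the other one is a parallel strip or a half-plane, or they are two parallel strips, or they are two half-planes. In particular: if the symmetries in (1) are central symmetries (i.e. (1) holds with "has some non-trivial symmetry" replaced by "is centrally symmetric"), then $K$ and $L$ are either two congruent circles or two parallel strips. If the symmetries in (1) are axial symmetries (i.e. (1) holds with "has some non-trivial symmetry" replaced by "is axially symmetric"), then in (2), in the case of two parallel strips, these strips are congruent.
   Context: A congruence is an isometry of $\mathbb{R}^2$ onto itself. A non-trivial symmetry of a set is a congruence (possibly orientation reversing), different from the identity, mapping the set onto itself. A set is centrally symmetric if it is invariant under the point reflection in some point, and axially symmetric if it is invariant under the reflection in some straight line. When $K$ or $L$ is said to be a circle, the closed disc is meant. A parallel strip is the closed region bounded by two distinct parallel straight lines ("two parallel strips" means that each of $K$ and $L$ is a parallel strip; their widths may differ and their directions are arbitrary). Half-planes are closed. *)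

theory Defs
  imports "HOL-Analysis.Analysis"
begin

definition congruence :: "(real^2 \<Rightarrow> real^2) \<Rightarrow> bool" where
  "congruence f \<longleftrightarrow> (\<forall>x y. dist (f x) (f y) = dist x y) \<and> surj f"

text \<open>A congruence is affine (Mazur--Ulam), so subtracting the value at 0 gives its linear part.\<close>

definition orientation_preserving :: "(real^2 \<Rightarrow> real^2) \<Rightarrow> bool" where
  "orientation_preserving f \<longleftrightarrow> 0 < det (matrix (\<lambda>x. f x - f 0))"

definition congruent_sets :: "(real^2) set \<Rightarrow> (real^2) set \<Rightarrow> bool" where
  "congruent_sets S T \<longleftrightarrow> (\<exists>f. congruence f \<and> f ` S = T)"

definition has_nontrivial_symmetry :: "(real^2) set \<Rightarrow> bool" where
  "has_nontrivial_symmetry S \<longleftrightarrow> (\<exists>f. congruence f \<and> f \<noteq> id \<and> f ` S = S)"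

definition point_reflection :: "real^2 \<Rightarrow> real^2 \<Rightarrow> real^2" where
  "point_reflection c x = 2 *\<^sub>R c - x"

text \<open>Reflection in the straight line through \<open>p\<close> with unit direction \<open>u\<close>: the foot
  \<open>p + ((x - p) \<bullet> u) *\<^sub>R u\<close> of the perpendicular is the midpoint of \<open>x\<close> and its image.\<close>

definition line_reflection :: "real^2 \<Rightarrow> real^2 \<Rightarrow> real^2 \<Rightarrow> real^2" where
  "line_reflection p u x = 2 *\<^sub>R (p + ((x - p) \<bullet> u) *\<^sub>R u) - x"

definition centrally_symmetric :: "(real^2) set \<Rightarrow> bool" where
  "centrally_symmetric S \<longleftrightarrow> (\<exists>c. point_reflection c ` S = S)"

definition axially_symmetric :: "(real^2) set \<Rightarrow> bool" where
  "axially_symmetric S \<longleftrightarrow> (\<exists>p u. norm u = 1 \<and> line_reflection p u ` S = S)"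

definition is_disc :: "(real^2) set \<Rightarrow> bool" where
  "is_disc S \<longleftrightarrow> (\<exists>c r. 0 < r \<and> S = cball c r)"

definition is_strip :: "(real^2) set \<Rightarrow> bool" where
  "is_strip S \<longleftrightarrow> (\<exists>a b c. a \<noteq> 0 \<and> b < c \<and> S = {x. b \<le> a \<bullet> x \<and> a \<bullet> x \<le> c})"

definition is_half_plane :: "(real^2) set \<Rightarrow> bool" where
  "is_half_plane S \<longleftrightarrow> (\<exists>a b. a \<noteq> 0 \<and> S = {x. a \<bullet> x \<le> b})"

definition intersections_satisfy ::
    "((real^2) set \<Rightarrow> bool) \<Rightarrow> (real^2) set \<Rightarrow> (real^2) set \<Rightarrow> bool" where
  "intersections_satisfy P K L \<longleftrightarrow>
    (\<forall>\<phi> \<psi>. congruence \<phi> \<and> orientation_preserving \<phi> \<and>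
           congruence \<psi> \<and> orientation_preserving \<psi> \<and>
           interior (\<phi> ` K \<inter> \<psi> ` L) \<noteq> {}
       \<longrightarrow> P (\<phi> ` K \<inter> \<psi> ` L))"

definition classified_pair :: "(real^2) set \<Rightarrow> (real^2) set \<Rightarrow> bool" where
  "classified_pair K L \<longleftrightarrow>
     (is_disc K \<and> is_disc L) \<or>
     (is_disc K \<and> (is_strip L \<or> is_half_plane L)) \<or>
     (is_disc L \<and> (is_strip K \<or> is_half_plane K)) \<or>
     (is_strip K \<and> is_strip L) \<or>
     (is_half_plane K \<and> is_half_plane L)"

end

theory Submission
  imports Defs
begin

text \<open>
  A boundary point of \<open>K\<close> cannot be a corner: the intersection of a small neighbourhood of a corner
  with a copy of \<open>L\<close> pushed slightly over it, near a point where \<open>L\<close> is touched from inside by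
  a disc, is after magnification almost any triangle with the given apex angle; for a scalene one,
  the limit of the symmetries is a contradiction.

  At smooth boundary points let \<open>K\<close> and the reversed \<open>L\<close> overlap in a thin lens over a common short
  chord. The chord is the unique diameter of the lens, so a symmetry of the lens preserves the chord,
  and either the cap of \<open>K\<close> is symmetric or it is congruent to the cap of \<open>L\<close>. Keeping the chord
  of \<open>L\<close> and varying that of \<open>K\<close> among the chords of the same length gives motions close to the
  identity mapping boundary arcs of \<open>K\<close> into \<open>K\<close>. After rescaling they converge to the velocity field
  of a rotation or translation that is tangent to the boundary of \<open>K\<close> near the given point. The flow
  of such a field preserves the distance to \<open>K\<close>, so the boundary contains orbits; the fields of
  neighbouring points agree up to a factor, so it contains a whole circle or a whole line. Hence each
  of \<open>K\<close> and \<open>L\<close> is a disc, a strip or a half-plane, and the remaining combinations are excluded by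
  explicit positions.
\<close>

section \<open>Isometries of the plane\<close>

text \<open>At smooth points only a unique supporting line is known, so neither curvatures nor
  derivatives of the boundary can be compared. A compactness argument replaces them: the deviation
  of nearby motions from the identity, divided by its size, has a limit point, and this is a
  velocity field that does not vanish identically. Tangency is expressed through outer normals,
  which exist at every boundary point.

  A single cap of \<open>L\<close> serves for all chords of \<open>K\<close> of its length, since
  one of the possible relations between the caps recurs infinitely often. The hypothesis is
  symmetric in \<open>K\<close> and \<open>L\<close>, so each set is examined with the other as a
  probe.

  At corners a limit of symmetries is useless if they tend to the identity; passing to powers of a
  rotation avoids this. The limit is only known to map a triangle into itself, which for a scalene
  triangle already forces the identity.

  The plane becomes the complex plane: motions are \<open>u * z + b\<close> or
  \<open>u * cnj z + b\<close> with \<open>u\<close> of modulus 1, and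
  \<open>(z - p) / (q - p)\<close> puts a chord on the segment from 0 to 1.\<close>

definition isom :: "(complex \<Rightarrow> complex) \<Rightarrow> bool" where
  "isom F \<longleftrightarrow> (\<forall>z w. dist (F z) (F w) = dist z w)"

lemma cmod_eq_cmod_iff: "cmod z = cmod w \<longleftrightarrow> (Re z)\<^sup>2 + (Im z)\<^sup>2 = (Re w)\<^sup>2 + (Im w)\<^sup>2"
  by (metis cmod_power2 norm_ge_zero power2_eq_iff_nonneg)

text \<open>The distances from 0 and 1 determine the real part and the square of the imaginary part.
  Mutual distances preserve the products of imaginary parts, so one sign, read off at
  \<open>\<i>\<close>, is valid for all points.\<close>

lemma isom_fixing_01:
  assumes F: "isom F" and "F 0 = 0" "F 1 = 1"
  shows "F = id \<or> F = cnj"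
proof -
  have re: "Re (F z) = Re z" and im: "(Im (F z))\<^sup>2 = (Im z)\<^sup>2" for z
  proof -
    have "cmod (F z) = cmod z" "cmod (F z - 1) = cmod (z - 1)"
      using F assms(2,3) unfolding isom_def dist_norm
      by (metis diff_zero)+
    then have "(Re (F z))\<^sup>2 + (Im (F z))\<^sup>2 = (Re z)\<^sup>2 + (Im z)\<^sup>2"
      "(Re (F z) - 1)\<^sup>2 + (Im (F z))\<^sup>2 = (Re z - 1)\<^sup>2 + (Im z)\<^sup>2"
      by (simp_all add: cmod_eq_cmod_iff)
    then show "Re (F z) = Re z" "(Im (F z))\<^sup>2 = (Im z)\<^sup>2"
      by (auto simp: power2_eq_square algebra_simps)
  qed
  have rel: "Im (F z) * Im (F w) = Im z * Im w" for z w
  proof -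
    have "cmod (F z - F w) = cmod (z - w)"
      using F unfolding isom_def dist_norm by blast
    then have "(Re z - Re w)\<^sup>2 + (Im (F z) - Im (F w))\<^sup>2 = (Re z - Re w)\<^sup>2 + (Im z - Im w)\<^sup>2"
      by (simp add: cmod_eq_cmod_iff re)
    then show ?thesis
      using im[of z] im[of w] by (simp add: power2_eq_square algebra_simps)
  qed
  have "Im (F \<i>) = 1 \<or> Im (F \<i>) = -1"
    using im[of \<i>] by (simp add: power2_eq_1_iff)
  then show ?thesis
  proof
    assume "Im (F \<i>) = 1"
    then have "F z = z" for z
      using rel[of z \<i>] re[of z] by (simp add: complex_eq_iff)
    then show ?thesis by auto
  next
    assume "Im (F \<i>) = -1"
    then have "F z = cnj z" for z
      using rel[of z \<i>] re[of z] by (simp add: complex_eq_iff)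
    then show ?thesis by auto
  qed
qed

text \<open>Source and target coordinates may differ. This covers the normalisation in
  \<open>isom_cases\<close> and, with \<open>q = p\<close> and \<open>e = d\<close>, the conjugation
  of \<open>F\<close> by a change of coordinates.\<close>

lemma isom_similarity:
  assumes "isom F" "d \<noteq> 0" "cmod d = cmod e"
  shows "isom (\<lambda>z. (F (p + d * z) - q) / e)"
  unfolding isom_def dist_norm
proof (intro allI)
  fix z w
  have "cmod ((F (p + d * z) - q) / e - (F (p + d * w) - q) / e)
      = cmod (F (p + d * z) - F (p + d * w)) / cmod e"
    by (simp add: diff_divide_distrib[symmetric] norm_divide)
  also have "cmod (F (p + d * z) - F (p + d * w)) = cmod (p + d * z - (p + d * w))"
    using assms(1) unfolding isom_def dist_norm by blast
  also have "\<dots> = cmod d * cmod (z - w)"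
    by (simp add: norm_mult[symmetric] algebra_simps)
  also have "\<dots> / cmod e = cmod (z - w)"
    using assms by auto
  finally show "cmod ((F (p + d * z) - q) / e - (F (p + d * w) - q) / e) = cmod (z - w)" .
qed

text \<open>Meant for figures with a unique diameter: in coordinates that put it on the segment from
  0 to 1, every symmetry is one of the four isometries preserving this segment.\<close>

lemma isom_permuting_01:
  assumes "isom F" "{F 0, F 1} = {0, 1}"
  shows "F = id \<or> F = cnj \<or> F = (\<lambda>z. 1 - z) \<or> F = (\<lambda>z. 1 - cnj z)"
proof (cases "F 0 = 0")
  case True
  then show ?thesis using assms isom_fixing_01[of F] by (auto simp: doubleton_eq_iff)
next
  case False
  then have "F 0 = 1" "F 1 = 0" using assms by (auto simp: doubleton_eq_iff)
  moreover have "isom (\<lambda>z. 1 - F z)"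
    using assms(1) by (simp add: isom_def dist_norm norm_minus_commute)
  ultimately have "(\<lambda>z. 1 - F z) = id \<or> (\<lambda>z. 1 - F z) = cnj"
    by (intro isom_fixing_01) auto
  then show ?thesis
  proof
    assume "(\<lambda>z. 1 - F z) = id"
    then have "F z = 1 - z" for z
      by (metis id_apply diff_diff_eq2 add_diff_cancel_left')
    then show ?thesis by auto
  next
    assume "(\<lambda>z. 1 - F z) = cnj"
    then have "F z = 1 - cnj z" for z
      by (metis diff_diff_eq2 add_diff_cancel_left')
    then show ?thesis by auto
  qed
qed

lemma isom_cases:
  assumes "isom F"
  obtains u b where "cmod u = 1" "F = (\<lambda>z. u * z + b)"
  | u b where "cmod u = 1" "F = (\<lambda>z. u * cnj z + b)"
proof -
  define u where "u = F 1 - F 0"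
  have u: "cmod u = 1"
    using assms unfolding isom_def dist_norm u_def by (metis diff_zero norm_one)
  let ?G = "\<lambda>z. (F (0 + 1 * z) - F 0) / u"
  have "isom ?G" by (rule isom_similarity) (use assms u in auto)
  moreover have "u \<noteq> 0" using u by auto
  ultimately have "?G = id \<or> ?G = cnj"
    by (intro isom_fixing_01) (auto simp: u_def)
  then show thesis
  proof
    assume "?G = id"
    then have "(F z - F 0) / u = z" for z
      by (simp add: fun_eq_iff)
    then have "F z = u * z + F 0" for z
      using \<open>u \<noteq> 0\<close> by (metis nonzero_mult_div_cancel_left times_divide_eq_right diff_add_cancel)
    then show thesis using that(1) u by blast
  next
    assume "?G = cnj"
    then have "(F z - F 0) / u = cnj z" for z
      by (simp add: fun_eq_iff)
    then have "F z = u * cnj z + F 0" for z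
      using \<open>u \<noteq> 0\<close> by (metis nonzero_mult_div_cancel_left times_divide_eq_right diff_add_cancel)
    then show thesis using that(2) u by blast
  qed
qed

section \<open>Lenses bounded by two boundary arcs\<close>

text \<open>Only \<open>L\<close> is moved: moving both sets amounts to this up to a common congruence.\<close>

definition inter_all :: "(complex set \<Rightarrow> bool) \<Rightarrow> complex set \<Rightarrow> complex set \<Rightarrow> bool" where
  "inter_all P K L \<longleftrightarrow> (\<forall>u b. cmod u = 1 \<longrightarrow> interior (K \<inter> (\<lambda>z. u * z + b) ` L) \<noteq> {} \<longrightarrow>
     P (K \<inter> (\<lambda>z. u * z + b) ` L))"

definition sym_inter :: "complex set \<Rightarrow> complex set \<Rightarrow> bool" where
  "sym_inter = inter_all (\<lambda>M. \<exists>F. isom F \<and> F \<noteq> id \<and> F ` M = M)"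

text \<open>The coordinate \<open>\<zeta>\<close> has \<open>p\<close> at \<open>0\<close> and \<open>q\<close> at \<open>1\<close>; the cap lies to the right of the chord
  from \<open>p\<close> to \<open>q\<close>. The slope \<open>1/4\<close> makes the chord the only diameter of every lens bounded by two
  good chords.\<close>

definition cap :: "complex set \<Rightarrow> complex \<Rightarrow> complex \<Rightarrow> complex set" where
  "cap K p q = {\<zeta>. p + (q - p) * \<zeta> \<in> K \<and> Im \<zeta> < 0}"

definition good_chord :: "complex set \<Rightarrow> complex \<Rightarrow> complex \<Rightarrow> bool" where
  "good_chord K p q \<longleftrightarrow> p \<in> K \<and> q \<in> K \<and> p \<noteq> q \<and> p + (q - p) * Complex (1/2) (1/8) \<in> K \<and>
    (\<forall>\<zeta>\<in>cap K p q. - Im \<zeta> \<le> Re \<zeta> / 4 \<and> - Im \<zeta> \<le> (1 - Re \<zeta>) / 4)"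

text \<open>A height in the rhombus is at most a quarter of the horizontal distance to either end.
  Hence even the sum of the horizontal distance and both heights reaches 1 only for the two
  ends.\<close>

lemma rhombus_diameter:
  assumes "\<bar>Im z\<bar> \<le> Re z / 4" "\<bar>Im z\<bar> \<le> (1 - Re z) / 4"
    "\<bar>Im w\<bar> \<le> Re w / 4" "\<bar>Im w\<bar> \<le> (1 - Re w) / 4" "1 \<le> cmod (z - w)"
  shows "{z, w} = {0, 1}"
proof -
  define a b where "a = \<bar>Im z\<bar>" and "b = \<bar>Im w\<bar>"
  have "cmod (z - w) \<le> \<bar>Re z - Re w\<bar> + \<bar>Im z - Im w\<bar>"
    using cmod_le[of "z - w"] by simp
  then have le: "1 \<le> \<bar>Re z - Re w\<bar> + a + b" "0 \<le> a" "0 \<le> b"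
    using assms(5) abs_triangle_ineq4[of "Im z" "Im w"] by (auto simp: a_def b_def)
  note ab = assms(1-4)[folded a_def b_def]
  show ?thesis
  proof (cases "Re z \<le> Re w")
    case True
    then have "Re z = 0 \<and> Re w = 1 \<and> a = 0 \<and> b = 0"
      using ab le abs_of_nonpos[of "Re z - Re w"] by auto
    then show ?thesis by (simp add: a_def b_def complex_eq_iff doubleton_eq_iff)
  next
    case False
    then have "Re w = 0 \<and> Re z = 1 \<and> a = 0 \<and> b = 0"
      using ab le abs_of_nonneg[of "Re z - Re w"] by auto
    then show ?thesis by (auto simp add: a_def b_def complex_eq_iff doubleton_eq_iff)
  qed
qed

text \<open>The apex over the midpoint has slope 1/4 from both ends, so the triangle is the upper
  half of the rhombus whose lower half contains the caps. \<open>w\<close> and \<open>v\<close> are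
  the barycentric weights of 1 and of the apex.\<close>

lemma thick_triangle:
  assumes "convex S" "0 \<in> S" "1 \<in> S" "Complex (1/2) (1/8) \<in> S"
    "0 \<le> Im z" "Im z \<le> Re z / 4" "Im z \<le> (1 - Re z) / 4"
  shows "z \<in> S"
proof -
  define v where "v = 8 * Im z"
  define w where "w = Re z - v / 2"
  have nn: "0 \<le> 1 - v - w" "0 \<le> w" "0 \<le> v" using assms by (auto simp: v_def w_def)
  have "(1 - v - w) *\<^sub>R 0 + w *\<^sub>R 1 + v *\<^sub>R Complex (1/2) (1/8) \<in> convex hull {0, 1, Complex (1/2) (1/8)}"
    unfolding convex_hull_3 using nn
    by (intro CollectI exI[of _ "1 - v - w"] exI[of _ w] exI[of _ v]) auto
  then have "(1 - v - w) *\<^sub>R 0 + w *\<^sub>R 1 + v *\<^sub>R Complex (1/2) (1/8) \<in> S"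
    using hull_minimal[of "{0, 1, Complex (1/2) (1/8)}" S convex] assms by auto
  moreover have "(1 - v - w) *\<^sub>R 0 + w *\<^sub>R 1 + v *\<^sub>R Complex (1/2) (1/8) = z"
    by (simp add: complex_eq_iff v_def w_def)
  ultimately show ?thesis by simp
qed

lemma inner_mult_zero:
  assumes "inner a d = 0" "inner a (\<i> * d) = 0" "d \<noteq> (0::complex)"
  shows "a = 0"
proof -
  have "(inner a d)\<^sup>2 + (inner a (\<i> * d))\<^sup>2 = (cmod a)\<^sup>2 * (cmod d)\<^sup>2"
    unfolding cmod_power2 by (simp add: inner_complex_def power2_eq_square algebra_simps)
  then show ?thesis using assms by auto
qed

lemma convex_coords: "convex K \<Longrightarrow> convex {\<zeta>. p + d * \<zeta> \<in> K}" for d :: complex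
proof -
  assume "convex K"
  then have "convex ((\<lambda>z. -p + z) ` K)" by (rule convex_translation)
  then have "convex ((\<lambda>z. d * z) -` ((\<lambda>z. -p + z) ` K))"
    by (intro convex_linear_vimage bounded_linear.linear bounded_linear_mult_right)
  moreover have "(\<lambda>z. d * z) -` ((\<lambda>z. -p + z) ` K) = {\<zeta>. p + d * \<zeta> \<in> K}"
    by (auto simp: image_iff) (metis add_uminus_conv_diff diff_add_cancel add.commute uminus_add_conv_diff)
  ultimately show ?thesis by simp
qed

text \<open>A strictly lower cap would be widened beyond the ends of the chord by a further point
  on the chord's line.\<close>

lemma chord_line_section:
  assumes "convex K" "good_chord K p q" "cap K p q \<noteq> {}" "p + (q - p) * \<zeta> \<in> K" "Im \<zeta> = 0"
  shows "0 \<le> Re \<zeta> \<and> Re \<zeta> \<le> 1"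
proof -
  obtain m where m: "m \<in> cap K p q" using assms by auto
  have mb: "0 \<le> Re m" "Re m \<le> 1" and mI: "Im m < 0"
    using m assms(2) unfolding good_chord_def cap_def by force+
  have thin: "0 \<le> Re w \<and> Re w \<le> 1" if "w \<in> cap K p q" for w
    using that assms(2) unfolding good_chord_def cap_def by force
  have cv: "convex {\<zeta>. p + (q - p) * \<zeta> \<in> K}" using assms(1) by (rule convex_coords)
  have comb: "0 \<le> Re \<zeta> + e * (Re m - Re \<zeta>) \<and> Re \<zeta> + e * (Re m - Re \<zeta>) \<le> 1" if "0 < e" "e \<le> 1" for e
  proof -
    have "(1 - e) *\<^sub>R \<zeta> + e *\<^sub>R m \<in> {\<zeta>. p + (q - p) * \<zeta> \<in> K}"
      using assms(4) m that by (intro convexD[OF cv]) (auto simp: cap_def)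
    moreover have "Im ((1 - e) *\<^sub>R \<zeta> + e *\<^sub>R m) < 0"
      using mI that assms(5) by (simp add: mult_pos_neg)
    ultimately have "(1 - e) *\<^sub>R \<zeta> + e *\<^sub>R m \<in> cap K p q"
      unfolding cap_def by blast
    from thin[OF this] show ?thesis by (simp add: algebra_simps)
  qed
  have "\<not> Re \<zeta> < 0"
  proof
    assume neg: "Re \<zeta> < 0"
    \<comment> \<open>Since \<open>Re m \<le> 1\<close>, a step of this size from
      \<open>\<zeta>\<close> towards \<open>m\<close> uses up at most half of the excess: the new
      point is strictly below the chord line but still beyond its end.\<close>
    define e where "e = - Re \<zeta> / (2 * (1 - Re \<zeta>))"
    have e: "0 < e" "e \<le> 1" "e * (1 - Re \<zeta>) = - Re \<zeta> / 2"
      using neg by (auto simp: e_def field_simps)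
    have "e * (Re m - Re \<zeta>) \<le> e * (1 - Re \<zeta>)"
      using mb e by (intro mult_left_mono) auto
    then show False using comb[OF e(1,2)] e(3) neg by auto
  qed
  moreover have "\<not> Re \<zeta> > 1"
  proof
    assume gt: "Re \<zeta> > 1"
    define e where "e = (Re \<zeta> - 1) / (2 * Re \<zeta>)"
    have e: "0 < e" "e \<le> 1" "e * Re \<zeta> = (Re \<zeta> - 1) / 2"
      using gt by (auto simp: e_def field_simps)
    have "e * (Re m - Re \<zeta>) \<ge> e * (0 - Re \<zeta>)"
      using mb e by (intro mult_left_mono) auto
    then show False using comb[OF e(1,2)] e(3) gt by (auto simp: field_simps)
  qed
  ultimately show ?thesis by auto
qed

text \<open>\<open>L\<close> is given a half-turn to the other side of the chord of
  \<open>K\<close>. In the coordinate of that chord the lens consists of the cap of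
  \<open>K\<close>, the half-turned cap of \<open>L\<close> and the chord, all inside the rhombus of
  \<open>rhombus_diameter\<close>. A symmetry therefore permutes 0 and 1, and the three isometries
  other than the identity that do so give the three alternatives. The nonempty cap of
  \<open>K\<close> provides interior points of the lens.\<close>

lemma lens_symmetry:
  assumes S: "sym_inter K L" and "convex K" "convex L"
    and gK: "good_chord K p q" and gL: "good_chord L p' q'"
    and len: "dist p q = dist p' q'" and ne: "cap K p q \<noteq> {}"
  shows "(\<lambda>\<zeta>. 1 - cnj \<zeta>) ` cap K p q = cap K p q \<or> cap K p q = cap L p' q' \<or>
    cap K p q = (\<lambda>\<zeta>. 1 - cnj \<zeta>) ` cap L p' q'"
proof -
  define d d' where "d = q - p" and "d' = q' - p'"
  have d0: "d \<noteq> 0" "d' \<noteq> 0" using gK gL by (auto simp: d_def d'_def good_chord_def)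
  have dd: "cmod d = cmod d'" using len by (simp add: d_def d'_def dist_norm norm_minus_commute)
  \<comment> \<open>\<open>p'\<close> goes to \<open>q\<close> and \<open>q'\<close> to
    \<open>p\<close>. The chords coincide with opposite directions, so the caps, each to the right
    of its own chord, lie on different sides.\<close>
  define u b where "u = - d / d'" and "b = q - u * p'"
  have u: "cmod u = 1" using dd d0 by (simp add: u_def norm_divide)
  have u0: "u \<noteq> 0" using u by auto
  define M where "M = K \<inter> (\<lambda>z. u * z + b) ` L"
  have psi: "u * (p' + d' * \<zeta>) + b = p + d * (1 - \<zeta>)" for \<zeta>
    using d0 by (simp add: u_def b_def d_def field_simps)
  have inM: "p + d * \<zeta> \<in> M \<longleftrightarrow> p + d * \<zeta> \<in> K \<and> p' + d' * (1 - \<zeta>) \<in> L" for \<zeta>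
  proof -
    have "p + d * \<zeta> \<in> (\<lambda>z. u * z + b) ` L \<longleftrightarrow> p' + d' * (1 - \<zeta>) \<in> L"
    proof
      assume "p + d * \<zeta> \<in> (\<lambda>z. u * z + b) ` L"
      then obtain z where z: "z \<in> L" "p + d * \<zeta> = u * z + b" by auto
      have "u * (p' + d' * (1 - \<zeta>)) + b = p + d * \<zeta>" using psi[of "1 - \<zeta>"] by simp
      then have "u * z = u * (p' + d' * (1 - \<zeta>))" using z(2) by (metis add_right_cancel)
      then have "z = p' + d' * (1 - \<zeta>)" using u0 by (metis mult_cancel_left)
      then show "p' + d' * (1 - \<zeta>) \<in> L" using z by simp
    next
      assume "p' + d' * (1 - \<zeta>) \<in> L"
      then show "p + d * \<zeta> \<in> (\<lambda>z. u * z + b) ` L"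
        using psi[of "1 - \<zeta>"] by (intro image_eqI[of _ _ "p' + d' * (1 - \<zeta>)"]) auto
    qed
    then show ?thesis by (auto simp: M_def)
  qed
  \<comment> \<open>Over its chord each set contains the triangle that receives the cap of the other
    one, so the intersection cuts nothing off either cap.\<close>
  have thickK: "p + d * \<zeta> \<in> K" if "0 \<le> Im \<zeta>" "Im \<zeta> \<le> Re \<zeta> / 4" "Im \<zeta> \<le> (1 - Re \<zeta>) / 4" for \<zeta>
    using thick_triangle[OF convex_coords[OF \<open>convex K\<close>, of p d], of \<zeta>] gK that
    by (auto simp: good_chord_def d_def)
  have thickL: "p' + d' * \<zeta> \<in> L" if "0 \<le> Im \<zeta>" "Im \<zeta> \<le> Re \<zeta> / 4" "Im \<zeta> \<le> (1 - Re \<zeta>) / 4" for \<zeta>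
    using thick_triangle[OF convex_coords[OF \<open>convex L\<close>, of p' d'], of \<zeta>] gL that
    by (auto simp: good_chord_def d'_def)
  have thinK: "- Im \<zeta> \<le> Re \<zeta> / 4 \<and> - Im \<zeta> \<le> (1 - Re \<zeta>) / 4" if "\<zeta> \<in> cap K p q" for \<zeta>
    using gK that unfolding good_chord_def by blast
  have thinL: "- Im \<zeta> \<le> Re \<zeta> / 4 \<and> - Im \<zeta> \<le> (1 - Re \<zeta>) / 4" if "\<zeta> \<in> cap L p' q'" for \<zeta>
    using gL that unfolding good_chord_def by blast
  have capK: "cap K p q = {\<zeta>. p + d * \<zeta> \<in> K \<and> Im \<zeta> < 0}" by (simp add: cap_def d_def)
  have capL: "cap L p' q' = {\<zeta>. p' + d' * \<zeta> \<in> L \<and> Im \<zeta> < 0}" by (simp add: cap_def d'_def)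
  define N where "N = {\<zeta>. p + d * \<zeta> \<in> M}"
  have lower: "\<zeta> \<in> N \<longleftrightarrow> \<zeta> \<in> cap K p q" if "Im \<zeta> < 0" for \<zeta>
  proof
    assume "\<zeta> \<in> cap K p q"
    then have "p' + d' * (1 - \<zeta>) \<in> L" using thinK[of \<zeta>] that by (intro thickL) auto
    with \<open>\<zeta> \<in> cap K p q\<close> show "\<zeta> \<in> N" by (simp add: N_def inM capK)
  qed (use that in \<open>auto simp: N_def inM capK\<close>)
  have upper: "\<zeta> \<in> N \<longleftrightarrow> 1 - \<zeta> \<in> cap L p' q'" if "Im \<zeta> > 0" for \<zeta>
  proof
    assume "1 - \<zeta> \<in> cap L p' q'"
    then have "p + d * \<zeta> \<in> K" using thinL[of "1 - \<zeta>"] that by (intro thickK) auto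
    with \<open>1 - \<zeta> \<in> cap L p' q'\<close> show "\<zeta> \<in> N" by (simp add: N_def inM capL)
  qed (use that in \<open>auto simp: N_def inM capL\<close>)
  have rhomb: "\<bar>Im \<zeta>\<bar> \<le> Re \<zeta> / 4 \<and> \<bar>Im \<zeta>\<bar> \<le> (1 - Re \<zeta>) / 4" if "\<zeta> \<in> N" for \<zeta>
  proof -
    consider "Im \<zeta> < 0" | "Im \<zeta> > 0" | "Im \<zeta> = 0" by linarith
    then show ?thesis
    proof cases
      case 1 then show ?thesis using lower thinK that by auto
    next
      case 2 then show ?thesis using upper thinL[of "1 - \<zeta>"] that by auto
    next
      case 3
      have "p + d * \<zeta> \<in> K" using that by (simp add: N_def inM)
      then have "p + (q - p) * \<zeta> \<in> K" by (simp add: d_def)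
      then show ?thesis
        using chord_line_section[OF \<open>convex K\<close> gK ne _ 3] 3 by simp
    qed
  qed
  have N01: "0 \<in> N" "1 \<in> N" using gK gL inM[of 0] inM[of 1] by (auto simp: N_def d_def d'_def good_chord_def)
  have cM: "convex M" unfolding M_def
  proof (intro convex_Int \<open>convex K\<close>)
    have "convex ((\<lambda>z. b + z) ` ((\<lambda>z. u * z) ` L))"
      by (intro convex_translation convex_linear_image bounded_linear.linear bounded_linear_mult_right \<open>convex L\<close>)
    then show "convex ((\<lambda>z. u * z + b) ` L)" by (simp add: image_image add.commute)
  qed
  have "interior M \<noteq> {}"
  proof
    assume "interior M = {}"
    then obtain a c where ac: "a \<noteq> 0" "M \<subseteq> {x. inner a x = c}"
      using empty_interior_subset_hyperplane[OF cM] by metis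
    obtain m where m: "m \<in> cap K p q" using ne by auto
    then have mI: "Im m < 0" by (simp add: cap_def)
    have "m \<in> N" using lower[OF mI] m by simp
    then have "inner a p = c" "inner a (p + d) = c" "inner a (p + d * m) = c"
      using ac N01 by (auto simp: N_def)
    then have e: "inner a d = 0" "inner a (d * m) = 0" by (auto simp: inner_add_right)
    have "inner a (d * m) = Re m * inner a d + Im m * inner a (\<i> * d)"
      by (simp add: inner_complex_def algebra_simps)
    then have "inner a (\<i> * d) = 0" using e mI by auto
    then show False using inner_mult_zero[OF e(1)] d0 ac by auto
  qed
  then obtain F where F: "isom F" "F \<noteq> id" "F ` M = M"
    using S u unfolding sym_inter_def inter_all_def M_def by blast
  define G where "G = (\<lambda>\<zeta>. (F (p + d * \<zeta>) - p) / d)"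
  have G: "isom G" unfolding G_def by (rule isom_similarity) (use F d0 in auto)
  have FG: "F (p + d * \<zeta>) = p + d * G \<zeta>" for \<zeta> using d0 by (simp add: G_def)
  have Gid: "G \<noteq> id"
  proof
    assume "G = id"
    then have "F z = z" for z using FG[of "(z - p) / d"] d0 by simp
    then show False using F by auto
  qed
  have GN: "G \<zeta> \<in> N" if "\<zeta> \<in> N" for \<zeta>
  proof -
    have "F (p + d * \<zeta>) \<in> F ` M" using that by (simp add: N_def)
    then show ?thesis by (simp add: F(3) FG N_def)
  qed
  have "{G 0, G 1} = {0, 1}"
  proof (rule rhombus_diameter)
    have "dist (G 0) (G 1) = 1" using G by (simp add: isom_def)
    then show "1 \<le> cmod (G 0 - G 1)" by (simp add: dist_norm)
  qed (use rhomb[OF GN[OF N01(1)]] rhomb[OF GN[OF N01(2)]] in auto)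
  \<comment> \<open>\<open>cnj\<close> exchanges the caps by the reflection in the chord,
    \<open>1 - z\<close> exchanges them by a half-turn, and \<open>1 - cnj z\<close> reflects each
    cap in the perpendicular bisector of the chord.\<close>
  with isom_permuting_01[OF G] Gid
  consider "G = cnj" | "G = (\<lambda>z. 1 - z)" | "G = (\<lambda>z. 1 - cnj z)" by auto
  then show ?thesis
  proof cases
    case 1
    have GG: "cnj \<zeta> \<in> N \<longleftrightarrow> \<zeta> \<in> N" for \<zeta> using GN[of \<zeta>] GN[of "cnj \<zeta>"] 1 by auto
    have swap: "\<zeta> \<in> cap K p q \<longleftrightarrow> 1 - cnj \<zeta> \<in> cap L p' q'" if "Im \<zeta> < 0" for \<zeta>
      using lower[of \<zeta>] upper[of "cnj \<zeta>"] GG[of \<zeta>] that by auto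
    have "cap K p q = (\<lambda>\<zeta>. 1 - cnj \<zeta>) ` cap L p' q'"
    proof (intro equalityI subsetI)
      fix x assume x: "x \<in> cap K p q"
      then have "Im x < 0" by (simp add: cap_def)
      then show "x \<in> (\<lambda>\<zeta>. 1 - cnj \<zeta>) ` cap L p' q'"
        using swap x by (intro image_eqI[of _ _ "1 - cnj x"]) auto
    next
      fix x assume "x \<in> (\<lambda>\<zeta>. 1 - cnj \<zeta>) ` cap L p' q'"
      then obtain y where y: "y \<in> cap L p' q'" "x = 1 - cnj y" by auto
      then have "Im x < 0" by (simp add: cap_def)
      then show "x \<in> cap K p q" using swap y by simp
    qed
    then show ?thesis by blast
  next
    case 2
    have GG: "1 - \<zeta> \<in> N \<longleftrightarrow> \<zeta> \<in> N" for \<zeta> using GN[of \<zeta>] GN[of "1 - \<zeta>"] 2 by auto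
    have "\<zeta> \<in> cap K p q \<longleftrightarrow> \<zeta> \<in> cap L p' q'" if "Im \<zeta> < 0" for \<zeta>
      using lower[of \<zeta>] upper[of "1 - \<zeta>"] GG[of \<zeta>] that by auto
    then have "cap K p q = cap L p' q'"
      by (auto simp: cap_def)
    then show ?thesis by blast
  next
    case 3
    have GG: "1 - cnj \<zeta> \<in> N \<longleftrightarrow> \<zeta> \<in> N" for \<zeta> using GN[of \<zeta>] GN[of "1 - cnj \<zeta>"] 3 by auto
    have "\<zeta> \<in> cap K p q \<longleftrightarrow> 1 - cnj \<zeta> \<in> cap K p q" if "Im \<zeta> < 0" for \<zeta>
      using lower[of \<zeta>] lower[of "1 - cnj \<zeta>"] GG[of \<zeta>] that by auto
    then have sym: "1 - cnj \<zeta> \<in> cap K p q" if "\<zeta> \<in> cap K p q" for \<zeta>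
      using that unfolding cap_def by blast
    have "(\<lambda>\<zeta>. 1 - cnj \<zeta>) ` cap K p q = cap K p q"
    proof (intro equalityI subsetI)
      fix x assume "x \<in> cap K p q"
      then show "x \<in> (\<lambda>\<zeta>. 1 - cnj \<zeta>) ` cap K p q"
        using sym by (intro image_eqI[of _ _ "1 - cnj x"]) auto
    qed (use sym in auto)
    then show ?thesis by blast
  qed
qed

section \<open>Infinitesimal motions tangent to the boundary\<close>

text \<open>The zero vector counts as a normal, so that the displacement from a nearest point is one
  even when it starts from a point of \<open>K\<close>.\<close>

definition outer_normal :: "complex set \<Rightarrow> complex \<Rightarrow> complex \<Rightarrow> bool" where
  "outer_normal K x n \<longleftrightarrow> (\<forall>z\<in>K. inner n (z - x) \<le> 0)"

text \<open>The velocity field of a one-parameter group of motions: a rotation with angular velocity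
  \<open>\<omega>\<close>, or a translation if \<open>\<omega> = 0\<close>.\<close>

definition kfield :: "real \<Rightarrow> complex \<Rightarrow> complex \<Rightarrow> complex" where
  "kfield \<omega> \<beta> z = \<i> * of_real \<omega> * z + \<beta>"

definition tangent_on :: "complex set \<Rightarrow> real \<Rightarrow> complex \<Rightarrow> complex set \<Rightarrow> bool" where
  "tangent_on K \<omega> \<beta> U \<longleftrightarrow> (\<forall>m\<in>K \<inter> U. \<forall>n. outer_normal K m n \<longrightarrow> inner n (kfield \<omega> \<beta> m) = 0)"

text \<open>\<open>(u k - 1, b k)\<close> divided by its size \<open>N k\<close> has a limit point
  of size 1, which is the field; \<open>|u k| = 1\<close> makes its linear part purely imaginary.
  Both the motion and its inverse keep \<open>m\<close> in \<open>K\<close>, so a normal at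
  \<open>m\<close> has non-positive product with the field and with its negative.\<close>

lemma infinitesimal_motion:
  fixes u b :: "nat \<Rightarrow> complex"
  assumes u: "\<And>k. cmod (u k) = 1" and nt: "\<And>k. u k \<noteq> 1 \<or> b k \<noteq> 0"
    and ul: "u \<longlonglongrightarrow> 1" and bl: "b \<longlonglongrightarrow> 0"
    and inK: "\<And>m n. m \<in> S \<Longrightarrow> outer_normal K m n \<Longrightarrow> n \<noteq> 0 \<Longrightarrow>
       eventually (\<lambda>k. u k * m + b k \<in> K \<and> (m - b k) / u k \<in> K) sequentially"
  obtains \<omega> \<beta> where "\<omega> \<noteq> 0 \<or> \<beta> \<noteq> 0" "\<And>m n. m \<in> S \<Longrightarrow> outer_normal K m n \<Longrightarrow> inner n (kfield \<omega> \<beta> m) = 0"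
proof -
  define N where "N k = cmod (u k - 1) + cmod (b k)" for k
  have N: "N k > 0" for k
    using nt[of k] by (auto simp: N_def intro: add_pos_nonneg add_nonneg_pos)
  define X where "X k = (u k - 1) / of_real (N k)" for k
  define Y where "Y k = b k / of_real (N k)" for k
  have NXY: "of_real (N k) * (X k * m + Y k) = (u k - 1) * m + b k" for k m
    using N[of k] by (simp add: X_def Y_def distrib_left)
  have XY: "cmod (X k) + cmod (Y k) = 1" for k
    using N[of k] by (simp add: X_def Y_def norm_divide add_divide_distrib[symmetric]) (simp add: N_def)
  have "bounded (range (\<lambda>k. (X k, Y k)))"
  proof (rule boundedI)
    fix z assume "z \<in> range (\<lambda>k. (X k, Y k))"
    then obtain k where "z = (X k, Y k)" by auto
    then show "norm z \<le> 1" using XY[of k] norm_Pair_le[of "X k" "Y k"] by simp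
  qed
  then obtain l r where r: "strict_mono r" and l: "((\<lambda>k. (X k, Y k)) \<circ> r) \<longlonglongrightarrow> l"
    using bounded_imp_convergent_subsequence by blast
  define \<mu> \<beta> where "\<mu> = fst l" and "\<beta> = snd l"
  have Xl: "(\<lambda>k. X (r k)) \<longlonglongrightarrow> \<mu>" and Yl: "(\<lambda>k. Y (r k)) \<longlonglongrightarrow> \<beta>"
    using tendsto_fst[OF l] tendsto_snd[OF l] by (simp_all add: o_def \<mu>_def \<beta>_def)
  have ul': "(\<lambda>k. u (r k)) \<longlonglongrightarrow> 1" using LIMSEQ_subseq_LIMSEQ[OF ul r] by (simp add: o_def)
  have bl': "(\<lambda>k. b (r k)) \<longlonglongrightarrow> 0" using LIMSEQ_subseq_LIMSEQ[OF bl r] by (simp add: o_def)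
  have "(\<lambda>k. cmod (X (r k)) + cmod (Y (r k))) \<longlonglongrightarrow> cmod \<mu> + cmod \<beta>"
    by (intro tendsto_intros Xl Yl)
  then have n1: "cmod \<mu> + cmod \<beta> = 1" by (simp add: XY LIMSEQ_const_iff)
  \<comment> \<open>The circle \<open>|u| = 1\<close> deviates from its tangent at 1 only to second
    order; after division by \<open>N k\<close> the real part still tends to 0.\<close>
  have re: "2 * Re (X k) = - (cmod (u k - 1) * cmod (X k))" for k
  proof -
    have "(cmod (u k))\<^sup>2 = 1" using u by simp
    then have "2 * Re (u k - 1) = - (cmod (u k - 1))\<^sup>2"
      unfolding cmod_power2 by (simp add: power2_eq_square algebra_simps)
    moreover have "2 * Re (X k) = 2 * Re (u k - 1) / N k"
      by (simp add: X_def Re_divide_of_real)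
    moreover have "cmod (X k) = cmod (u k - 1) / N k"
      using N[of k] by (simp add: X_def norm_divide)
    ultimately show ?thesis by (simp add: power2_eq_square)
  qed
  have "(\<lambda>k. 2 * Re (X (r k))) \<longlonglongrightarrow> - (cmod (1 - 1) * cmod \<mu>)"
    unfolding re by (intro tendsto_intros Xl ul')
  moreover have "(\<lambda>k. 2 * Re (X (r k))) \<longlonglongrightarrow> 2 * Re \<mu>"
    by (intro tendsto_intros Xl)
  ultimately have "2 * Re \<mu> = - (cmod (1 - 1) * cmod \<mu>)" by (rule LIMSEQ_unique[rotated])
  then have mu: "\<mu> = \<i> * of_real (Im \<mu>)" by (simp add: complex_eq_iff)
  show thesis
  proof
    show "Im \<mu> \<noteq> 0 \<or> \<beta> \<noteq> 0" using n1 mu by auto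
    fix m n assume m: "m \<in> S" and n: "outer_normal K m n"
    show "inner n (kfield (Im \<mu>) \<beta> m) = 0"
    proof (cases "n = 0")
      case False
      have "eventually (\<lambda>k. u k * m + b k \<in> K \<and> (m - b k) / u k \<in> K) sequentially"
        using inK[OF m n False] .
      then have ev: "eventually (\<lambda>k. u (r k) * m + b (r k) \<in> K \<and> (m - b (r k)) / u (r k) \<in> K) sequentially"
        using eventually_subseq[OF r] by blast
      have v: "kfield (Im \<mu>) \<beta> m = \<mu> * m + \<beta>" using mu by (simp add: kfield_def)
      have le: "inner n z \<le> 0" if "w + of_real c * z = m" "w \<in> K" "c < 0" for w z c
      proof -
        have "inner n (w - m) \<le> 0" using n that(2) unfolding outer_normal_def by blast
        moreover have "w - m = (- c) *\<^sub>R z" using that(1) by (auto simp: scaleR_conv_of_real algebra_simps)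
        ultimately show ?thesis using that(3) by (simp add: zero_le_mult_iff)
      qed
      have 1: "inner n (\<mu> * m + \<beta>) \<le> 0"
      proof (rule tendsto_upperbound)
        show "((\<lambda>k. inner n (X (r k) * m + Y (r k))) \<longlongrightarrow> inner n (\<mu> * m + \<beta>)) sequentially"
          by (intro tendsto_intros Xl Yl)
        show "eventually (\<lambda>k. inner n (X (r k) * m + Y (r k)) \<le> 0) sequentially"
          using ev
        proof eventually_elim
          case (elim k)
          show ?case
            by (rule le[of "u (r k) * m + b (r k)" "- N (r k)"])
              (use N[of "r k"] elim NXY[of "r k" m] in \<open>auto simp: left_diff_distrib\<close>)
        qed
      qed simp
      \<comment> \<open>The same estimate for the inverse motion; the quotient by 1 is the limit of
        its factor \<open>1 / u (r k)\<close>.\<close>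
      have 2: "inner n (- (\<mu> * m + \<beta>) / 1) \<le> 0"
      proof (rule tendsto_upperbound)
        show "((\<lambda>k. inner n (- (X (r k) * m + Y (r k)) / u (r k))) \<longlongrightarrow> inner n (- (\<mu> * m + \<beta>) / 1)) sequentially"
          by (intro tendsto_intros Xl Yl ul') auto
        show "eventually (\<lambda>k. inner n (- (X (r k) * m + Y (r k)) / u (r k)) \<le> 0) sequentially"
          using ev
        proof eventually_elim
          case (elim k)
          have "u (r k) \<noteq> 0" using u[of "r k"] by auto
          have "(m - b (r k)) / u (r k) + of_real (- N (r k)) * (- (X (r k) * m + Y (r k)) / u (r k))
              = (m - b (r k) + of_real (N (r k)) * (X (r k) * m + Y (r k))) / u (r k)"
            by (simp only: mult_minus_left mult_minus_right minus_mult_minus times_divide_eq_right minus_divide_left[symmetric] of_real_minus minus_minus add_divide_distrib[of "m - b (r k)"])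
          also have "\<dots> = m"
            unfolding NXY using \<open>u (r k) \<noteq> 0\<close> by (simp add: left_diff_distrib)
          finally show ?case
            by (rule le) (use N[of "r k"] elim in auto)
        qed
      qed simp
      have "- inner n (\<mu> * m + \<beta>) \<le> 0" using 2 by (simp only: div_by_1 inner_minus_right)
      then show ?thesis using 1 v by simp
    qed simp
  qed
qed

text \<open>The slope \<open>1/20\<close> at scale \<open>\<tau>\<close> gives the Lipschitz constant \<open>1/10\<close> at scale \<open>\<tau>/2\<close>, which is
  small enough for all chords there to be good.\<close>

locale boundary_graph =
  fixes K :: "complex set" and f :: "real \<Rightarrow> real" and \<tau> :: real
  assumes convex: "convex K" and \<tau>: "0 < \<tau>"
    and graph: "\<bar>s\<bar> \<le> \<tau> \<Longrightarrow> Complex s (f s) \<in> K"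
    and above: "\<bar>s\<bar> \<le> \<tau> \<Longrightarrow> Complex s y \<in> K \<Longrightarrow> f s \<le> y"
    and nonneg: "\<bar>s\<bar> \<le> \<tau> \<Longrightarrow> 0 \<le> f s"
    and flat: "\<bar>s\<bar> \<le> \<tau> \<Longrightarrow> f s \<le> \<bar>s\<bar> / 20"
    and top: "\<bar>s\<bar> \<le> \<tau> \<Longrightarrow> Complex s \<tau> \<in> K"
begin

definition pt :: "real \<Rightarrow> complex" where "pt s = Complex s (f s)"

lemma Re_pt [simp]: "Re (pt s) = s" and Im_pt [simp]: "Im (pt s) = f s"
  by (simp_all add: pt_def)

lemma fill:
  assumes "\<bar>s\<bar> \<le> \<tau>" "f s \<le> y" "y \<le> \<tau>"
  shows "Complex s y \<in> K"
proof (cases "f s = y")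
  case False
  define e where "e = (y - f s) / (\<tau> - f s)"
  have e: "0 \<le> e" "e \<le> 1" "e * (\<tau> - f s) = y - f s" using assms False by (auto simp: e_def)
  have "(1 - e) *\<^sub>R Complex s (f s) + e *\<^sub>R Complex s \<tau> \<in> K"
    using convexD[OF convex graph[OF assms(1)] top[OF assms(1)], of "1 - e" e] e by simp
  moreover have "(1 - e) *\<^sub>R Complex s (f s) + e *\<^sub>R Complex s \<tau> = Complex s y"
    using e by (simp add: complex_eq_iff algebra_simps)
  ultimately show ?thesis by simp
qed (use graph assms in auto)

lemma below_segment:
  assumes "z \<in> K" "w \<in> K" "0 \<le> e" "e \<le> 1" "(1 - e) * Re z + e * Re w = s" "\<bar>s\<bar> \<le> \<tau>"
  shows "f s \<le> (1 - e) * Im z + e * Im w"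
proof -
  have "(1 - e) *\<^sub>R z + e *\<^sub>R w \<in> K"
    using convexD[OF convex assms(1,2), of "1 - e" e] assms by simp
  moreover have "(1 - e) *\<^sub>R z + e *\<^sub>R w = Complex s ((1 - e) * Im z + e * Im w)"
    using assms(5) by (simp add: complex_eq_iff)
  ultimately show ?thesis using above[OF assms(6)] by simp
qed

text \<open>Convexity of \<open>f\<close> with denominators cleared. The ends are arbitrary points
  of \<open>K\<close>, not necessarily on the graph or over the interval on which it is
  described.\<close>

lemma slope:
  assumes "z \<in> K" "w \<in> K" "Re z < s" "s < Re w" "\<bar>s\<bar> \<le> \<tau>"
  shows "f s * (Re w - Re z) \<le> (Re w - s) * Im z + (s - Re z) * Im w"
proof -
  define e where "e = (s - Re z) / (Re w - Re z)"
  have e: "0 \<le> e" "e \<le> 1" "e * (Re w - Re z) = s - Re z" using assms by (auto simp: e_def)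
  have "f s \<le> (1 - e) * Im z + e * Im w"
    by (rule below_segment) (use assms e in \<open>auto simp: algebra_simps\<close>)
  then have "f s * (Re w - Re z) \<le> ((1 - e) * Im z + e * Im w) * (Re w - Re z)"
    using assms by (intro mult_right_mono) auto
  also have "\<dots> = ((Re w - Re z) - e * (Re w - Re z)) * Im z + (e * (Re w - Re z)) * Im w"
    by (simp add: algebra_simps)
  also have "\<dots> = (Re w - s) * Im z + (s - Re z) * Im w" unfolding e(3) by simp
  finally show ?thesis .
qed

text \<open>The secant from \<open>a\<close> to \<open>b\<close> is compared with secants ending at
  \<open>\<tau>\<close> and \<open>-\<tau>\<close>. Their rise is at most \<open>\<tau> / 20\<close>
  over a length of at least \<open>\<tau> / 2\<close>, whence the constant 1/10.\<close>

lemma lipschitz_aux: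
  assumes "\<bar>a\<bar> \<le> \<tau> / 2" "\<bar>b\<bar> \<le> \<tau> / 2" "a < b"
  shows "\<bar>f b - f a\<bar> \<le> (b - a) / 10"
proof -
  have "f b * (\<tau> - a) \<le> (\<tau> - b) * f a + (b - a) * f \<tau>"
    using slope[of "pt a" "pt \<tau>" b] graph assms \<tau> by (auto simp: pt_def)
  then have "(f b - f a) * (\<tau> - a) \<le> (b - a) * (f \<tau> - f a)" by (simp add: algebra_simps)
  also have "\<dots> \<le> (b - a) * (\<tau> / 20)"
    using assms flat[of \<tau>] nonneg[of a] \<tau> by (intro mult_left_mono) auto
  finally have 1: "(f b - f a) * (\<tau> - a) \<le> (b - a) * (\<tau> / 20)" .
  have "f b - f a \<le> (b - a) / 10"
  proof (rule ccontr)
    assume "\<not> f b - f a \<le> (b - a) / 10"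
    then have "(b - a) / 10 * (\<tau> / 2) < (f b - f a) * (\<tau> - a)"
      using assms \<tau> by (intro mult_less_le_imp_less) auto
    then show False using 1 by simp
  qed
  have "f a * (b + \<tau>) \<le> (b - a) * f (-\<tau>) + (a + \<tau>) * f b"
    using slope[of "pt (-\<tau>)" "pt b" a] graph assms \<tau> by (auto simp: pt_def)
  then have "(f a - f b) * (b + \<tau>) \<le> (b - a) * (f (-\<tau>) - f b)" by (simp add: algebra_simps)
  also have "\<dots> \<le> (b - a) * (\<tau> / 20)"
    using assms flat[of "-\<tau>"] nonneg[of b] \<tau> by (intro mult_left_mono) auto
  finally have 2: "(f a - f b) * (b + \<tau>) \<le> (b - a) * (\<tau> / 20)" .
  have "f a - f b \<le> (b - a) / 10"
  proof (rule ccontr)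
    assume "\<not> f a - f b \<le> (b - a) / 10"
    then have "(b - a) / 10 * (\<tau> / 2) < (f a - f b) * (b + \<tau>)"
      using assms \<tau> by (intro mult_less_le_imp_less) auto
    then show False using 2 by simp
  qed
  with \<open>f b - f a \<le> (b - a) / 10\<close> show ?thesis by linarith
qed

lemma lipschitz:
  assumes "\<bar>a\<bar> \<le> \<tau> / 2" "\<bar>b\<bar> \<le> \<tau> / 2"
  shows "\<bar>f b - f a\<bar> \<le> \<bar>b - a\<bar> / 10"
  using lipschitz_aux[of a b] lipschitz_aux[of b a] assms
  by (cases a b rule: linorder_cases) (auto simp: abs_minus_commute)

lemma continuous_f: "continuous_on {-\<tau>/2..\<tau>/2} f"
proof (rule continuous_on_subset[OF lipschitz_on_continuous_on])
  show "(1/10)-lipschitz_on {-\<tau>/2..\<tau>/2} f"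
    by (rule lipschitz_onI) (use lipschitz in \<open>auto simp: dist_real_def abs_minus_commute\<close>)
qed auto

end

section \<open>Chords of a boundary graph and their caps\<close>

context boundary_graph
begin

lemma pt_diff: "pt t - pt s = Complex (t - s) (f t - f s)"
  by (simp add: complex_eq_iff)

lemma Im_coord:
  assumes "s < t"
  shows "Im ((z - pt s) / (pt t - pt s)) < 0 \<longleftrightarrow>
    (t - s) * (Im z - f s) < (f t - f s) * (Re z - s)"
proof -
  have "(t - s)\<^sup>2 + (f t - f s)\<^sup>2 > 0" using assms by (simp add: add_pos_nonneg)
  then show ?thesis
    by (simp add: Im_divide divide_less_0_iff algebra_simps)
qed

text \<open>A point of \<open>K\<close> below the chord line but beyond or over an end would put a
  point of \<open>K\<close> below that end: either the point itself or one on its segment to the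
  other end. The ends are the lowest points of \<open>K\<close> on their verticals.\<close>

lemma below_chord_between:
  assumes "-\<tau>/2 \<le> s" "s < t" "t \<le> \<tau>/2" "z \<in> K" "(t - s) * (Im z - f s) < (f t - f s) * (Re z - s)"
  shows "s < Re z" "Re z < t"
proof -
  have st: "\<bar>s\<bar> \<le> \<tau>" "\<bar>t\<bar> \<le> \<tau>" using assms by auto
  have ps: "pt s \<in> K" "pt t \<in> K" using graph st by (auto simp: pt_def)
  show "s < Re z"
  proof (rule ccontr)
    assume "\<not> s < Re z"
    then consider "Re z = s" | "Re z < s" by linarith
    then show False
    proof cases
      case 1
      then have "f s \<le> Im z" using above[OF st(1), of "Im z"] assms(4) by (metis complex.collapse)
      then have "0 \<le> (t - s) * (Im z - f s)" using assms(2) by simp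
      then show ?thesis using assms(5) 1 by simp
    next
      case 2
      have "f s * (t - Re z) \<le> (t - s) * Im z + (s - Re z) * f t"
        using slope[OF assms(4) ps(2) 2] assms(2) st by simp
      then show ?thesis using assms(5) by (simp add: algebra_simps)
    qed
  qed
  show "Re z < t"
  proof (rule ccontr)
    assume "\<not> Re z < t"
    then consider "Re z = t" | "t < Re z" by linarith
    then show False
    proof cases
      case 1
      then have "f t \<le> Im z" using above[OF st(2), of "Im z"] assms(4) by (metis complex.collapse)
      then have "(t - s) * (f t - f s) \<le> (t - s) * (Im z - f s)"
        using assms(2) by (intro mult_left_mono) auto
      then show ?thesis using assms(5) 1 by (simp add: mult.commute)
    next
      case 2
      have "f t * (Re z - s) \<le> (Re z - t) * f s + (t - s) * Im z"
        using slope[OF ps(1) assms(4) _ 2] assms(2) st by simp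
      then show ?thesis using assms(5) by (simp add: algebra_simps)
    qed
  qed
qed

text \<open>In coordinates multiplied by \<open>N\<close>, slopes of at most 1/10 bound the depth by
  \<open>D * X / 5\<close> and the distance from the left end from below by
  \<open>99 / 100 * D * X\<close>; 1/5 is less than a quarter of 99/100. The right end is treated
  alike with \<open>D - X\<close>.\<close>

lemma good_chord_pt:
  assumes "-\<tau>/2 \<le> s" "s < t" "t \<le> \<tau>/2"
  shows "good_chord K (pt s) (pt t)"
  unfolding good_chord_def
proof (intro conjI ballI)
  define D \<Delta> where "D = t - s" and "\<Delta> = f t - f s"
  have D: "0 < D" "D \<le> \<tau>" using assms by (auto simp: D_def)
  have \<Delta>: "\<bar>\<Delta>\<bar> \<le> D / 10" using lipschitz[of s t] assms by (auto simp: D_def \<Delta>_def)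
  have qp: "pt t - pt s = Complex D \<Delta>" by (simp add: pt_diff D_def \<Delta>_def)
  show "pt s \<in> K" "pt t \<in> K" using graph assms by (auto simp: pt_def)
  show "pt s \<noteq> pt t" using assms by (metis Re_pt less_irrefl)
  show "pt s + (pt t - pt s) * Complex (1/2) (1/8) \<in> K"
  proof -
    \<comment> \<open>The abscissa of the apex over the middle of the chord. The factor 41/80 below
      is \<open>1/2 + 1/80\<close>, because \<open>|\<Delta>| / 8\<close> is at most
      \<open>D / 80\<close>.\<close>
    define a where "a = s + D / 2 - \<Delta> / 8"
    have "- D / 10 \<le> \<Delta>" "\<Delta> \<le> D / 10" "t = s + D" using \<Delta> by (auto simp: D_def)
    then have a: "\<bar>a - s\<bar> \<le> D * 41 / 80" "s \<le> a" "a \<le> t"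
      unfolding abs_le_iff using D a_def by linarith+
    have "\<bar>f a - f s\<bar> \<le> \<bar>a - s\<bar> / 10" using lipschitz[of s a] a assms by auto
    then have "f a - f s \<le> \<bar>a - s\<bar> / 10" by (rule order_trans[OF abs_ge_self])
    also have "\<dots> \<le> (D * 41 / 80) / 10" using a(1) by (intro divide_right_mono) auto
    finally have fa: "f a \<le> f s + D * 41 / 800" by simp
    have "\<bar>s\<bar> \<le> \<tau> / 2" using assms by auto
    then have "f s \<le> \<tau> / 40" using flat[of s] \<tau> by simp
    then have "Complex a (f s + \<Delta> / 2 + D / 8) \<in> K"
      using fa a assms \<Delta> D by (intro fill) (auto simp: abs_if split: if_splits)
    moreover have "pt s + (pt t - pt s) * Complex (1/2) (1/8) = Complex a (f s + \<Delta> / 2 + D / 8)"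
      unfolding qp by (simp add: complex_eq_iff a_def)
    ultimately show ?thesis by simp
  qed
  fix \<zeta> assume "\<zeta> \<in> cap K (pt s) (pt t)"
  then have \<zeta>: "pt s + (pt t - pt s) * \<zeta> \<in> K" "Im \<zeta> < 0" by (auto simp: cap_def)
  define z where "z = pt s + (pt t - pt s) * \<zeta>"
  define X Y where "X = Re z - s" and "Y = Im z - f s"
  have XY: "X = D * Re \<zeta> - \<Delta> * Im \<zeta>" "Y = \<Delta> * Re \<zeta> + D * Im \<zeta>"
    by (simp_all add: X_def Y_def z_def qp)
  define N where "N = D\<^sup>2 + \<Delta>\<^sup>2"
  have N: "N > 0" using D by (simp add: N_def add_pos_nonneg)
  have NRe: "N * Re \<zeta> = D * X + \<Delta> * Y" and NIm: "N * Im \<zeta> = D * Y - \<Delta> * X"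
    by (simp_all add: N_def XY power2_eq_square algebra_simps)
  have "N * Im \<zeta> < 0" using N \<zeta> by (simp add: mult_pos_neg)
  then have low: "D * Y < \<Delta> * X" by (simp add: NIm)
  then have z: "s < Re z" "Re z < t"
    using below_chord_between[OF assms, of z] \<zeta>(1) by (auto simp: z_def X_def Y_def D_def \<Delta>_def)
  then have X: "0 < X" "0 < D - X" by (auto simp: X_def D_def)
  have zK: "Complex (Re z) (Im z) \<in> K" using \<zeta>(1) unfolding z_def[symmetric] by simp
  have fz: "f (Re z) \<le> Im z" using above[OF _ zK] z assms by auto
  \<comment> \<open>The point lies above the graph and below the chord. The first fact bounds its
    height from below through the Lipschitz constant, the second will bound it from above through
    the slope of the chord.\<close>
  have "\<bar>f (Re z) - f s\<bar> \<le> \<bar>Re z - s\<bar> / 10" "\<bar>f t - f (Re z)\<bar> \<le> \<bar>t - Re z\<bar> / 10"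
    using lipschitz[of s "Re z"] lipschitz[of "Re z" t] z assms by auto
  then have Y: "- X / 10 \<le> Y" "\<Delta> - Y \<le> (D - X) / 10"
    using fz z by (auto simp: X_def Y_def \<Delta>_def D_def abs_if split: if_splits)
  have dx: "\<bar>\<Delta> * X\<bar> \<le> D * X / 10" "\<bar>\<Delta> * (D - X)\<bar> \<le> D * (D - X) / 10"
    using mult_right_mono[OF \<Delta>, of X] mult_right_mono[OF \<Delta>, of "D - X"] X by (auto simp: abs_mult)
  have "D * Y < D * (X / 10)" using low abs_le_D1[OF dx(1)] by simp
  then have Y2: "Y < X / 10" using D by simp
  have absY: "\<bar>Y\<bar> \<le> X / 10" using Y(1) Y2 unfolding abs_le_iff by simp
  have "D * (\<Delta> - Y) > \<Delta> * (D - X)" using low by (simp add: algebra_simps)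
  moreover have "- (D * (D - X) / 10) \<le> \<Delta> * (D - X)" using abs_le_D2[OF dx(2)] by simp
  moreover have "D * (- (D - X) / 10) = - (D * (D - X) / 10)" by (simp add: field_simps)
  ultimately have "D * (- (D - X) / 10) < D * (\<Delta> - Y)" by linarith
  then have Y3: "- (D - X) / 10 < \<Delta> - Y" using D by (metis mult_less_cancel_left_pos)
  have absY': "\<bar>\<Delta> - Y\<bar> \<le> (D - X) / 10" using Y(2) Y3 unfolding abs_le_iff by simp
  have DY: "\<bar>D * Y\<bar> \<le> D * X / 10" "\<bar>D * (\<Delta> - Y)\<bar> \<le> D * (D - X) / 10"
    using mult_left_mono[OF absY, of D] mult_left_mono[OF absY', of D] D by (auto simp: abs_mult)
  have dy: "\<bar>\<Delta> * Y\<bar> \<le> D / 10 * (X / 10)" "\<bar>\<Delta> * (\<Delta> - Y)\<bar> \<le> D / 10 * ((D - X) / 10)"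
    unfolding abs_mult using mult_mono[OF \<Delta> absY] mult_mono[OF \<Delta> absY'] D by auto
  have pos: "0 < D * X" "0 < D * (D - X)" using D X by auto
  have "N * (- Im \<zeta>) \<le> N * (Re \<zeta> / 4)"
  proof -
    have "N * (- Im \<zeta>) = \<Delta> * X - D * Y" "N * (Re \<zeta> / 4) = (D * X + \<Delta> * Y) / 4"
      using NRe NIm by auto
    then show ?thesis using abs_le_D1[OF dx(1)] abs_le_D2[OF DY(1)] abs_le_D2[OF dy(1)] pos(1) by simp
  qed
  then show "- Im \<zeta> \<le> Re \<zeta> / 4" using N by (metis mult_le_cancel_left_pos)
  have "N * (- Im \<zeta>) \<le> N * ((1 - Re \<zeta>) / 4)"
  proof -
    have "N * (- Im \<zeta>) = D * (\<Delta> - Y) - \<Delta> * (D - X)" "N * (1 - Re \<zeta>) = D * (D - X) + \<Delta> * (\<Delta> - Y)"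
      using NRe NIm by (auto simp: N_def power2_eq_square algebra_simps)
    then show ?thesis using abs_le_D2[OF dx(2)] abs_le_D1[OF DY(2)] abs_le_D2[OF dy(2)] pos(2) by simp
  qed
  then show "- Im \<zeta> \<le> (1 - Re \<zeta>) / 4" using N by (metis mult_le_cancel_left_pos)
qed

text \<open>One point of \<open>K\<close> strictly below the chord pulls the whole open arc below
  it: over \<open>a\<close>, either this point itself or its segment to one end of the chord is
  strictly below the chord, and the graph is not higher.\<close>

lemma pt_in_cap:
  assumes "-\<tau>/2 \<le> s" "s < t" "t \<le> \<tau>/2" "s < a" "a < t" "cap K (pt s) (pt t) \<noteq> {}"
  shows "(pt a - pt s) / (pt t - pt s) \<in> cap K (pt s) (pt t)"
proof -
  obtain \<zeta> where \<zeta>: "pt s + (pt t - pt s) * \<zeta> \<in> K" "Im \<zeta> < 0" using assms(6) by (auto simp: cap_def)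
  define z where "z = pt s + (pt t - pt s) * \<zeta>"
  have ne: "pt t - pt s \<noteq> 0" using assms by (metis Re_pt less_irrefl eq_iff_diff_eq_0)
  then have "(z - pt s) / (pt t - pt s) = \<zeta>" by (simp add: z_def)
  then have low: "(t - s) * (Im z - f s) < (f t - f s) * (Re z - s)"
    using Im_coord[OF assms(2), of z] \<zeta> by simp
  have zK: "z \<in> K" using \<zeta> by (simp add: z_def)
  note z = below_chord_between[OF assms(1-3) zK low]
  have ps: "pt s \<in> K" "pt t \<in> K" "pt a \<in> K" using graph assms by (auto simp: pt_def)
  have a: "\<bar>a\<bar> \<le> \<tau>" using assms by auto
  have "(t - s) * (f a - f s) < (f t - f s) * (a - s)"
  proof -
    consider "Re z = a" | "a < Re z" | "Re z < a" by linarith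
    then show ?thesis
    proof cases
      case 1
      then have "f a \<le> Im z" using above[OF a, of "Im z"] zK by (metis complex.collapse)
      then have "(t - s) * (f a - f s) \<le> (t - s) * (Im z - f s)"
        using assms(2) by (intro mult_left_mono) auto
      then show ?thesis using low 1 by simp
    next
      case 2
      have "f a * (Re z - s) \<le> (Re z - a) * f s + (a - s) * Im z"
        using slope[OF ps(1) zK _ 2 a] assms by simp
      then have "(t - s) * ((f a - f s) * (Re z - s)) \<le> (t - s) * ((a - s) * (Im z - f s))"
        using assms by (intro mult_left_mono) (auto simp: algebra_simps)
      also have "\<dots> = (a - s) * ((t - s) * (Im z - f s))" by simp
      also have "\<dots> < (a - s) * ((f t - f s) * (Re z - s))"
        using low assms by (intro mult_strict_left_mono) auto
      finally have "(t - s) * (f a - f s) * (Re z - s) < (f t - f s) * (a - s) * (Re z - s)"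
        by (simp add: mult_ac)
      then show ?thesis using z by (simp add: mult_less_cancel_right)
    next
      case 3
      have "f a * (t - Re z) \<le> (t - a) * Im z + (a - Re z) * f t"
        using slope[OF zK ps(2) 3 _ a] assms by simp
      then have "(t - s) * ((t - a) * (f t - Im z)) \<le> (t - s) * ((f t - f a) * (t - Re z))"
        using assms by (intro mult_left_mono) (auto simp: algebra_simps)
      moreover have "(t - a) * ((f t - f s) * (t - Re z)) < (t - a) * ((t - s) * (f t - Im z))"
        using low assms by (intro mult_strict_left_mono) (auto simp: algebra_simps)
      ultimately have "(t - a) * (f t - f s) * (t - Re z) < (t - s) * (f t - f a) * (t - Re z)"
        by (simp add: mult_ac)
      then have "(t - a) * (f t - f s) < (t - s) * (f t - f a)" using z by (simp add: mult_less_cancel_right)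
      then show ?thesis by (simp add: algebra_simps)
    qed
  qed
  then show ?thesis using Im_coord[OF assms(2), of "pt a"] ps ne by (simp add: cap_def)
qed

text \<open>Strictly between the graph and the level \<open>\<tau>\<close>, both vertical directions
  stay in \<open>K\<close>, so a normal has no vertical component; the two top corners then remove
  its horizontal component.\<close>

lemma normal_point_on_graph:
  assumes "m \<in> K" "outer_normal K m n" "n \<noteq> 0" "\<bar>Re m\<bar> < \<tau>" "Im m < \<tau>"
  shows "m = pt (Re m)"
proof -
  have le: "f (Re m) \<le> Im m" using above[of "Re m" "Im m"] assms by auto
  have on: "inner n (z - m) \<le> 0" if "z \<in> K" for z using assms(2) that by (simp add: outer_normal_def)
  have "\<not> f (Re m) < Im m"
  proof
    assume less: "f (Re m) < Im m"
    have "Im n * (f (Re m) - Im m) \<le> 0" "Im n * (\<tau> - Im m) \<le> 0"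
      using on[of "Complex (Re m) (f (Re m))"] on[of "Complex (Re m) \<tau>"] graph[of "Re m"] top[of "Re m"] assms
      by (auto simp: inner_complex_def)
    then have i0: "Im n = 0" using less assms(5) by (auto simp: mult_le_0_iff)
    then have "Re n * (\<tau> - Re m) \<le> 0" "Re n * (- \<tau> - Re m) \<le> 0"
      using on[of "Complex \<tau> \<tau>"] on[of "Complex (-\<tau>) \<tau>"] top[of \<tau>] top[of "-\<tau>"] \<tau>
      by (auto simp: inner_complex_def)
    then have "Re n = 0" using assms(4) by (auto simp: mult_le_0_iff)
    then show False using i0 assms(3) by (simp add: complex_eq_iff)
  qed
  then show ?thesis using le by (simp add: complex_eq_iff)
qed

lemma pt_frontier:
  assumes "\<bar>s\<bar> \<le> \<tau>"
  shows "pt s \<in> frontier K"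
proof -
  have "pt s \<in> K" using graph assms by (simp add: pt_def)
  moreover have "pt s \<notin> interior K"
  proof
    assume "pt s \<in> interior K"
    then obtain e where e: "e > 0" "ball (pt s) e \<subseteq> K" by (auto simp: mem_interior)
    have "Complex s (f s - e / 2) \<in> ball (pt s) e"
      using e by (simp add: pt_def dist_norm cmod_def)
    then have "f s \<le> f s - e / 2" using above[OF assms, of "f s - e / 2"] e(2) by (meson subsetD)
    then show False using e by simp
  qed
  ultimately show ?thesis using closure_subset by (auto simp: frontier_def)
qed

text \<open>The intermediate value theorem gives an end not beyond \<open>s + l\<close>. Lipschitz
  constant 1/10 forces \<open>t - s\<close> to be at least \<open>10 * l / 11\<close>, and
  \<open>10/11 - 1/2\<close> exceeds 2/5, so every such chord reaches across the base point.\<close>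

lemma chord_exists:
  assumes "0 < l" "l \<le> \<tau> / 2" "- l / 2 \<le> s" "s \<le> - 2 * l / 5"
  shows "\<exists>t. 2 * l / 5 \<le> t \<and> t \<le> \<tau> / 2 \<and> dist (pt s) (pt t) = l"
proof -
  have "\<exists>t\<ge>s. t \<le> s + l \<and> dist (pt s) (pt t) = l"
  proof (rule IVT')
    have "l \<le> dist (pt s) (pt (s + l))"
      using abs_Re_le_cmod[of "pt s - pt (s + l)"] assms by (simp add: dist_norm)
    then show "l \<le> dist (pt s) (pt (s + l))" .
    have cf: "continuous_on {s..s + l} f"
      by (rule continuous_on_subset[OF continuous_f]) (use assms in auto)
    have pe: "pt = (\<lambda>t. of_real t + \<i> * of_real (f t))"
      by (simp add: fun_eq_iff pt_def complex_eq_iff)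
    show "continuous_on {s..s + l} (\<lambda>t. dist (pt s) (pt t))"
      unfolding pe by (intro continuous_intros cf)
  qed (use assms in auto)
  then obtain t where t: "s \<le> t" "t \<le> s + l" "dist (pt s) (pt t) = l" by blast
  have 1: "l \<le> \<bar>t - s\<bar> + \<bar>f t - f s\<bar>"
    using t(3) cmod_le[of "pt t - pt s"] by (simp add: dist_norm norm_minus_commute)
  have 2: "\<bar>f t - f s\<bar> \<le> \<bar>t - s\<bar> / 10"
    using t assms by (intro lipschitz) auto
  have "\<bar>t - s\<bar> = t - s" using t by simp
  then have "l \<le> (t - s) * 11 / 10" using 1 2 by simp
  then show ?thesis using t assms by (intro exI[of _ t]) auto
qed

end

section \<open>Limits of chords with congruent or symmetric caps\<close>

lemma eventually_Im_neg:
  assumes "g \<longlonglongrightarrow> z" "Im z < 0"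
  shows "eventually (\<lambda>k. Im (g k) < 0) sequentially"
  using tendsto_Im[OF assms(1)] assms(2) by (rule order_tendstoD(2))

context boundary_graph
begin

lemma tendsto_pt:
  assumes "S \<longlonglongrightarrow> s" "\<And>k. -\<tau>/2 \<le> S k \<and> S k \<le> \<tau>/2" "-\<tau>/2 \<le> s \<and> s \<le> \<tau>/2"
  shows "(\<lambda>k. pt (S k)) \<longlonglongrightarrow> pt s"
proof -
  have "(\<lambda>k. f (S k)) \<longlonglongrightarrow> f s"
  proof (rule continuous_on_tendsto_compose[OF continuous_f assms(1)])
    show "s \<in> {-\<tau>/2..\<tau>/2}" using assms(3) by auto
    show "eventually (\<lambda>k. S k \<in> {-\<tau>/2..\<tau>/2}) sequentially"
      using assms(2) by (intro always_eventually) auto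
  qed
  then show ?thesis unfolding pt_def by (intro tendsto_Complex assms(1))
qed

text \<open>Equal caps mean that the motion from one chord to the next carries cap to cap. These
  motions tend to the identity since the chords converge, and none is the identity since consecutive
  starting points differ. A point over all the chords lies in all the caps, so the motions and their
  inverses keep it in \<open>K\<close>.\<close>

lemma congruent_caps:
  fixes S T :: "nat \<Rightarrow> real"
  assumes ST: "\<And>k. -\<tau>/2 \<le> S k \<and> S k < T k \<and> T k \<le> \<tau>/2"
    and len: "\<And>k. dist (pt (S k)) (pt (T k)) = l"
    and lim: "S \<longlonglongrightarrow> s" "T \<longlonglongrightarrow> t" and st: "-\<tau>/2 \<le> s" "s < t" "t \<le> \<tau>/2"
    and ne: "\<And>k. S k \<noteq> S (Suc k)" "\<And>k. cap K (pt (S k)) (pt (T k)) \<noteq> {}"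
    and const: "\<And>k. cap K (pt (S k)) (pt (T k)) = C"
    and U: "\<And>m n. m \<in> U \<Longrightarrow> outer_normal K m n \<Longrightarrow> n \<noteq> 0 \<Longrightarrow> \<exists>a. m = pt a \<and> (\<forall>k. S k < a \<and> a < T k)"
  shows "\<exists>\<omega> \<beta>. (\<omega> \<noteq> 0 \<or> \<beta> \<noteq> 0) \<and> tangent_on K \<omega> \<beta> U"
proof -
  define P d where "P k = pt (S k)" and "d k = pt (T k) - pt (S k)" for k
  have d0: "d k \<noteq> 0" for k using ST[of k] by (metis d_def Re_pt less_irrefl eq_iff_diff_eq_0)
  have dl: "cmod (d k) = l" for k using len[of k] by (simp add: d_def dist_norm norm_minus_commute)
  have Pl: "P \<longlonglongrightarrow> pt s" unfolding P_def using ST st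
    by (intro tendsto_pt[OF lim(1)]) (meson less_imp_le order_trans)+
  have "(\<lambda>k. pt (T k)) \<longlonglongrightarrow> pt t" using ST st
    by (intro tendsto_pt[OF lim(2)]) (meson less_imp_le order_trans)+
  then have dlim: "d \<longlonglongrightarrow> pt t - pt s" using Pl unfolding d_def P_def by (intro tendsto_diff)
  have d1: "pt t - pt s \<noteq> 0" using st by (metis Re_pt less_irrefl eq_iff_diff_eq_0)
  define u b where "u k = d (Suc k) / d k" and "b k = P (Suc k) - u k * P k" for k
  have step: "u k * (P k + d k * \<zeta>) + b k = P (Suc k) + d (Suc k) * \<zeta>" for k \<zeta>
    using d0[of k] by (simp add: u_def b_def algebra_simps)
  have u0: "u k \<noteq> 0" for k using d0 by (simp add: u_def)
  have ul: "u \<longlonglongrightarrow> (pt t - pt s) / (pt t - pt s)"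
    unfolding u_def by (intro tendsto_divide LIMSEQ_Suc dlim d1)
  then have ul: "u \<longlonglongrightarrow> 1" using d1 by simp
  have "b \<longlonglongrightarrow> pt s - 1 * pt s" unfolding b_def by (intro tendsto_intros LIMSEQ_Suc Pl ul)
  then have bl: "b \<longlonglongrightarrow> 0" by simp
  obtain \<omega> \<beta> where "\<omega> \<noteq> 0 \<or> \<beta> \<noteq> 0" "\<And>m n. m \<in> U \<Longrightarrow> outer_normal K m n \<Longrightarrow> inner n (kfield \<omega> \<beta> m) = 0"
  proof (rule infinitesimal_motion[OF _ _ ul bl, of U K])
    show "cmod (u k) = 1" for k using dl[of k] dl[of "Suc k"] d0[of k] by (auto simp: u_def norm_divide)
    show "u k \<noteq> 1 \<or> b k \<noteq> 0" for k
    proof (rule ccontr)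
      assume "\<not> (u k \<noteq> 1 \<or> b k \<noteq> 0)"
      then have "P (Suc k) = P k" by (auto simp: b_def)
      then show False using ne(1)[of k] by (metis P_def Re_pt)
    qed
    show "eventually (\<lambda>k. u k * m + b k \<in> K \<and> (m - b k) / u k \<in> K) sequentially"
      if m: "m \<in> U" "outer_normal K m n" "n \<noteq> 0" for m n
    proof (intro always_eventually allI)
      fix k
      obtain a where a: "m = pt a" "\<And>k. S k < a" "\<And>k. a < T k" using U[OF m] by blast
      define Z where "Z k = (m - P k) / d k" for k
      have Z: "Z k \<in> C" for k
        using pt_in_cap[of "S k" "T k" a] a ST[of k] ne(2)[of k] const[of k] by (simp add: Z_def P_def d_def)
      have mZ: "m = P k + d k * Z k" for k using d0[of k] by (simp add: Z_def)
      have inK: "\<zeta> \<in> C \<Longrightarrow> P k + d k * \<zeta> \<in> K" for k \<zeta>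
        using const[of k] unfolding cap_def P_def d_def by blast
      have "u k * m + b k \<in> K" using step[of k "Z k"] inK[OF Z, of "Suc k" k] mZ[of k] by simp
      moreover have "(m - b k) / u k = P k + d k * Z (Suc k)"
        using step[of k "Z (Suc k)"] mZ[of "Suc k"] u0[of k]
        by (metis add_diff_cancel_right' nonzero_mult_div_cancel_left)
      ultimately show "u k * m + b k \<in> K \<and> (m - b k) / u k \<in> K" using inK[OF Z, of k "Suc k"] by simp
    qed
  qed blast
  then show ?thesis unfolding tangent_on_def by blast
qed

text \<open>The product of the reflections of two consecutive symmetric caps tends to the identity without
  being equal to it.\<close>

lemma symmetric_caps:
  fixes S T :: "nat \<Rightarrow> real"
  assumes ST: "\<And>k. -\<tau>/2 \<le> S k \<and> S k < T k \<and> T k \<le> \<tau>/2"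
    and len: "\<And>k. dist (pt (S k)) (pt (T k)) = l"
    and lim: "S \<longlonglongrightarrow> s" "T \<longlonglongrightarrow> t" and st: "-\<tau>/2 \<le> s" "s < t" "t \<le> \<tau>/2"
    and ne: "\<And>k. S k \<noteq> S (Suc k)" "\<And>k. cap K (pt (S k)) (pt (T k)) \<noteq> {}"
    and ne': "cap K (pt s) (pt t) \<noteq> {}"
    and sym: "\<And>k. (\<lambda>\<zeta>. 1 - cnj \<zeta>) ` cap K (pt (S k)) (pt (T k)) = cap K (pt (S k)) (pt (T k))"
    and U: "\<And>m n. m \<in> U \<Longrightarrow> outer_normal K m n \<Longrightarrow> n \<noteq> 0 \<Longrightarrow>
      \<exists>a. m = pt a \<and> s < a \<and> a < t \<and> (\<forall>k. S k < a \<and> a < T k)"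
  shows "\<exists>\<omega> \<beta>. (\<omega> \<noteq> 0 \<or> \<beta> \<noteq> 0) \<and> tangent_on K \<omega> \<beta> U"
proof -
  define P d where "P k = pt (S k)" and "d k = pt (T k) - pt (S k)" for k
  define P' d' where "P' = pt s" and "d' = pt t - pt s"
  have d0: "d k \<noteq> 0" for k using ST[of k] by (metis d_def Re_pt less_irrefl eq_iff_diff_eq_0)
  have dl: "cmod (d k) = l" for k using len[of k] by (simp add: d_def dist_norm norm_minus_commute)
  have l0: "l \<noteq> 0" using dl[of 0] d0[of 0] by auto
  have Pl: "P \<longlonglongrightarrow> P'" unfolding P_def P'_def using ST st
    by (intro tendsto_pt[OF lim(1)]) (meson less_imp_le order_trans)+
  have "(\<lambda>k. pt (T k)) \<longlonglongrightarrow> pt t" using ST st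
    by (intro tendsto_pt[OF lim(2)]) (meson less_imp_le order_trans)+
  then have dlim: "d \<longlonglongrightarrow> d'" using Pl unfolding d_def P_def d'_def P'_def by (intro tendsto_diff)
  have d1: "d' \<noteq> 0" using st unfolding d'_def by (metis Re_pt less_irrefl eq_iff_diff_eq_0)
  \<comment> \<open>\<open>\<sigma> k\<close> is the reflection in the perpendicular bisector of the
    \<open>k\<close>-th chord: in the chord coordinate it is \<open>1 - cnj \<zeta>\<close>. The
    primed values are those of the limit chord.\<close>
  define w e where "w k = - d k / cnj (d k)" and "e k = P k + d k - w k * cnj (P k)" for k
  define w' e' where "w' = - d' / cnj d'" and "e' = P' + d' - w' * cnj P'"
  define \<sigma> where "\<sigma> k z = w k * cnj z + e k" for k z
  define Z where "Z k z = (z - P k) / d k" for k z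
  have PZ: "P k + d k * Z k z = z" for k z using d0 by (simp add: Z_def)
  have \<sigma>coord: "\<sigma> k z = P k + d k * (1 - cnj (Z k z))" for k z
  proof -
    have "w k * cnj d' = - (d k * cnj (d' / d k))" for d' by (simp add: w_def)
    then have "w k * cnj (z - P k) = - (d k * cnj (Z k z))" unfolding Z_def .
    then show ?thesis by (simp add: \<sigma>_def e_def algebra_simps)
  qed
  have Z\<sigma>: "Z k (\<sigma> k z) = 1 - cnj (Z k z)" for k z using d0 by (simp add: \<sigma>coord Z_def)
  have invol: "\<sigma> k (\<sigma> k z) = z" for k z
    using PZ[of k z] by (subst \<sigma>coord) (simp add: Z\<sigma>)
  have wl: "w \<longlonglongrightarrow> w'" unfolding w_def w'_def by (intro tendsto_intros dlim) (use d1 in auto)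
  have el: "e \<longlonglongrightarrow> e'" unfolding e_def e'_def by (intro tendsto_intros dlim Pl wl)
  define u b where "u k = w (Suc k) * cnj (w k)" and "b k = w (Suc k) * cnj (e k) + e (Suc k)" for k
  have comp: "\<sigma> (Suc k) (\<sigma> k z) = u k * z + b k" for k z
    by (simp add: \<sigma>_def u_def b_def algebra_simps)
  have w1: "cmod (w k) = 1" for k using d0 by (simp add: w_def norm_divide)
  have u1: "cmod (u k) = 1" for k by (simp add: u_def norm_mult w1)
  have "u \<longlonglongrightarrow> w' * cnj w'" unfolding u_def by (intro tendsto_intros LIMSEQ_Suc wl)
  moreover have "w' * cnj w' = 1" using d1 by (simp add: w'_def)
  ultimately have ul: "u \<longlonglongrightarrow> 1" by simp
  have "b \<longlonglongrightarrow> w' * cnj e' + e'" unfolding b_def by (intro tendsto_intros LIMSEQ_Suc wl el)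
  moreover have "w' * cnj e' + e' = 0" using d1 by (simp add: e'_def w'_def field_simps)
  ultimately have bl: "b \<longlonglongrightarrow> 0" by simp
  obtain \<omega> \<beta> where "\<omega> \<noteq> 0 \<or> \<beta> \<noteq> 0" "\<And>m n. m \<in> U \<Longrightarrow> outer_normal K m n \<Longrightarrow> inner n (kfield \<omega> \<beta> m) = 0"
  proof (rule infinitesimal_motion[OF u1 _ ul bl, of U K])
    \<comment> \<open>If consecutive reflections agreed at \<open>P k\<close>, then
      \<open>d k\<close> would be a real multiple of \<open>d (Suc k)\<close>, hence equal to it, as
      both have length \<open>l\<close> and point to the right. The displacement of the starting
      point would then be orthogonal to the chord, which two vectors of slope at most 1/10 cannot
      be.\<close>
    show "u k \<noteq> 1 \<or> b k \<noteq> 0" for k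
    proof (rule ccontr)
      assume "\<not> (u k \<noteq> 1 \<or> b k \<noteq> 0)"
      then have "\<sigma> (Suc k) (\<sigma> k (P k)) = P k" by (simp add: comp)
      then have "\<sigma> k (P k) = \<sigma> (Suc k) (P k)" by (metis invol)
      moreover have "\<sigma> k (P k) = P k + d k" by (simp add: \<sigma>coord Z_def)
      ultimately have "P k + d k = P (Suc k) + d (Suc k) * (1 - cnj (Z (Suc k) (P k)))"
        by (simp add: \<sigma>coord)
      then have "d k = d (Suc k) * (1 - cnj (Z (Suc k) (P k))) - (P k - P (Suc k))" by (simp add: algebra_simps)
      also have "P k - P (Suc k) = d (Suc k) * Z (Suc k) (P k)" using d0 by (simp add: Z_def)
      finally have dd: "d k = of_real (1 - 2 * Re (Z (Suc k) (P k))) * d (Suc k)"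
        by (simp add: complex_eq_iff algebra_simps)
      then have "cmod (d k) = \<bar>1 - 2 * Re (Z (Suc k) (P k))\<bar> * cmod (d (Suc k))"
        by (metis norm_mult norm_of_real)
      then have "\<bar>1 - 2 * Re (Z (Suc k) (P k))\<bar> = 1" using dl l0 by simp
      moreover have "Re (d k) > 0" "Re (d (Suc k)) > 0" using ST[of k] ST[of "Suc k"] by (auto simp: d_def)
      moreover have "Re (d k) = (1 - 2 * Re (Z (Suc k) (P k))) * Re (d (Suc k))" using dd by (metis times_complex.sel(1) Re_complex_of_real Im_complex_of_real mult_zero_left diff_zero)
      ultimately have "Re (Z (Suc k) (P k)) = 0" by (auto simp: abs_if zero_less_mult_iff split: if_splits)
      then have "(S k - S (Suc k)) * (T (Suc k) - S (Suc k))
          + (f (S k) - f (S (Suc k))) * (f (T (Suc k)) - f (S (Suc k))) = 0"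
        using d0[of "Suc k"] by (simp add: Z_def Re_divide P_def d_def complex_eq_iff sum_power2_eq_zero_iff)
      then have "\<bar>(S k - S (Suc k)) * (T (Suc k) - S (Suc k))\<bar>
          = \<bar>(f (S k) - f (S (Suc k))) * (f (T (Suc k)) - f (S (Suc k)))\<bar>"
        by (metis abs_minus_cancel eq_neg_iff_add_eq_0)
      moreover have bd: "\<bar>S k\<bar> \<le> \<tau> / 2" "\<bar>S (Suc k)\<bar> \<le> \<tau> / 2" "\<bar>T (Suc k)\<bar> \<le> \<tau> / 2"
        using ST[of k] ST[of "Suc k"] by auto
      have "\<bar>f (S k) - f (S (Suc k))\<bar> \<le> \<bar>S k - S (Suc k)\<bar> / 10"
        "\<bar>f (T (Suc k)) - f (S (Suc k))\<bar> \<le> \<bar>T (Suc k) - S (Suc k)\<bar> / 10"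
        using lipschitz[OF bd(2,1)] lipschitz[OF bd(2,3)] .
      then have "\<bar>(f (S k) - f (S (Suc k))) * (f (T (Suc k)) - f (S (Suc k)))\<bar>
          \<le> (\<bar>S k - S (Suc k)\<bar> / 10) * (\<bar>T (Suc k) - S (Suc k)\<bar> / 10)"
        unfolding abs_mult by (intro mult_mono) auto
      ultimately have "\<bar>(S k - S (Suc k)) * (T (Suc k) - S (Suc k))\<bar> \<le> \<bar>S k - S (Suc k)\<bar> * \<bar>T (Suc k) - S (Suc k)\<bar> / 100"
        by simp
      moreover have "0 < \<bar>S k - S (Suc k)\<bar> * \<bar>T (Suc k) - S (Suc k)\<bar>" using ne(1)[of k] ST[of "Suc k"] by simp
      ultimately show False by (simp add: abs_mult)
    qed
    show "eventually (\<lambda>k. u k * m + b k \<in> K \<and> (m - b k) / u k \<in> K) sequentially"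
      if m: "m \<in> U" "outer_normal K m n" "n \<noteq> 0" for m n
    proof -
      obtain a where a: "m = pt a" "s < a" "a < t" "\<And>k. S k < a" "\<And>k. a < T k" using U[OF m] by blast
      have Zc: "Z k m \<in> cap K (pt (S k)) (pt (T k))" for k
        using pt_in_cap[of "S k" "T k" a] a ST[of k] ne(2)[of k] by (simp add: Z_def P_def d_def)
      have \<sigma>K: "\<sigma> k z \<in> K" if "Z k z \<in> cap K (pt (S k)) (pt (T k))" for k z
      proof -
        have "1 - cnj (Z k z) \<in> cap K (pt (S k)) (pt (T k))" using sym[of k] that by blast
        then show ?thesis by (simp add: \<sigma>coord cap_def P_def d_def)
      qed
      have \<sigma>m: "\<sigma> k m \<in> K" for k using \<sigma>K Zc by blast
      have capI: "Z k z \<in> cap K (pt (S k)) (pt (T k))" if "z \<in> K" "Im (Z k z) < 0" for k z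
        using that PZ[of k z] by (simp add: cap_def P_def d_def)
      \<comment> \<open>A point reflected by one bisector must lie in the cap of the neighbouring
        chord before it can be reflected again. In the limit its coordinate is
        \<open>1 - cnj Zl\<close>, strictly below the chord, so this holds from some index
        on.\<close>
      define Zl where "Zl = (m - P') / d'"
      have Zl: "Im Zl < 0"
        using pt_in_cap[OF st a(2,3) ne'] by (simp add: Zl_def P'_def d'_def a(1) cap_def)
      have \<sigma>l: "(\<lambda>k. \<sigma> k m) \<longlonglongrightarrow> w' * cnj m + e'" unfolding \<sigma>_def by (intro tendsto_intros wl el)
      have lim_val: "(w' * cnj m + e' - P') / d' = 1 - cnj Zl"
        using d1 by (simp add: Zl_def e'_def w'_def field_simps)
      have 1: "(\<lambda>k. Z (Suc k) (\<sigma> k m)) \<longlonglongrightarrow> 1 - cnj Zl"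
        unfolding Z_def lim_val[symmetric] by (intro tendsto_intros LIMSEQ_Suc \<sigma>l Pl dlim d1)
      have 2: "(\<lambda>k. Z k (\<sigma> (Suc k) m)) \<longlonglongrightarrow> 1 - cnj Zl"
        unfolding Z_def lim_val[symmetric] by (intro tendsto_intros LIMSEQ_Suc[OF \<sigma>l] Pl dlim d1)
      have "eventually (\<lambda>k. Im (Z (Suc k) (\<sigma> k m)) < 0 \<and> Im (Z k (\<sigma> (Suc k) m)) < 0) sequentially"
        using eventually_Im_neg[OF 1] eventually_Im_neg[OF 2] Zl by (intro eventually_conj) auto
      then show ?thesis
      proof eventually_elim
        case (elim k)
        have "u k * m + b k \<in> K" using \<sigma>K[OF capI[OF \<sigma>m]] elim comp by metis
        moreover have "(m - b k) / u k = \<sigma> k (\<sigma> (Suc k) m)"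
        proof -
          have "m = u k * (\<sigma> k (\<sigma> (Suc k) m)) + b k" by (metis comp invol)
          moreover have "u k \<noteq> 0" using u1[of k] by auto
          ultimately show ?thesis by (metis add_diff_cancel_right' nonzero_mult_div_cancel_left)
        qed
        ultimately show ?case using \<sigma>K[OF capI[OF \<sigma>m]] elim by simp
      qed
    qed
  qed blast
  then show ?thesis unfolding tangent_on_def by blast
qed

end

section \<open>Existence of a tangent field near a smooth point\<close>

context boundary_graph
begin

text \<open>With an empty cap the arc is the chord itself. A normal at an inner point of a segment
  in \<open>K\<close> is orthogonal to the segment, so translation along the chord is
  tangent.\<close>

lemma tangent_on_flat:
  assumes st: "-\<tau>/2 \<le> s" "s < t" "t \<le> \<tau>/2" and flat: "cap K (pt s) (pt t) = {}"
    and U: "\<And>m n. m \<in> U \<Longrightarrow> outer_normal K m n \<Longrightarrow> n \<noteq> 0 \<Longrightarrow> \<exists>a. m = pt a \<and> s < a \<and> a < t"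
  shows "tangent_on K 0 (pt t - pt s) U"
  unfolding tangent_on_def
proof (intro ballI allI impI)
  fix m n assume m: "m \<in> K \<inter> U" and n: "outer_normal K m n"
  show "inner n (kfield 0 (pt t - pt s) m) = 0"
  proof (cases "n = 0")
    case False
    then obtain a where a: "m = pt a" "s < a" "a < t" using U m n by blast
    have ps: "pt s \<in> K" "pt t \<in> K" "pt a \<in> K" using graph st a by (auto simp: pt_def)
    have ne: "pt t - pt s \<noteq> 0" using st by (metis Re_pt less_irrefl eq_iff_diff_eq_0)
    define e where "e = (a - s) / (t - s)"
    have e: "0 < e" "e < 1" "e * (t - s) = a - s" using a st by (auto simp: e_def)
    have "(pt a - pt s) / (pt t - pt s) \<notin> cap K (pt s) (pt t)" using flat by simp
    then have "\<not> (t - s) * (f a - f s) < (f t - f s) * (a - s)"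
      using Im_coord[OF st(2), of "pt a"] ps ne by (simp add: cap_def)
    moreover have "f a * (t - s) \<le> (t - a) * f s + (a - s) * f t"
      using slope[OF ps(1,2), of a] a st by simp
    ultimately have "(t - s) * (f a - f s) = (f t - f s) * (a - s)" by (simp add: algebra_simps)
    also have "\<dots> = (t - s) * (e * (f t - f s))" unfolding e(3)[symmetric] by (simp add: mult_ac)
    finally have "f a - f s = e * (f t - f s)" using st by simp
    then have pa: "pt a = pt s + e *\<^sub>R (pt t - pt s)" using e by (simp add: complex_eq_iff)
    have "inner n (pt s - pt a) \<le> 0" "inner n (pt t - pt a) \<le> 0"
      using n ps a unfolding outer_normal_def by auto
    moreover have "pt s - pt a = - (e *\<^sub>R (pt t - pt s))" "pt t - pt a = (1 - e) *\<^sub>R (pt t - pt s)"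
      unfolding pa by (auto simp: algebra_simps)
    ultimately have "0 \<le> e * inner n (pt t - pt s)" "(1 - e) * inner n (pt t - pt s) \<le> 0"
      by (metis inner_minus_right inner_scaleR_right neg_le_0_iff_le)+
    then have "inner n (pt t - pt s) = 0" using e by (auto simp: zero_le_mult_iff mult_le_0_iff)
    then show ?thesis by (simp add: kfield_def)
  qed simp
qed

text \<open>All chords start in \<open>[- l / 2, - 2 * l / 5]\<close> and end to the right of
  \<open>2 * l / 5\<close>, so each spans the part of the boundary within \<open>l / 4\<close> of
  the base point. By pigeonhole one outcome of \<open>lens_symmetry\<close> occurs for infinitely
  many of them; a subsequence with convergent ends feeds the limit lemmas.\<close>

theorem tangent_near_0:
  assumes S: "sym_inter K L" and "convex L" and gL: "good_chord L p' q'" and "dist p' q' = l"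
    and l: "0 < l" "l \<le> \<tau> / 2"
  shows "\<exists>\<omega> \<beta>. (\<omega> \<noteq> 0 \<or> \<beta> \<noteq> 0) \<and> tangent_on K \<omega> \<beta> (ball 0 (l / 4))"
proof -
  define U where "U = K \<inter> ball 0 (l / 4)"
  have U: "\<exists>a. m = pt a \<and> - 2 * l / 5 < a \<and> a < 2 * l / 5"
    if "m \<in> U" "outer_normal K m n" "n \<noteq> 0" for m n
  proof -
    have "cmod m < l / 4" using that by (simp add: U_def)
    then have b: "\<bar>Re m\<bar> < l / 4" "Im m < l / 4"
      using abs_Re_le_cmod[of m] abs_Im_le_cmod[of m] by linarith+
    then have "m = pt (Re m)"
      using that l by (intro normal_point_on_graph[of m n]) (auto simp: U_def)
    then show ?thesis using b by (intro exI[of _ "Re m"]) (auto simp: abs_less_iff)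
  qed
  have "\<exists>\<omega> \<beta>. (\<omega> \<noteq> 0 \<or> \<beta> \<noteq> 0) \<and> tangent_on K \<omega> \<beta> U"
  proof (cases "\<exists>s t. - l / 2 \<le> s \<and> s \<le> - 2 * l / 5 \<and> 2 * l / 5 \<le> t \<and> t \<le> \<tau> / 2 \<and> cap K (pt s) (pt t) = {}")
    case True
    then obtain s t where st: "- l / 2 \<le> s" "s \<le> - 2 * l / 5" "2 * l / 5 \<le> t" "t \<le> \<tau> / 2" "cap K (pt s) (pt t) = {}"
      by blast
    have "tangent_on K 0 (pt t - pt s) U"
    proof (rule tangent_on_flat)
      fix m n assume "m \<in> U" "outer_normal K m n" "n \<noteq> 0"
      then show "\<exists>a. m = pt a \<and> s < a \<and> a < t" using U[of m n] st by force
    qed (use st l in auto)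
    moreover have "pt t - pt s \<noteq> 0"
    proof
      assume "pt t - pt s = 0"
      then have "t = s" by (metis Re_pt eq_iff_diff_eq_0)
      then show False using st l by simp
    qed
    ultimately show ?thesis by blast
  next
    case False
    \<comment> \<open>Pairwise distinct starting points tending to \<open>- l / 2\<close>.
      Distinctness makes the resulting motions non-trivial, convergence makes them tend to the
      identity.\<close>
    define S0 where "S0 k = - l / 2 + l / 10 / real (Suc k)" for k
    have S0: "- l / 2 \<le> S0 k \<and> S0 k \<le> - 2 * l / 5" for k
    proof -
      define x where "x = l / 10 / real (Suc k)"
      have "x \<le> l / 10 / 1" unfolding x_def using l by (intro divide_left_mono) auto
      moreover have "0 \<le> x" unfolding x_def using l by (intro divide_nonneg_nonneg) auto
      moreover have "S0 k = - l / 2 + x" by (simp only: S0_def x_def)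
      ultimately show ?thesis by simp
    qed
    have S0_inj: "S0 j \<noteq> S0 k" if "j \<noteq> k" for j k
      using that l by (auto simp: S0_def field_simps)
    have "\<forall>k. \<exists>t. 2 * l / 5 \<le> t \<and> t \<le> \<tau> / 2 \<and> dist (pt (S0 k)) (pt t) = l"
      using chord_exists l S0 by blast
    then obtain T0 where T0: "\<And>k. 2 * l / 5 \<le> T0 k \<and> T0 k \<le> \<tau> / 2 \<and> dist (pt (S0 k)) (pt (T0 k)) = l"
      by metis
    define c where "c k = cap K (pt (S0 k)) (pt (T0 k))" for k
    have ne: "cap K (pt s) (pt t) \<noteq> {}" if "- l / 2 \<le> s" "s \<le> - 2 * l / 5" "2 * l / 5 \<le> t" "t \<le> \<tau> / 2" for s t
      using False that by blast
    define A where "A = {k. (\<lambda>\<zeta>. 1 - cnj \<zeta>) ` c k = c k}"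
    define B where "B = {k. c k = cap L p' q'}"
    define C where "C = {k. c k = (\<lambda>\<zeta>. 1 - cnj \<zeta>) ` cap L p' q'}"
    have "k \<in> A \<union> B \<union> C" for k
    proof -
      have g: "good_chord K (pt (S0 k)) (pt (T0 k))"
        using S0[of k] T0[of k] l by (intro good_chord_pt) auto
      have d: "dist (pt (S0 k)) (pt (T0 k)) = dist p' q'" using T0[of k] \<open>dist p' q' = l\<close> by simp
      have "cap K (pt (S0 k)) (pt (T0 k)) \<noteq> {}" using S0[of k] T0[of k] by (intro ne) auto
      from lens_symmetry[OF S convex \<open>convex L\<close> g gL d this]
      show ?thesis unfolding A_def B_def C_def c_def Un_iff mem_Collect_eq by argo
    qed
    then have "UNIV = A \<union> B \<union> C" by blast
    then have "infinite A \<or> infinite B \<or> infinite C" by (metis finite_UnI infinite_UNIV_nat)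
    then obtain X where X: "infinite X" "X = A \<or> X = B \<or> X = C" by blast
    obtain r0 :: "nat \<Rightarrow> nat" where r0: "strict_mono r0" "\<And>n. r0 n \<in> X"
      using infinite_enumerate[OF X(1)] by blast
    have "bounded (range (\<lambda>k. T0 (r0 k)))"
    proof (rule boundedI)
      fix x assume "x \<in> range (\<lambda>k. T0 (r0 k))"
      then obtain k where k: "x = T0 (r0 k)" by blast
      show "norm x \<le> \<tau> / 2" using T0[of "r0 k"] l by (simp add: k)
    qed
    then obtain t r1 where r1: "strict_mono r1" "((\<lambda>k. T0 (r0 k)) \<circ> r1) \<longlonglongrightarrow> t"
      using bounded_imp_convergent_subsequence by blast
    define r where "r = r0 \<circ> r1"
    have r: "strict_mono r" unfolding r_def using r0(1) r1(1) by (rule strict_mono_o)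
    define S T where "S k = S0 (r k)" and "T k = T0 (r k)" for k
    have Tl: "T \<longlonglongrightarrow> t" using r1(2) by (simp add: T_def[abs_def] r_def o_def)
    have "S0 \<longlonglongrightarrow> - l / 2 + 0" unfolding S0_def[abs_def]
      by (intro tendsto_intros LIMSEQ_Suc[OF lim_const_over_n])
    from LIMSEQ_subseq_LIMSEQ[OF this r] have Sl: "S \<longlonglongrightarrow> - l / 2" by (simp add: S_def[abs_def] o_def)
    have Tb: "2 * l / 5 \<le> T k" "T k \<le> \<tau> / 2" for k using T0[of "r k"] by (auto simp: T_def)
    have t: "2 * l / 5 \<le> t" "t \<le> \<tau> / 2"
      using LIMSEQ_le_const[OF Tl] LIMSEQ_le_const2[OF Tl] Tb by blast+
    have ST: "-\<tau>/2 \<le> S k \<and> S k < T k \<and> T k \<le> \<tau>/2" for k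
      using S0[of "r k"] T0[of "r k"] l by (auto simp: S_def T_def)
    have len: "dist (pt (S k)) (pt (T k)) = l" for k using T0 by (simp add: S_def T_def)
    have SS: "S k \<noteq> S (Suc k)" for k
      unfolding S_def using strict_mono_less[OF r, of k "Suc k"] by (intro S0_inj) auto
    have nec: "cap K (pt (S k)) (pt (T k)) \<noteq> {}" for k
      unfolding S_def T_def by (intro ne) (use S0[of "r k"] T0[of "r k"] in simp_all)
    have nel: "cap K (pt (- l / 2)) (pt t) \<noteq> {}" using t l by (intro ne) auto
    have mem: "r k \<in> X" for k using r0(2) by (simp add: r_def)
    have lt: "- \<tau> / 2 \<le> - l / 2" "- l / 2 < t" using t l by auto
    have Um: "\<exists>a. m = pt a \<and> - l / 2 < a \<and> a < t \<and> (\<forall>k. S k < a \<and> a < T k)"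
      if m: "m \<in> U" "outer_normal K m n" "n \<noteq> 0" for m n
    proof -
      obtain a where a: "m = pt a" "- 2 * l / 5 < a" "a < 2 * l / 5" using U[OF m] by blast
      have "S k < a \<and> a < T k" for k using a S0[of "r k"] T0[of "r k"] by (auto simp: S_def T_def)
      then show ?thesis using a t l by (intro exI[of _ a]) auto
    qed
    have Um': "\<exists>a. m = pt a \<and> (\<forall>k. S k < a \<and> a < T k)"
      if m: "m \<in> U" "outer_normal K m n" "n \<noteq> 0" for m n
      using Um[OF m] by metis
    from X(2) show ?thesis
    proof (elim disjE)
      assume "X = A"
      then have "(\<lambda>\<zeta>. 1 - cnj \<zeta>) ` cap K (pt (S k)) (pt (T k)) = cap K (pt (S k)) (pt (T k))" for k
        using mem[of k] by (simp add: A_def c_def S_def T_def)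
      from symmetric_caps[OF ST len Sl Tl lt t(2) SS nec nel this Um] show ?thesis .
    next
      assume "X = B"
      then have "cap K (pt (S k)) (pt (T k)) = cap L p' q'" for k
        using mem[of k] by (simp add: B_def c_def S_def T_def)
      from congruent_caps[OF ST len Sl Tl lt t(2) SS nec this Um'] show ?thesis .
    next
      assume "X = C"
      then have "cap K (pt (S k)) (pt (T k)) = (\<lambda>\<zeta>. 1 - cnj \<zeta>) ` cap L p' q'" for k
        using mem[of k] by (simp add: C_def c_def S_def T_def)
      from congruent_caps[OF ST len Sl Tl lt t(2) SS nec this Um'] show ?thesis .
    qed
  qed
  then show ?thesis by (auto simp: tangent_on_def U_def)
qed

end

text \<open>Four rays suffice. The diagonal ones enter \<open>K\<close> and give the horizontal
  segment at height \<open>\<tau>\<close>; those of slope 1/20 on either side bound the graph from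
  above.\<close>

lemma boundary_graph_exists:
  assumes "closed K" "convex K" "0 \<in> K" and pos: "\<And>z. z \<in> K \<Longrightarrow> 0 \<le> Im z"
    and smooth: "\<And>w. 0 < Im w \<Longrightarrow> \<exists>t>0. t *\<^sub>R w \<in> K"
  shows "\<exists>f \<tau>. boundary_graph K f \<tau>"
proof -
  have shrink: "s *\<^sub>R w \<in> K" if "t *\<^sub>R w \<in> K" "0 \<le> s" "s \<le> t" "0 < t" for s t w
  proof -
    have "(1 - s / t) *\<^sub>R 0 + (s / t) *\<^sub>R (t *\<^sub>R w) \<in> K"
      using that assms by (intro convexD) auto
    then show ?thesis using that by simp
  qed
  obtain t1 t2 t3 t4 where t: "t1 > 0" "t1 *\<^sub>R Complex 1 1 \<in> K" "t2 > 0" "t2 *\<^sub>R Complex (-1) 1 \<in> K"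
    "t3 > 0" "t3 *\<^sub>R Complex 1 (1/20) \<in> K" "t4 > 0" "t4 *\<^sub>R Complex (-1) (1/20) \<in> K"
    using smooth[of "Complex 1 1"] smooth[of "Complex (-1) 1"] smooth[of "Complex 1 (1/20)"]
      smooth[of "Complex (-1) (1/20)"] by auto
  define \<tau> where "\<tau> = min (min t1 t2) (min t3 t4)"
  have \<tau>: "\<tau> > 0" using t by (simp add: \<tau>_def)
  have corner: "s *\<^sub>R Complex 1 1 \<in> K" "s *\<^sub>R Complex (-1) 1 \<in> K" "s *\<^sub>R Complex 1 (1/20) \<in> K"
    "s *\<^sub>R Complex (-1) (1/20) \<in> K" if "0 \<le> s" "s \<le> \<tau>" for s
    using that t by (auto intro!: shrink[OF t(2)] shrink[OF t(4)] shrink[OF t(6)] shrink[OF t(8)] simp: \<tau>_def)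
  define f where "f s = Inf {y. Complex s y \<in> K}" for s
  have top: "Complex s \<tau> \<in> K" if "\<bar>s\<bar> \<le> \<tau>" for s
  proof -
    define e where "e = (s + \<tau>) / (2 * \<tau>)"
    have e: "0 \<le> e" "e \<le> 1" "2 * e * \<tau> = s + \<tau>" using that \<tau> by (auto simp: e_def)
    have "(1 - e) *\<^sub>R (\<tau> *\<^sub>R Complex (-1) 1) + e *\<^sub>R (\<tau> *\<^sub>R Complex 1 1) \<in> K"
      using e corner[of \<tau>] \<tau> assms by (intro convexD) auto
    moreover have "(1 - e) *\<^sub>R (\<tau> *\<^sub>R Complex (-1) 1) + e *\<^sub>R (\<tau> *\<^sub>R Complex 1 1) = Complex s \<tau>"
      using e by (simp add: complex_eq_iff algebra_simps)
    ultimately show ?thesis by simp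
  qed
  have ce: "Complex s = (\<lambda>y. of_real s + \<i> * of_real y)" for s by (simp add: fun_eq_iff complex_eq_iff)
  have cl: "closed {y. Complex s y \<in> K}" for s
  proof -
    have "closed (Complex s -` K)"
      unfolding ce by (intro closed_vimage \<open>closed K\<close> continuous_intros)
    then show ?thesis by (simp add: vimage_def)
  qed
  have bb: "bdd_below {y. Complex s y \<in> K}" for s
    by (rule bdd_belowI[of _ 0]) (use pos in force)
  have fin: "Complex s (f s) \<in> K" if "\<bar>s\<bar> \<le> \<tau>" for s
    using closed_contains_Inf[OF _ bb cl, of s] top[OF that] unfolding f_def by blast
  have le: "f s \<le> y" if "Complex s y \<in> K" for s y
    unfolding f_def by (rule cInf_lower) (use that bb in auto)
  have "boundary_graph K f \<tau>"
  proof
    fix s assume s: "\<bar>s\<bar> \<le> \<tau>"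
    show "Complex s (f s) \<in> K" "Complex s \<tau> \<in> K" by (rule fin[OF s], rule top[OF s])
    show "0 \<le> f s" using pos[OF fin[OF s]] by simp
    have "Complex s (\<bar>s\<bar> / 20) = \<bar>s\<bar> *\<^sub>R (if 0 \<le> s then Complex 1 (1/20) else Complex (-1) (1/20))"
      by (simp add: complex_eq_iff)
    then have "Complex s (\<bar>s\<bar> / 20) \<in> K" using corner(3,4)[of "\<bar>s\<bar>"] s by (simp split: if_splits)
    then show "f s \<le> \<bar>s\<bar> / 20" by (rule le)
  qed (use assms \<tau> le in auto)
  then show ?thesis by blast
qed

section \<open>Smooth boundary points\<close>

text \<open>Every direction into the open half-plane of a supporting line enters \<open>K\<close>.
  For a convex set this is differentiability of the boundary, in a form that needs no
  parametrisation.\<close>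

definition smooth_at :: "complex set \<Rightarrow> complex \<Rightarrow> bool" where
  "smooth_at K x \<longleftrightarrow> (\<exists>\<nu>. cmod \<nu> = 1 \<and> outer_normal K x \<nu> \<and>
     (\<forall>w. inner \<nu> w < 0 \<longrightarrow> (\<exists>t>0. x + t *\<^sub>R w \<in> K)))"

lemma inner_rotate: "cmod c = 1 \<Longrightarrow> inner n (c * w) = inner (n / c) w"
proof -
  assume c: "cmod c = 1"
  then have "c * cnj c = 1" by (simp add: complex_norm_square[symmetric])
  then have "n / c = n * cnj c" by (metis c divide_eq_eq mult.assoc mult.commute mult_cancel_left2 norm_zero zero_neq_one)
  then show ?thesis by (simp add: inner_complex_def algebra_simps)
qed

text \<open>The set as seen from the origin \<open>x\<close> with real axis along \<open>c\<close>;
  taken as a preimage, so that membership unfolds without inverses.\<close>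

definition frame :: "complex \<Rightarrow> complex \<Rightarrow> complex set \<Rightarrow> complex set" where
  "frame x c K = {z. x + c * z \<in> K}"

lemma frame_image: "c \<noteq> 0 \<Longrightarrow> (\<lambda>z. x + c * z) ` frame x c K = K"
proof (intro equalityI subsetI)
  fix w assume "c \<noteq> 0" "w \<in> K"
  then show "w \<in> (\<lambda>z. x + c * z) ` frame x c K"
    by (intro image_eqI[of _ _ "(w - x) / c"]) (auto simp: frame_def)
qed (auto simp: frame_def)

lemma convex_frame: "convex K \<Longrightarrow> convex (frame x c K)"
  unfolding frame_def by (rule convex_coords)

lemma closed_frame: "closed K \<Longrightarrow> closed (frame x c K)"
proof -
  assume "closed K"
  then have "closed ((\<lambda>z. x + c * z) -` K)" by (intro closed_vimage continuous_intros)
  then show ?thesis by (simp add: frame_def vimage_def)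
qed

lemma interior_frame:
  assumes "cmod c = 1"
  shows "interior (frame x c K) = frame x c (interior K)"
proof (intro set_eqI)
  fix z
  have c0: "c \<noteq> 0" using assms by auto
  have "ball z e \<subseteq> frame x c K \<longleftrightarrow> ball (x + c * z) e \<subseteq> K" for e
  proof
    assume h: "ball z e \<subseteq> frame x c K"
    show "ball (x + c * z) e \<subseteq> K"
    proof
      fix w assume "w \<in> ball (x + c * z) e"
      moreover have "x + c * z - w = c * (z - (w - x) / c)" using c0 by (simp add: field_simps)
      ultimately have "(w - x) / c \<in> ball z e" using assms by (simp add: dist_norm norm_mult)
      then show "w \<in> K" using h c0 by (auto simp: frame_def)
    qed
  next
    assume h: "ball (x + c * z) e \<subseteq> K"
    show "ball z e \<subseteq> frame x c K"
    proof
      fix w assume "w \<in> ball z e"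
      moreover have "x + c * z - (x + c * w) = c * (z - w)" by (simp add: algebra_simps)
      ultimately have "x + c * w \<in> ball (x + c * z) e" using assms by (simp add: dist_norm norm_mult)
      then show "w \<in> frame x c K" using h by (auto simp: frame_def)
    qed
  qed
  then show "z \<in> interior (frame x c K) \<longleftrightarrow> z \<in> frame x c (interior K)"
    by (simp add: mem_interior frame_def)
qed

lemma frontier_frame:
  assumes "cmod c = 1" "closed K"
  shows "frontier (frame x c K) = frame x c (frontier K)"
  using assms by (simp add: frontier_def closed_frame closure_closed interior_frame) (auto simp: frame_def)

text \<open>The two frames can be chosen independently: the hypothesis covers all motions of
  \<open>L\<close>, and the change of frames is absorbed by the new motion with parameters
  \<open>v\<close> and \<open>d\<close>.\<close>

lemma inter_all_frame:
  assumes S: "inter_all P K L" and c: "cmod c = 1" "cmod c' = 1"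
    and PQ: "\<And>M. P M \<Longrightarrow> Q (frame x c M)"
  shows "inter_all Q (frame x c K) (frame y c' L)"
  unfolding inter_all_def
proof (intro allI impI)
  fix u b :: complex assume u: "cmod u = 1"
  define M1 where "M1 = frame x c K \<inter> (\<lambda>z. u * z + b) ` frame y c' L"
  assume "interior (frame x c K \<inter> (\<lambda>z. u * z + b) ` frame y c' L) \<noteq> {}"
  then have int1: "interior M1 \<noteq> {}" by (simp add: M1_def)
  have c0: "c \<noteq> 0" "c' \<noteq> 0" using c by auto
  define v where "v = c * u / c'"
  define d where "d = x + c * b - v * y"
  have v: "cmod v = 1" using c u by (simp add: v_def norm_mult norm_divide)
  define M where "M = K \<inter> (\<lambda>z. v * z + d) ` L"
  have M1: "M1 = frame x c M"
  proof (intro set_eqI)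
    fix z
    have "z \<in> (\<lambda>z. u * z + b) ` frame y c' L \<longleftrightarrow> x + c * z \<in> (\<lambda>z. v * z + d) ` L"
    proof
      assume "z \<in> (\<lambda>z. u * z + b) ` frame y c' L"
      then obtain w where "z = u * w + b" "y + c' * w \<in> L" by (auto simp: frame_def)
      then show "x + c * z \<in> (\<lambda>z. v * z + d) ` L"
        using c0 by (intro image_eqI[of _ _ "y + c' * w"]) (auto simp: v_def d_def field_simps)
    next
      assume "x + c * z \<in> (\<lambda>z. v * z + d) ` L"
      then obtain w where w: "x + c * z = v * w + d" "w \<in> L" by auto
      then have "c * z = c * (u * ((w - y) / c') + b)" using c0 by (simp add: v_def d_def field_simps)
      then have "z = u * ((w - y) / c') + b" using c0 by (metis mult_cancel_left)
      then show "z \<in> (\<lambda>z. u * z + b) ` frame y c' L"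
        using w c0 by (intro image_eqI[of _ _ "(w - y) / c'"]) (auto simp: frame_def)
    qed
    then show "z \<in> M1 \<longleftrightarrow> z \<in> frame x c M" by (simp add: M1_def M_def frame_def)
  qed
  have "interior M \<noteq> {}" using int1 unfolding M1 interior_frame[OF c(1)] by (auto simp: frame_def)
  then have "P M" using S v unfolding inter_all_def M_def by blast
  then have "Q M1" unfolding M1 by (rule PQ)
  then show "Q (frame x c K \<inter> (\<lambda>z. u * z + b) ` frame y c' L)" by (simp add: M1_def)
qed

lemma isom_frame:
  fixes x c :: complex
  assumes F: "isom F" "F ` M = M" and c0: "c \<noteq> 0"
  defines "G \<equiv> \<lambda>z. (F (x + c * z) - x) / c"
  shows "isom G" "G ` frame x c M = frame x c M" "F \<noteq> id \<Longrightarrow> G \<noteq> id"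
proof -
  show G: "isom G" unfolding G_def by (rule isom_similarity) (use F c0 in auto)
  have FG: "F (x + c * z) = x + c * G z" for z using c0 by (simp add: G_def)
  show "G \<noteq> id" if "F \<noteq> id"
  proof
    assume "G = id"
    then have "F z = z" for z using FG[of "(z - x) / c"] c0 by simp
    then show False using that by auto
  qed
  show "G ` frame x c M = frame x c M"
  proof (intro equalityI subsetI)
    fix w assume "w \<in> G ` frame x c M"
    then obtain z where z: "w = G z" "x + c * z \<in> M" by (auto simp: frame_def)
    have "F (x + c * z) \<in> F ` M" using z by blast
    then show "w \<in> frame x c M" using z by (simp add: F(2) FG frame_def)
  next
    fix w assume "w \<in> frame x c M"
    then have "x + c * w \<in> F ` M" by (simp add: F(2) frame_def)
    then obtain z where z: "z \<in> M" "x + c * w = F z" by auto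
    then have "G ((z - x) / c) = w" using c0 by (simp add: G_def flip: z(2))
    moreover have "(z - x) / c \<in> frame x c M" using z c0 by (simp add: frame_def)
    ultimately show "w \<in> G ` frame x c M" by blast
  qed
qed

lemma sym_inter_frame:
  assumes "sym_inter K L" and c: "cmod c = 1" "cmod c' = 1"
  shows "sym_inter (frame x c K) (frame y c' L)"
  unfolding sym_inter_def
proof (rule inter_all_frame[OF assms(1)[unfolded sym_inter_def] c])
  fix M assume "\<exists>F. isom F \<and> F \<noteq> id \<and> F ` M = M"
  then obtain F where F: "isom F" "F \<noteq> id" "F ` M = M" by blast
  have "c \<noteq> 0" using c by auto
  from isom_frame[OF F(1,3) this] F(2)
  show "\<exists>F. isom F \<and> F \<noteq> id \<and> F ` frame x c M = frame x c M" by blast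
qed

text \<open>A proper change of frame keeps the angular velocity and only alters the constant term,
  so that the field in the new frame is the old one turned by \<open>c\<close>.\<close>

lemma tangent_on_frame:
  assumes "tangent_on (frame x c K) \<omega> \<beta> (ball 0 r)" "cmod c = 1"
  shows "tangent_on K \<omega> (c * \<beta> - \<i> * of_real \<omega> * x) (ball x r)"
  unfolding tangent_on_def
proof (intro ballI allI impI)
  fix m n assume m: "m \<in> K \<inter> ball x r" and n: "outer_normal K m n"
  have c0: "c \<noteq> 0" using assms by auto
  define z where "z = (m - x) / c"
  have mz: "m = x + c * z" using c0 by (simp add: z_def)
  have "z \<in> frame x c K \<inter> ball 0 r"
    using m assms(2) by (simp add: mz frame_def dist_norm norm_mult)
  moreover have "outer_normal (frame x c K) z (n / c)"
    unfolding outer_normal_def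
  proof
    fix w assume "w \<in> frame x c K"
    then have "inner n (x + c * w - m) \<le> 0" using n by (simp add: outer_normal_def frame_def)
    moreover have "x + c * w - m = c * (w - z)" by (simp add: mz algebra_simps)
    ultimately show "inner (n / c) (w - z) \<le> 0" using assms(2) by (simp add: inner_rotate)
  qed
  ultimately have "inner (n / c) (kfield \<omega> \<beta> z) = 0" using assms(1) by (simp add: tangent_on_def)
  then have "inner n (c * kfield \<omega> \<beta> z) = 0" using assms(2) by (simp add: inner_rotate)
  moreover have "c * kfield \<omega> \<beta> z = kfield \<omega> (c * \<beta> - \<i> * of_real \<omega> * x) m"
    by (simp add: kfield_def mz algebra_simps)
  ultimately show "inner n (kfield \<omega> (c * \<beta> - \<i> * of_real \<omega> * x) m) = 0" by simp
qed

lemma smooth_frame: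
  assumes "closed K" "convex K" "x \<in> K" "smooth_at K x"
  obtains c f \<tau> where "cmod c = 1" "boundary_graph (frame x c K) f \<tau>" "f 0 = 0"
proof -
  obtain \<nu> where \<nu>: "cmod \<nu> = 1" "outer_normal K x \<nu>" "\<And>w. inner \<nu> w < 0 \<Longrightarrow> \<exists>t>0. x + t *\<^sub>R w \<in> K"
    using assms(4) by (auto simp: smooth_at_def)
  define c where "c = \<i> * \<nu>"
  have c: "cmod c = 1" using \<nu> by (simp add: c_def norm_mult)
  have nz: "\<nu> \<noteq> 0" using \<nu> by auto
  have "\<nu> / c = - \<i>" using nz by (simp add: c_def divide_eq_eq)
  then have ip: "inner \<nu> (c * w) = - Im w" for w
    unfolding inner_rotate[OF c] by (simp add: inner_complex_def)
  have "\<exists>f \<tau>. boundary_graph (frame x c K) f \<tau>"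
  proof (rule boundary_graph_exists)
    show "closed (frame x c K)" "convex (frame x c K)" using assms by (auto intro: closed_frame convex_frame)
    show "0 \<in> frame x c K" using assms by (simp add: frame_def)
    show "0 \<le> Im z" if "z \<in> frame x c K" for z
      using that \<nu>(2) ip[of z] by (force simp: frame_def outer_normal_def)
    fix w :: complex assume "0 < Im w"
    then show "\<exists>t>0. t *\<^sub>R w \<in> frame x c K"
      using \<nu>(3)[of "c * w"] ip[of w] by (simp add: frame_def)
  qed
  then obtain f \<tau> where bg: "boundary_graph (frame x c K) f \<tau>" by blast
  have "f 0 = 0"
    using boundary_graph.nonneg[OF bg, of 0] boundary_graph.flat[OF bg, of 0] boundary_graph.\<tau>[OF bg] by simp
  then show thesis using that c bg by blast
qed

text \<open>The last conclusion supplies a starting point whose orbit is not a single point. A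
  non-zero field has at most one zero, and the ball contains two boundary points.\<close>

theorem tangent_near:
  assumes S: "sym_inter K L" and K: "closed K" "convex K" "x \<in> K" "smooth_at K x"
    and L: "closed L" "convex L" "y \<in> L" "smooth_at L y"
  obtains r \<omega> \<beta> where "0 < r" "\<omega> \<noteq> 0 \<or> \<beta> \<noteq> 0" "tangent_on K \<omega> \<beta> (ball x r)"
    "\<exists>m\<in>frontier K \<inter> ball x r. kfield \<omega> \<beta> m \<noteq> 0"
proof -
  obtain c f \<tau> where c: "cmod c = 1" "boundary_graph (frame x c K) f \<tau>" "f 0 = 0"
    using smooth_frame[OF K] .
  obtain c' f' \<tau>' where c': "cmod c' = 1" "boundary_graph (frame y c' L) f' \<tau>'" "f' 0 = 0"
    using smooth_frame[OF L] .
  interpret K: boundary_graph "frame x c K" f \<tau> by fact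
  interpret L: boundary_graph "frame y c' L" f' \<tau>' by fact
  define l where "l = min \<tau> \<tau>' / 2"
  have l: "0 < l" "l \<le> \<tau> / 2" "l \<le> \<tau>' / 2" using K.\<tau> L.\<tau> by (auto simp: l_def)
  obtain t where t: "2 * l / 5 \<le> t" "t \<le> \<tau>' / 2" "dist (L.pt (- l / 2)) (L.pt t) = l"
    using L.chord_exists[of l "- l / 2"] l by auto
  have "good_chord (frame y c' L) (L.pt (- l / 2)) (L.pt t)"
    using t l by (intro L.good_chord_pt) auto
  from K.tangent_near_0[OF sym_inter_frame[OF S c(1) c'(1)] L.convex this t(3) l(1,2)]
  obtain \<omega> \<beta> where v: "\<omega> \<noteq> 0 \<or> \<beta> \<noteq> 0" "tangent_on (frame x c K) \<omega> \<beta> (ball 0 (l / 4))" by blast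
  define \<beta>' where "\<beta>' = c * \<beta> - \<i> * of_real \<omega> * x"
  have c0: "c \<noteq> 0" using c by auto
  have v': "\<omega> \<noteq> 0 \<or> \<beta>' \<noteq> 0" using v c0 by (auto simp: \<beta>'_def)
  define m1 m2 where "m1 = x + c * K.pt 0" and "m2 = x + c * K.pt (l / 8)"
  have fr: "m1 \<in> frontier K" "m2 \<in> frontier K"
    using K.pt_frontier[of 0, unfolded frontier_frame[OF c(1) K(1)]]
      K.pt_frontier[of "l / 8", unfolded frontier_frame[OF c(1) K(1)]] l
    by (auto simp: frame_def m1_def m2_def)
  have "cmod (K.pt (l / 8)) \<le> l / 8 + f (l / 8)"
    using cmod_le[of "K.pt (l / 8)"] K.nonneg[of "l / 8"] l by simp
  also have "\<dots> < l / 4" using K.flat[of "l / 8"] l by simp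
  finally have "cmod (K.pt (l / 8)) < l / 4" .
  moreover have "K.pt 0 = 0" by (simp add: complex_eq_iff c(3))
  ultimately have "m1 \<in> ball x (l / 4)" "m2 \<in> ball x (l / 4)"
    using c l by (auto simp: m1_def m2_def dist_norm norm_mult)
  have "m1 \<noteq> m2"
  proof
    assume "m1 = m2"
    then have "K.pt 0 = K.pt (l / 8)" using c0 by (simp add: m1_def m2_def)
    then have "0 = l / 8" by (metis K.Re_pt)
    then show False using l by simp
  qed
  then have "kfield \<omega> \<beta>' m1 \<noteq> 0 \<or> kfield \<omega> \<beta>' m2 \<noteq> 0"
  proof -
    have "kfield \<omega> \<beta>' m1 - kfield \<omega> \<beta>' m2 = \<i> * of_real \<omega> * (m1 - m2)"
      by (simp add: kfield_def algebra_simps)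
    moreover have "kfield \<omega> \<beta>' m1 \<noteq> 0" if "\<omega> = 0" using v' that by (simp add: kfield_def)
    ultimately show ?thesis using \<open>m1 \<noteq> m2\<close>
      by (metis diff_self eq_iff_diff_eq_0 mult_eq_0_iff complex_i_not_zero of_real_eq_0_iff)
  qed
  then have "\<exists>m\<in>frontier K \<inter> ball x (l / 4). kfield \<omega> \<beta>' m \<noteq> 0"
    using fr \<open>m1 \<in> ball x (l / 4)\<close> \<open>m2 \<in> ball x (l / 4)\<close> by blast
  moreover have "tangent_on K \<omega> \<beta>' (ball x (l / 4))"
    unfolding \<beta>'_def by (rule tangent_on_frame[OF v(2) c(1)])
  ultimately show thesis using that[of "l / 4" \<omega> \<beta>'] v' l by simp
qed

section \<open>Orbits of tangent fields\<close>

lemma perp_parallel: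
  fixes n v w :: complex
  assumes "inner n v = 0" "inner n w = 0" "n \<noteq> 0" "v \<noteq> 0"
  obtains c where "w = c *\<^sub>R v"
proof -
  have "Re n * (Re v * Im w - Im v * Re w) = (Re n * Re v + Im n * Im v) * Im w - (Re n * Re w + Im n * Im w) * Im v"
    by (simp add: algebra_simps)
  moreover have "Im n * (Re v * Im w - Im v * Re w) = (Re n * Re w + Im n * Im w) * Re v - (Re n * Re v + Im n * Im v) * Re w"
    by (simp add: algebra_simps)
  ultimately have "Re n * (Re v * Im w - Im v * Re w) = 0" "Im n * (Re v * Im w - Im v * Re w) = 0"
    using assms(1,2) by (simp_all add: inner_complex_def)
  then have cross: "Re v * Im w = Im v * Re w" using assms(3) by (auto simp: complex_eq_iff)
  show thesis
  proof (cases "Re v = 0")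
    case True
    then have "Im v \<noteq> 0" using assms(4) by (auto simp: complex_eq_iff)
    then show thesis using cross True by (intro that[of "Im w / Im v"]) (auto simp: complex_eq_iff)
  next
    case False
    then show thesis using cross by (intro that[of "Re w / Re v"]) (auto simp: complex_eq_iff field_simps)
  qed
qed

text \<open>The solution of \<open>z' = kfield \<omega> \<beta> z\<close>; for
  \<open>\<omega> \<noteq> 0\<close> the field vanishes at
  \<open>\<i> * \<beta> / of_real \<omega>\<close>, the centre of rotation.\<close>

definition flow :: "real \<Rightarrow> complex \<Rightarrow> real \<Rightarrow> complex \<Rightarrow> complex" where
  "flow \<omega> \<beta> t z = (if \<omega> = 0 then z + of_real t * \<beta>
     else \<i> * \<beta> / of_real \<omega> + cis (\<omega> * t) * (z - \<i> * \<beta> / of_real \<omega>))"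

lemma flow_0 [simp]: "flow \<omega> \<beta> 0 z = z"
  by (simp add: flow_def)

lemma flow_add: "flow \<omega> \<beta> (s + t) z = flow \<omega> \<beta> s (flow \<omega> \<beta> t z)"
  by (simp add: flow_def algebra_simps cis_mult[symmetric])

lemma dist_flow [simp]: "dist (flow \<omega> \<beta> t z) (flow \<omega> \<beta> t w) = dist z w"
proof (cases "\<omega> = 0")
  case False
  have "flow \<omega> \<beta> t z - flow \<omega> \<beta> t w = cis (\<omega> * t) * (z - w)"
    using False by (simp add: flow_def algebra_simps)
  then show ?thesis by (simp add: dist_norm norm_mult)
qed (simp add: flow_def dist_norm)

lemma continuous_flow: "continuous_on UNIV (\<lambda>t. flow \<omega> \<beta> t z)"
  by (cases "\<omega> = 0") (auto simp: flow_def intro!: continuous_intros)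

lemma kfield_center: "\<omega> \<noteq> 0 \<Longrightarrow> kfield \<omega> \<beta> z = \<i> * of_real \<omega> * (z - \<i> * \<beta> / of_real \<omega>)"
  by (simp add: kfield_def field_simps)

lemma norm_kfield_flow [simp]: "cmod (kfield \<omega> \<beta> (flow \<omega> \<beta> t z)) = cmod (kfield \<omega> \<beta> z)"
proof (cases "\<omega> = 0")
  case False
  then show ?thesis unfolding kfield_center[OF False] by (simp add: flow_def norm_mult)
qed (simp add: kfield_def)

lemma norm_kfield_le: "cmod (kfield \<omega> \<beta> z) \<le> cmod (kfield \<omega> \<beta> w) + \<bar>\<omega>\<bar> * dist z w"
proof -
  have "kfield \<omega> \<beta> z = kfield \<omega> \<beta> w + \<i> * of_real \<omega> * (z - w)" by (simp add: kfield_def algebra_simps)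
  then show ?thesis
    using norm_triangle_ineq[of "kfield \<omega> \<beta> w" "\<i> * of_real \<omega> * (z - w)"] by (simp add: norm_mult dist_norm)
qed

text \<open>The derivative of the squared distance from \<open>y\<close> is twice the product of
  \<open>c - y\<close> with the velocity at \<open>c\<close>. Velocities are skew, so this equals
  the product with the velocity at \<open>y\<close>, which vanishes; only a second-order term
  remains.\<close>

lemma dist_flow_sq_le:
  assumes "inner (c - y) (kfield \<omega> \<beta> y) = 0"
  shows "(dist (flow \<omega> \<beta> h c) y)\<^sup>2 \<le> (dist c y)\<^sup>2 + h\<^sup>2 * (cmod (kfield \<omega> \<beta> c) * cmod (kfield \<omega> \<beta> y))"
proof (cases "\<omega> = 0")
  case True
  have e: "flow \<omega> \<beta> h c - y = (c - y) + h *\<^sub>R \<beta>" using True by (simp add: flow_def scaleR_conv_of_real)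
  have sq: "(cmod (a + h *\<^sub>R b))\<^sup>2 = (cmod a)\<^sup>2 + 2 * h * inner a b + h\<^sup>2 * (cmod b)\<^sup>2" for a b :: complex
    unfolding cmod_power2 by (simp add: inner_complex_def power2_eq_square algebra_simps)
  have "(dist (flow \<omega> \<beta> h c) y)\<^sup>2 = (cmod (c - y))\<^sup>2 + h\<^sup>2 * (cmod \<beta>)\<^sup>2"
    unfolding dist_norm e sq using assms True by (simp add: kfield_def)
  then show ?thesis using True by (simp add: dist_norm kfield_def power2_eq_square)
next
  case False
  define o' where "o' = \<i> * \<beta> / of_real \<omega>"
  define p q where "p = c - o'" and "q = y - o'"
  have kf: "kfield \<omega> \<beta> z = \<i> * of_real \<omega> * (z - o')" for z
    using kfield_center[OF False] by (simp add: o'_def)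
  \<comment> \<open>Orthogonality of \<open>c - y\<close> to the velocity at \<open>y\<close> makes
    \<open>c\<close>, \<open>y\<close> and the centre collinear. This removes the sine term
    below.\<close>
  have cr: "Re p * Im q = Im p * Re q"
  proof -
    have "inner (p - q) (\<i> * of_real \<omega> * q) = 0" using assms by (simp add: kf p_def q_def)
    then have "\<omega> * (Im p * Re q - Re p * Im q) = 0" by (simp add: inner_complex_def algebra_simps)
    then show ?thesis using False by simp
  qed
  let ?C = "cos (\<omega> * h)" and ?S = "sin (\<omega> * h)"
  have "(dist (flow \<omega> \<beta> h c) y)\<^sup>2 = (cmod (cis (\<omega> * h) * p - q))\<^sup>2"
    using False by (simp add: flow_def o'_def[symmetric] dist_norm p_def q_def algebra_simps)
  also have "\<dots> = (?C\<^sup>2 + ?S\<^sup>2) * ((Re p)\<^sup>2 + (Im p)\<^sup>2) + ((Re q)\<^sup>2 + (Im q)\<^sup>2)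
      - 2 * ?C * (Re p * Re q + Im p * Im q) - 2 * ?S * (Re p * Im q - Im p * Re q)"
  proof -
    have "(cmod (Complex x y * p - q))\<^sup>2 = (x\<^sup>2 + y\<^sup>2) * ((Re p)\<^sup>2 + (Im p)\<^sup>2) + ((Re q)\<^sup>2 + (Im q)\<^sup>2)
      - 2 * x * (Re p * Re q + Im p * Im q) - 2 * y * (Re p * Im q - Im p * Re q)" for x y
      unfolding cmod_power2 by (simp add: power2_eq_square algebra_simps)
    then show ?thesis by (simp only: cis.ctr)
  qed
  also have "\<dots> = (Re p)\<^sup>2 + (Im p)\<^sup>2 + ((Re q)\<^sup>2 + (Im q)\<^sup>2) - 2 * ?C * (Re p * Re q + Im p * Im q)"
    by (simp add: cr)
  also have "\<dots> = (cmod (p - q))\<^sup>2 + 2 * (1 - ?C) * inner p q"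
    unfolding cmod_power2 by (simp add: inner_complex_def power2_eq_square algebra_simps)
  also have "\<dots> \<le> (cmod (p - q))\<^sup>2 + (\<omega> * h)\<^sup>2 * (cmod p * cmod q)"
  proof -
    have "2 * (1 - ?C) * inner p q \<le> 2 * (1 - ?C) * (cmod p * cmod q)"
      using norm_cauchy_schwarz[of p q] by (intro mult_left_mono) auto
    also have "\<dots> \<le> (\<omega> * h)\<^sup>2 * (cmod p * cmod q)"
    proof (intro mult_right_mono)
      have "?C = 1 - 2 * (sin (\<omega> * h / 2))\<^sup>2" using cos_double_sin[of "\<omega> * h / 2"] by simp
      moreover have "\<bar>sin (\<omega> * h / 2)\<bar>\<^sup>2 \<le> \<bar>\<omega> * h / 2\<bar>\<^sup>2" by (intro power_mono abs_sin_x_le_abs_x) auto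
      ultimately show "2 * (1 - ?C) \<le> (\<omega> * h)\<^sup>2" by (simp add: power_divide)
    qed auto
    finally show ?thesis by simp
  qed
  also have "(\<omega> * h)\<^sup>2 * (cmod p * cmod q) = h\<^sup>2 * (cmod (kfield \<omega> \<beta> c) * cmod (kfield \<omega> \<beta> y))"
    by (simp add: kf norm_mult p_def q_def power2_eq_square)
  also have "p - q = c - y" by (simp add: p_def q_def)
  finally show ?thesis by (simp add: dist_norm)
qed

lemma dist_flow_le: "dist (flow \<omega> \<beta> h c) c \<le> \<bar>h\<bar> * cmod (kfield \<omega> \<beta> c)"
proof -
  have "(dist (flow \<omega> \<beta> h c) c)\<^sup>2 \<le> (\<bar>h\<bar> * cmod (kfield \<omega> \<beta> c))\<^sup>2"
    using dist_flow_sq_le[of c c \<omega> \<beta> h] by (simp add: power_mult_distrib power2_eq_square[of "cmod _"])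
  then show ?thesis by (rule power2_le_imp_le) auto
qed

text \<open>Exchanging \<open>x\<close> and \<open>y\<close> bounds the increment on both sides, so
  the derivative is zero.\<close>

lemma quadratic_increment_constant:
  fixes g :: "real \<Rightarrow> real"
  assumes "convex S" "\<And>x y. x \<in> S \<Longrightarrow> y \<in> S \<Longrightarrow> g y \<le> g x + C * (y - x)\<^sup>2" "x \<in> S" "y \<in> S"
  shows "g x = g y"
proof -
  have ab: "\<bar>g y - g x\<bar> \<le> \<bar>C\<bar> * (y - x)\<^sup>2" if "x \<in> S" "y \<in> S" for x y
  proof -
    have "C * (y - x)\<^sup>2 \<le> \<bar>C\<bar> * (y - x)\<^sup>2" by (intro mult_right_mono) auto
    then show ?thesis using assms(2)[OF that] assms(2)[OF that(2,1)] by (simp add: power2_commute[of x y] abs_le_iff)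
  qed
  have "(g has_field_derivative 0) (at x within S)" if "x \<in> S" for x
    unfolding has_field_derivative_iff
  proof (rule Lim_null_comparison)
    show "eventually (\<lambda>y. norm ((g y - g x) / (y - x)) \<le> \<bar>C\<bar> * \<bar>y - x\<bar>) (at x within S)"
      unfolding eventually_at_filter
    proof (intro always_eventually allI impI)
      fix y assume "y \<noteq> x" "y \<in> S"
      then show "norm ((g y - g x) / (y - x)) \<le> \<bar>C\<bar> * \<bar>y - x\<bar>"
        using ab[OF that, of y] by (simp add: norm_divide divide_le_eq power2_eq_square mult.assoc abs_mult[symmetric])
    qed
    show "((\<lambda>y. \<bar>C\<bar> * \<bar>y - x\<bar>) \<longlongrightarrow> 0) (at x within S)"
      by (rule tendsto_eq_intros refl | simp)+
  qed
  then obtain c where "\<And>x. x \<in> S \<Longrightarrow> g x = c"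
    using has_field_derivative_zero_constant[OF assms(1), of g] by blast
  then show ?thesis using assms by simp
qed

text \<open>The squared distance to \<open>K\<close> changes only to second order along the flow: the
  displacement from the nearest point is a normal there, and the field is skew.\<close>

lemma flow_preserves_distance:
  assumes K: "closed K" "convex K" "m \<in> K" and tg: "tangent_on K \<omega> \<beta> (ball m r)" "0 < r"
  obtains \<delta> where "0 < \<delta>" "\<And>z t. dist m z < \<delta> \<Longrightarrow> \<bar>t\<bar> \<le> \<delta> \<Longrightarrow> flow \<omega> \<beta> t z \<in> K \<longleftrightarrow> z \<in> K"
proof -
  define V where "V = cmod (kfield \<omega> \<beta> m) + \<bar>\<omega>\<bar> + 1"
  have V: "V > 0" by (simp add: V_def add_nonneg_pos)
  have kV: "cmod (kfield \<omega> \<beta> z) \<le> V" if "dist z m \<le> 1" for z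
    using norm_kfield_le[of \<omega> \<beta> z m] mult_left_mono[OF that, of "\<bar>\<omega>\<bar>"] by (simp add: V_def)
  \<comment> \<open>For times up to \<open>\<delta>\<close> the orbit stays within a third of
    \<open>min r 1\<close> of \<open>m\<close>, and its nearest points in \<open>K\<close> within
    two thirds. There the field is tangent and its size is at most \<open>V\<close>.\<close>
  define \<delta> where "\<delta> = min r 1 / (3 * (1 + V))"
  have "3 * (1 + V) > 0" using V by simp
  then have \<delta>: "\<delta> > 0" "\<delta> * (3 * (1 + V)) = min r 1"
    unfolding \<delta>_def using tg by (simp_all only: nonzero_divide_eq_eq zero_less_divide_iff) auto
  have \<delta>1: "\<delta> + \<delta> * V = min r 1 / 3" using \<delta>(2) by (simp add: algebra_simps)
  have "\<delta> * V \<ge> 0" using \<delta> V by simp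
  then have "\<delta> \<le> min r 1 / 3" using \<delta>1 by linarith
  then have dl: "\<delta> \<le> 1" by linarith
  show thesis
  proof
    fix z t assume z: "dist m z < \<delta>" and t: "\<bar>t\<bar> \<le> \<delta>"
    define c where "c s = flow \<omega> \<beta> s z" for s
    define y where "y s = closest_point K (c s)" for s
    have ne: "K \<noteq> {}" using K by auto
    have yK: "y s \<in> K" for s using closest_point_in_set[OF K(1) ne] by (simp add: y_def)
    have near: "dist (c s) m \<le> min r 1 / 3" if "\<bar>s\<bar> \<le> \<delta>" for s
    proof -
      have "dist (c s) z \<le> \<bar>s\<bar> * cmod (kfield \<omega> \<beta> z)" unfolding c_def by (rule dist_flow_le)
      also have "\<dots> \<le> \<delta> * V" using that z dl \<delta> by (intro mult_mono kV) (auto simp: dist_commute)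
      finally show ?thesis using dist_triangle[of "c s" m z] z \<delta>1 dist_commute[of m z] by linarith
    qed
    have neary: "dist (y s) m < min r 1" if "\<bar>s\<bar> \<le> \<delta>" for s
    proof -
      have "dist (c s) (y s) \<le> dist (c s) m" unfolding y_def by (rule closest_point_le[OF K(1) K(3)])
      then have "dist (y s) m \<le> 2 * (min r 1 / 3)"
        using near[OF that] dist_triangle[of "y s" m "c s"] dist_commute[of "y s" "c s"] by linarith
      moreover have "min r 1 > 0" using tg by simp
      ultimately show ?thesis by linarith
    qed
    have perp: "inner (c s - y s) (kfield \<omega> \<beta> (y s)) = 0" if "\<bar>s\<bar> \<le> \<delta>" for s
    proof -
      have "outer_normal K (y s) (c s - y s)"
        unfolding outer_normal_def y_def using closest_point_dot[OF K(2,1)] by blast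
      moreover have "y s \<in> K \<inter> ball m r" using yK neary[OF that] by (simp add: dist_commute)
      ultimately show ?thesis using tg(1) by (simp add: tangent_on_def)
    qed
    define g where "g s = (dist (c s) (y s))\<^sup>2" for s
    have inc: "g s' \<le> g s + V * V * (s' - s)\<^sup>2" if "s \<in> {-\<delta>..\<delta>}" "s' \<in> {-\<delta>..\<delta>}" for s s'
    proof -
      have s: "\<bar>s\<bar> \<le> \<delta>" using that by auto
      have cs: "c s' = flow \<omega> \<beta> (s' - s) (c s)" by (simp add: c_def flow_add[symmetric])
      \<comment> \<open>Measuring from the old nearest point gives only an upper bound, but it holds
        for \<open>s'\<close> on either side of \<open>s\<close>.\<close>
      have "dist (c s') (y s') \<le> dist (c s') (y s)"
        unfolding y_def by (rule closest_point_le[OF K(1)]) (use yK in \<open>simp add: y_def\<close>)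
      then have "g s' \<le> (dist (c s') (y s))\<^sup>2" unfolding g_def by (intro power_mono) auto
      also have "\<dots> \<le> g s + (s' - s)\<^sup>2 * (cmod (kfield \<omega> \<beta> (c s)) * cmod (kfield \<omega> \<beta> (y s)))"
        unfolding cs g_def by (rule dist_flow_sq_le[OF perp[OF s]])
      also have "\<dots> \<le> g s + (s' - s)\<^sup>2 * (V * V)"
        using near[OF s] neary[OF s] V by (intro add_left_mono mult_left_mono mult_mono kV) auto
      finally show ?thesis by (simp add: mult.commute)
    qed
    have "g t = g 0"
      by (rule quadratic_increment_constant[of "{-\<delta>..\<delta>}", OF _ inc]) (use t \<delta> in auto)
    moreover have "c s \<in> K \<longleftrightarrow> g s = 0" for s
    proof
      assume "c s \<in> K" then show "g s = 0" by (simp add: g_def y_def closest_point_self)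
    next
      assume "g s = 0" then show "c s \<in> K" using yK[of s] by (simp add: g_def)
    qed
    ultimately have "c t \<in> K \<longleftrightarrow> c 0 \<in> K" by simp
    then show "flow \<omega> \<beta> t z \<in> K \<longleftrightarrow> z \<in> K" by (simp add: c_def)
  qed (use \<delta> in auto)
qed

text \<open>Membership is preserved in both directions, so points outside \<open>K\<close>
  arbitrarily near to \<open>m\<close> are carried to points outside \<open>K\<close> near its
  image.\<close>

lemma flow_frontier_local:
  assumes K: "closed K" "convex K" "m \<in> frontier K" and tg: "tangent_on K \<omega> \<beta> (ball m r)" "0 < r"
  obtains \<delta> where "0 < \<delta>" "\<And>t. \<bar>t\<bar> \<le> \<delta> \<Longrightarrow> flow \<omega> \<beta> t m \<in> frontier K"
proof -
  have mK: "m \<in> K" using K by (meson frontier_subset_closed subsetD)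
  obtain \<delta> where \<delta>: "0 < \<delta>" "\<And>z t. dist m z < \<delta> \<Longrightarrow> \<bar>t\<bar> \<le> \<delta> \<Longrightarrow> flow \<omega> \<beta> t z \<in> K \<longleftrightarrow> z \<in> K"
    using flow_preserves_distance[OF K(1,2) mK tg] by blast
  show thesis
  proof
    fix t assume t: "\<bar>t\<bar> \<le> \<delta>"
    show "flow \<omega> \<beta> t m \<in> frontier K"
      unfolding frontier_straddle
    proof (intro allI impI conjI)
      fix e :: real assume e: "0 < e"
      show "\<exists>x\<in>K. dist (flow \<omega> \<beta> t m) x < e"
        using \<delta>(2)[of m t] \<delta>(1) t mK e by (intro bexI[of _ "flow \<omega> \<beta> t m"]) auto
      have "0 < min e \<delta>" using e \<delta> by simp
      then obtain z where z: "z \<notin> K" "dist m z < min e \<delta>"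
        using K(3) unfolding frontier_straddle by blast
      then have "flow \<omega> \<beta> t z \<notin> K" using \<delta>(2)[of z t] t by simp
      then show "\<exists>x. x \<notin> K \<and> dist (flow \<omega> \<beta> t m) x < e" using z by (intro exI[of _ "flow \<omega> \<beta> t z"]) auto
    qed
  qed (rule \<delta>(1))
qed

lemma outer_normal_exists:
  assumes "convex K" "interior K \<noteq> {}" "x \<in> frontier K"
  obtains n where "n \<noteq> 0" "outer_normal K x n"
proof -
  have "x \<in> closure K" "x \<notin> rel_interior K"
    using assms by (simp_all add: frontier_def rel_interior_nonempty_interior)
  then obtain a where a: "a \<noteq> 0" "\<And>y. y \<in> closure K \<Longrightarrow> inner a x \<le> inner a y"
    using supporting_hyperplane_relative_frontier[OF assms(1)] by metis
  show thesis
  proof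
    show "- a \<noteq> 0" using a by simp
    show "outer_normal K x (- a)"
      unfolding outer_normal_def using a(2) closure_subset[of K] by (auto simp: inner_diff_right)
  qed
qed

text \<open>For a rotation about \<open>z\<close> all velocities are orthogonal to the displacement
  from \<open>z\<close>; this shows that the orbit of \<open>z\<close> under a field not vanishing
  there is different. The product is computed exactly, and
  \<open>s \<le> 1 / \<bar>\<omega>\<bar>\<close> keeps its sine factor away from zero.\<close>

lemma flow_leaves:
  assumes "kfield \<omega> \<beta> z \<noteq> 0" "0 < \<epsilon>"
  obtains s where "0 < s" "s < \<epsilon>" "inner (flow \<omega> \<beta> s z - z) (kfield \<omega> \<beta> (flow \<omega> \<beta> s z)) \<noteq> 0"
proof (cases "\<omega> = 0")
  case True
  then have "flow \<omega> \<beta> (\<epsilon> / 2) z - z = (\<epsilon> / 2) *\<^sub>R \<beta>" by (simp add: flow_def scaleR_conv_of_real)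
  then have "inner (flow \<omega> \<beta> (\<epsilon> / 2) z - z) (kfield \<omega> \<beta> (flow \<omega> \<beta> (\<epsilon> / 2) z)) = \<epsilon> / 2 * inner \<beta> \<beta>"
    using True by (simp add: kfield_def)
  moreover have "\<beta> \<noteq> 0" using assms True by (simp add: kfield_def)
  ultimately show thesis using assms by (intro that[of "\<epsilon> / 2"]) auto
next
  case False
  define o' where "o' = \<i> * \<beta> / of_real \<omega>"
  define p where "p = z - o'"
  define s where "s = min (\<epsilon> / 2) (1 / \<bar>\<omega>\<bar>)"
  have s: "0 < s" "s < \<epsilon>" "s \<le> 1 / \<bar>\<omega>\<bar>" using assms False by (auto simp: s_def)
  have "\<bar>\<omega>\<bar> * s \<le> \<bar>\<omega>\<bar> * (1 / \<bar>\<omega>\<bar>)" using s(3) by (rule mult_left_mono) simp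
  then have "0 < \<bar>\<omega>\<bar> * s" "\<bar>\<omega>\<bar> * s \<le> 1" using False s by auto
  then have "0 < sin (\<bar>\<omega>\<bar> * s)" using pi_gt3 by (intro sin_gt_zero) auto
  then have sn: "sin (\<omega> * s) \<noteq> 0" by (cases "\<omega> > 0") auto
  have kf: "kfield \<omega> \<beta> w = \<i> * of_real \<omega> * (w - o')" for w
    using kfield_center[OF False] by (simp add: o'_def)
  have fl: "flow \<omega> \<beta> s z = o' + cis (\<omega> * s) * p" using False by (simp add: flow_def o'_def p_def)
  have p0: "p \<noteq> 0" using assms by (auto simp: kf p_def)
  have gen: "inner (Complex x y * p - p) (\<i> * of_real \<omega> * (Complex x y * p)) = \<omega> * y * ((Re p)\<^sup>2 + (Im p)\<^sup>2)" for x y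
    by (simp add: inner_complex_def power2_eq_square algebra_simps)
  have "inner (flow \<omega> \<beta> s z - z) (kfield \<omega> \<beta> (flow \<omega> \<beta> s z))
      = inner (cis (\<omega> * s) * p - p) (\<i> * of_real \<omega> * (cis (\<omega> * s) * p))"
  proof -
    have "o' + w - z = w - p" for w by (simp add: p_def)
    then show ?thesis by (simp only: fl kf add_diff_cancel_left')
  qed
  also have "\<dots> = \<omega> * sin (\<omega> * s) * (cmod p)\<^sup>2" unfolding cmod_power2 cis.ctr by (rule gen)
  also have "\<dots> \<noteq> 0" using False sn p0 by simp
  finally show thesis using that s by blast
qed

text \<open>A field vanishing at \<open>z\<close> is a rotation about \<open>z\<close>, which cannot be tangent to the orbit through \<open>z\<close>
  of a field that does not vanish there.\<close>

lemma tangent_fields_parallel: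
  assumes K: "convex K" "interior K \<noteq> {}"
    and fr: "0 < \<epsilon>" "\<And>s. \<bar>s\<bar> < \<epsilon> \<Longrightarrow> flow \<omega> \<beta> s z \<in> frontier K \<inter> K \<inter> U"
    and tg: "tangent_on K \<omega> \<beta> U" "tangent_on K \<omega>' \<beta>' U"
    and nz: "kfield \<omega> \<beta> z \<noteq> 0"
  obtains c where "\<omega>' = c * \<omega>" "\<beta>' = c *\<^sub>R \<beta>"
proof -
  have par: "\<exists>c. kfield \<omega>' \<beta>' (flow \<omega> \<beta> s z) = c *\<^sub>R kfield \<omega> \<beta> (flow \<omega> \<beta> s z)" if s: "\<bar>s\<bar> < \<epsilon>" for s
  proof -
    obtain n where n: "n \<noteq> 0" "outer_normal K (flow \<omega> \<beta> s z) n"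
      using outer_normal_exists[OF K] fr(2)[OF s] by blast
    moreover have "kfield \<omega> \<beta> (flow \<omega> \<beta> s z) \<noteq> 0" using nz norm_kfield_flow[of \<omega> \<beta> s z] by (metis norm_eq_zero)
    moreover have "inner n (kfield \<omega> \<beta> (flow \<omega> \<beta> s z)) = 0" "inner n (kfield \<omega>' \<beta>' (flow \<omega> \<beta> s z)) = 0"
      using tg fr(2)[OF s] n unfolding tangent_on_def by blast+
    ultimately show ?thesis by (metis perp_parallel)
  qed
  obtain c where c: "kfield \<omega>' \<beta>' z = c *\<^sub>R kfield \<omega> \<beta> z" using par[of 0] fr(1) by auto
  define \<kappa> where "\<kappa> = \<omega>' - c * \<omega>"
  have diff: "kfield \<omega>' \<beta>' w - c *\<^sub>R kfield \<omega> \<beta> w = \<i> * of_real \<kappa> * (w - z)" for w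
  proof -
    have "kfield \<omega>' \<beta>' w - c *\<^sub>R kfield \<omega> \<beta> w = (kfield \<omega>' \<beta>' w - kfield \<omega>' \<beta>' z) - c *\<^sub>R (kfield \<omega> \<beta> w - kfield \<omega> \<beta> z)"
      by (simp add: c algebra_simps)
    also have "\<dots> = \<i> * of_real \<kappa> * (w - z)" by (simp add: kfield_def \<kappa>_def scaleR_conv_of_real algebra_simps)
    finally show ?thesis .
  qed
  have "\<kappa> = 0"
  proof (rule ccontr)
    assume \<kappa>: "\<kappa> \<noteq> 0"
    obtain s where s: "0 < s" "s < \<epsilon>" "inner (flow \<omega> \<beta> s z - z) (kfield \<omega> \<beta> (flow \<omega> \<beta> s z)) \<noteq> 0"
      using flow_leaves[OF nz fr(1)] .
    define w where "w = flow \<omega> \<beta> s z"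
    obtain e where "kfield \<omega>' \<beta>' w = e *\<^sub>R kfield \<omega> \<beta> w" using par[of s] s by (auto simp: w_def)
    then have e: "\<i> * of_real \<kappa> * (w - z) = (e - c) *\<^sub>R kfield \<omega> \<beta> w" using diff[of w] by (simp add: algebra_simps)
    have "inner (w - z) (\<i> * of_real \<kappa> * (w - z)) = 0" by (simp add: inner_complex_def)
    then have "(e - c) * inner (w - z) (kfield \<omega> \<beta> w) = 0" unfolding e by simp
    then have "e = c" using s by (simp add: w_def)
    then have "w = z" using e \<kappa> by simp
    then show False using s by (simp add: w_def)
  qed
  then have "\<omega>' = c * \<omega>" by (simp add: \<kappa>_def)
  moreover have "\<beta>' = c *\<^sub>R \<beta>"
    using c unfolding kfield_def \<open>\<omega>' = c * \<omega>\<close> by (simp add: scaleR_conv_of_real algebra_simps)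
  ultimately show thesis by (rule that)
qed

section \<open>Continuation of a tangent field along its orbit\<close>

lemma tangent_on_mono: "tangent_on K \<omega> \<beta> U \<Longrightarrow> V \<subseteq> U \<Longrightarrow> tangent_on K \<omega> \<beta> V"
  unfolding tangent_on_def by blast

text \<open>Connectedness of the time axis. Near a good time the local flow keeps the orbit in the
  frontier. At a limit of good times \<open>loc\<close> gives some field, which is tangent along a
  piece of the orbit where the given field is tangent too, so the two are proportional.\<close>

lemma flow_frontier:
  assumes K: "closed K" "convex K" "interior K \<noteq> {}"
    and loc: "\<And>x. x \<in> frontier K \<Longrightarrow> \<exists>r>0. \<exists>\<omega> \<beta>. (\<omega> \<noteq> 0 \<or> \<beta> \<noteq> 0) \<and> tangent_on K \<omega> \<beta> (ball x r)"
    and x0: "x0 \<in> frontier K" "tangent_on K \<omega> \<beta> (ball x0 r)" "0 < r" "kfield \<omega> \<beta> x0 \<noteq> 0"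
  shows "flow \<omega> \<beta> t x0 \<in> frontier K"
proof -
  define c where "c t = flow \<omega> \<beta> t x0" for t
  define V where "V = cmod (kfield \<omega> \<beta> x0)"
  have V: "V > 0" using x0 by (simp add: V_def)
  have cont: "continuous_on UNIV c" unfolding c_def[abs_def] by (rule continuous_flow)
  have cadd: "c (s + t) = flow \<omega> \<beta> s (c t)" for s t by (simp add: c_def flow_add)
  have kc: "cmod (kfield \<omega> \<beta> (c t)) = V" for t by (simp add: c_def V_def)
  have step: "dist (flow \<omega> \<beta> s (c t)) (c t) \<le> \<bar>s\<bar> * V" for s t
    using dist_flow_le[of \<omega> \<beta> s "c t"] by (simp add: kc)
  have frK: "frontier K \<subseteq> K" using K by (simp add: frontier_subset_closed)
  \<comment> \<open>Besides membership in the frontier, tangency of this very field near the point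
    is recorded; it is what allows the orbit to be continued.\<close>
  define E where "E = {t. c t \<in> frontier K \<and> (\<exists>r>0. tangent_on K \<omega> \<beta> (ball (c t) r))}"
  have stay: "\<exists>\<delta>>0. \<forall>s. \<bar>s\<bar> < \<delta> \<longrightarrow> c (s + t) \<in> frontier K \<and> dist (c (s + t)) (c t) < e"
    if t: "t \<in> E" and e: "e > 0" for t e
  proof -
    obtain r where r: "r > 0" "c t \<in> frontier K" "tangent_on K \<omega> \<beta> (ball (c t) r)" using t by (auto simp: E_def)
    obtain \<delta> where \<delta>: "0 < \<delta>" "\<And>s. \<bar>s\<bar> \<le> \<delta> \<Longrightarrow> flow \<omega> \<beta> s (c t) \<in> frontier K"
      using flow_frontier_local[OF K(1,2) r(2,3,1)] by blast
    show ?thesis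
    proof (intro exI[of _ "min \<delta> (e / V)"] conjI allI impI)
      show "0 < min \<delta> (e / V)" using \<delta> V e by simp
      fix s assume s: "\<bar>s\<bar> < min \<delta> (e / V)"
      then show "c (s + t) \<in> frontier K" using \<delta>(2)[of s] by (simp add: cadd)
      have "\<bar>s\<bar> * V < e" using s V by (simp add: pos_less_divide_eq)
      then show "dist (c (s + t)) (c t) < e" using step[of s t] by (simp add: cadd)
    qed
  qed
  have "open E"
    unfolding open_dist
  proof
    fix t assume t: "t \<in> E"
    then obtain r where r: "r > 0" "tangent_on K \<omega> \<beta> (ball (c t) r)" by (auto simp: E_def)
    obtain \<delta> where \<delta>: "\<delta> > 0" "\<And>s. \<bar>s\<bar> < \<delta> \<Longrightarrow> c (s + t) \<in> frontier K \<and> dist (c (s + t)) (c t) < r / 2"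
      using stay[OF t, of "r / 2"] r by auto
    show "\<exists>e>0. \<forall>y. dist y t < e \<longrightarrow> y \<in> E"
    proof (intro exI[of _ \<delta>] conjI allI impI \<delta>(1))
      fix y assume "dist y t < \<delta>"
      then have y: "c y \<in> frontier K" "dist (c y) (c t) < r / 2" using \<delta>(2)[of "y - t"] by (auto simp: dist_real_def)
      have "ball (c y) (r / 2) \<subseteq> ball (c t) r"
      proof
        fix w assume "w \<in> ball (c y) (r / 2)"
        then show "w \<in> ball (c t) r" using y(2) dist_triangle[of "c t" w "c y"] by (simp add: dist_commute)
      qed
      then show "y \<in> E" using y(1) r tangent_on_mono[OF r(2)] by (auto simp: E_def intro!: exI[of _ "r / 2"])
    qed
  qed
  moreover have "closed E"
    unfolding closed_sequential_limits
  proof (intro allI impI)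
    fix T t assume "(\<forall>n. T n \<in> E) \<and> T \<longlonglongrightarrow> t"
    then have T: "\<And>n. T n \<in> E" "T \<longlonglongrightarrow> t" by auto
    have lim: "(\<lambda>n. c (T n)) \<longlonglongrightarrow> c t"
      using continuous_on_tendsto_compose[OF cont T(2)] by simp
    have ct: "c t \<in> frontier K"
      using closed_sequentially[OF frontier_closed _ lim] T(1) by (auto simp: E_def)
    obtain r0 \<omega>' \<beta>' where r0: "r0 > 0" "\<omega>' \<noteq> 0 \<or> \<beta>' \<noteq> 0" "tangent_on K \<omega>' \<beta>' (ball (c t) r0)"
      using loc[OF ct] by blast
    obtain n where n: "dist (c (T n)) (c t) < r0 / 2"
      using lim r0(1) unfolding lim_sequentially by (metis half_gt_zero order_refl)
    obtain r1 where r1: "r1 > 0" "tangent_on K \<omega> \<beta> (ball (c (T n)) r1)" using T(1)[of n] by (auto simp: E_def)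
    define e where "e = min r1 (r0 / 2)"
    have e: "e > 0" using r0 r1 by (simp add: e_def)
    define U where "U = ball (c (T n)) e"
    have U0: "U \<subseteq> ball (c t) r0"
    proof
      fix w assume "w \<in> U"
      then show "w \<in> ball (c t) r0"
        using n dist_triangle[of "c t" w "c (T n)"] by (simp add: U_def e_def dist_commute)
    qed
    have U1: "U \<subseteq> ball (c (T n)) r1" by (auto simp: U_def e_def)
    obtain \<delta> where \<delta>: "\<delta> > 0" "\<And>s. \<bar>s\<bar> < \<delta> \<Longrightarrow> c (s + T n) \<in> frontier K \<and> dist (c (s + T n)) (c (T n)) < e"
      using stay[OF T(1)[of n] e] by auto
    have "flow \<omega> \<beta> s (c (T n)) \<in> frontier K \<inter> K \<inter> U" if "\<bar>s\<bar> < \<delta>" for s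
      using \<delta>(2)[OF that] frK by (auto simp: cadd U_def dist_commute)
    moreover have "kfield \<omega> \<beta> (c (T n)) \<noteq> 0" using kc[of "T n"] V by auto
    ultimately obtain k where k: "\<omega>' = k * \<omega>" "\<beta>' = k *\<^sub>R \<beta>"
      using tangent_fields_parallel[OF K(2,3) \<delta>(1), of \<omega> \<beta> "c (T n)" U \<omega>' \<beta>']
        tangent_on_mono[OF r1(2) U1] tangent_on_mono[OF r0(3) U0] by blast
    have k0: "k \<noteq> 0" using k r0(2) by auto
    have "kfield \<omega>' \<beta>' m = k *\<^sub>R kfield \<omega> \<beta> m" for m
      by (simp add: kfield_def k scaleR_conv_of_real algebra_simps)
    then have "tangent_on K \<omega> \<beta> (ball (c t) r0)" using r0(3) k0 by (simp add: tangent_on_def)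
    then show "t \<in> E" using ct r0(1) by (auto simp: E_def)
  qed
  ultimately have "E = {} \<or> E = UNIV" using clopen by blast
  moreover have "0 \<in> E" using x0 by (auto simp: E_def c_def)
  ultimately have "t \<in> E" by blast
  then show ?thesis by (simp add: E_def c_def)
qed

text \<open>A point of the disc is the midpoint of a chord orthogonal to its radius. A point of
  \<open>K\<close> outside would make the point of the circle towards it an interior point.\<close>

lemma disc_of_circle_frontier:
  fixes K :: "complex set"
  assumes "closed K" "convex K" "K \<noteq> UNIV" and R: "0 < R" and fr: "sphere p R \<subseteq> frontier K"
  shows "K = cball p R"
proof -
  have sp: "sphere p R \<subseteq> K" using fr frontier_subset_closed[OF assms(1)] by blast
  have sub: "cball p R \<subseteq> K"
  proof
    fix z assume z: "z \<in> cball p R"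
    define w where "w = z - p"
    have w: "cmod w \<le> R" using z by (simp add: w_def dist_norm norm_minus_commute)
    obtain e where e: "cmod e = 1" "inner w e = 0"
    proof (cases "w = 0")
      case True then show thesis using that[of 1] by simp
    next
      case False
      have "inner w (\<i> * w) = 0" by (simp add: inner_complex_def)
      then have "inner w ((1 / cmod w) *\<^sub>R (\<i> * w)) = 0" by simp
      then show thesis using False by (intro that[of "(1 / cmod w) *\<^sub>R (\<i> * w)"]) (auto simp: norm_mult)
    qed
    define h where "h = sqrt (R\<^sup>2 - (cmod w)\<^sup>2)"
    have "(cmod w)\<^sup>2 \<le> R\<^sup>2" using w by (intro power_mono) auto
    then have h: "h\<^sup>2 = R\<^sup>2 - (cmod w)\<^sup>2" by (simp add: h_def)
    have sq: "(cmod (w + s *\<^sub>R e))\<^sup>2 = R\<^sup>2" if "s\<^sup>2 = h\<^sup>2" for s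
    proof -
      have "(cmod (w + s *\<^sub>R e))\<^sup>2 = (cmod w)\<^sup>2 + 2 * s * inner w e + s\<^sup>2 * (cmod e)\<^sup>2"
        unfolding cmod_power2 by (simp add: inner_complex_def power2_eq_square algebra_simps)
      then show ?thesis using e h that by simp
    qed
    have on: "z + s *\<^sub>R e \<in> sphere p R" if "s\<^sup>2 = h\<^sup>2" for s
    proof -
      have "cmod (w + s *\<^sub>R e) = R"
        using sq[OF that] R by (metis norm_ge_zero power2_eq_imp_eq less_imp_le)
      moreover have "z + s *\<^sub>R e - p = w + s *\<^sub>R e" by (simp add: w_def)
      ultimately show ?thesis unfolding mem_sphere by (metis dist_commute dist_norm)
    qed
    have "z + h *\<^sub>R e \<in> sphere p R" "z + (- h) *\<^sub>R e \<in> sphere p R"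
      by (rule on, simp)+
    then have "(1/2) *\<^sub>R (z + h *\<^sub>R e) + (1/2) *\<^sub>R (z + (- h) *\<^sub>R e) \<in> K"
      using sp assms(2) by (intro convexD) auto
    then show "z \<in> K" by (simp add: scaleR_add_right[symmetric])
  qed
  moreover have "K \<subseteq> cball p R"
  proof
    fix z assume z: "z \<in> K"
    show "z \<in> cball p R"
    proof (rule ccontr)
      assume "z \<notin> cball p R"
      then have d: "dist p z > R" by simp
      have pi: "p \<in> interior K" using sub R by (meson ball_subset_cball centre_in_ball interior_maximal open_ball subsetD order_trans)
      define y where "y = p + (R / dist p z) *\<^sub>R (z - p)"
      have "y \<in> sphere p R" using d R by (auto simp: y_def dist_norm norm_minus_commute)
      then have "y \<in> frontier K" using fr by blast
      moreover have "y \<in> interior K"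
      proof -
        have "y = z - (1 - R / dist p z) *\<^sub>R (z - p)" by (simp add: y_def algebra_simps)
        moreover have "0 < dist p z" using d R by linarith
        then have "0 < 1 - R / dist p z" "1 - R / dist p z \<le> 1" using d R by (simp_all add: pos_divide_less_eq)
        ultimately show ?thesis using mem_interior_convex_shrink[OF assms(2) pi z] by metis
      qed
      ultimately show False by (simp add: frontier_def)
    qed
  qed
  ultimately show ?thesis by blast
qed

text \<open>A closed convex set containing a line is invariant under translation along it. It is
  therefore determined by the set \<open>I\<close> of values of \<open>inner n\<close>, a closed
  interval with the largest element \<open>c\<close> that is bounded below or not.\<close>

lemma strip_or_half_plane_of_line_frontier:
  assumes K: "closed K" "convex K" "interior K \<noteq> {}" and \<beta>: "\<beta> \<noteq> (0::complex)"
    and fr: "\<And>t. x0 + of_real t * \<beta> \<in> frontier K"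
  shows "(\<exists>a b c. a \<noteq> 0 \<and> b < c \<and> K = {x. b \<le> inner a x \<and> inner a x \<le> c}) \<or>
    (\<exists>a b. a \<noteq> 0 \<and> K = {x. inner a x \<le> b})"
proof -
  have frK: "frontier K \<subseteq> K" using K by (simp add: frontier_subset_closed)
  have inv: "w + s *\<^sub>R \<beta> \<in> K" if w: "w \<in> K" for w s
  proof -
    \<comment> \<open>The point of the line with parameter \<open>(k + 1) * s\<close> gets the
      weight \<open>1 / (k + 1)\<close>: in the limit the contribution of \<open>x0\<close>
      disappears and the shift by \<open>s *\<^sub>R \<beta>\<close> remains.\<close>
    have "(\<lambda>k. (1 - inverse (real (Suc k))) *\<^sub>R w + inverse (real (Suc k)) *\<^sub>R (x0 + of_real (real (Suc k) * s) * \<beta>)) \<longlonglongrightarrow>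
       (1 - 0) *\<^sub>R w + 0 *\<^sub>R x0 + s *\<^sub>R \<beta>"
    proof -
      have "(1 - inverse (real (Suc k))) *\<^sub>R w + inverse (real (Suc k)) *\<^sub>R (x0 + of_real (real (Suc k) * s) * \<beta>)
         = (1 - inverse (real (Suc k))) *\<^sub>R w + inverse (real (Suc k)) *\<^sub>R x0 + s *\<^sub>R \<beta>" for k
      proof -
        have "inverse (real (Suc k)) *\<^sub>R (of_real (real (Suc k) * s) * \<beta>) = s *\<^sub>R \<beta>"
          by (simp add: scaleR_conv_of_real field_simps del: of_nat_Suc)
        then show ?thesis by (simp add: scaleR_add_right)
      qed
      then show ?thesis
        by (simp only:) (intro tendsto_intros LIMSEQ_inverse_real_of_nat)
    qed
    moreover have "(1 - inverse (real (Suc k))) *\<^sub>R w + inverse (real (Suc k)) *\<^sub>R (x0 + of_real (real (Suc k) * s) * \<beta>) \<in> K" for k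
      using w fr[of "real (Suc k) * s"] frK K(2) by (intro convexD) (auto simp: field_simps)
    ultimately show ?thesis using closed_sequentially[OF K(1)] by fastforce
  qed
  have "x0 \<in> frontier K" using fr[of 0] by simp
  then obtain n where n: "n \<noteq> 0" "outer_normal K x0 n" using outer_normal_exists[OF K(2,3)] by blast
  have n\<beta>: "inner n \<beta> = 0"
  proof -
    have "inner n (s *\<^sub>R \<beta>) \<le> 0" for s
      using n(2) fr[of s] frK unfolding outer_normal_def by (force simp: scaleR_conv_of_real)
    from this[of 1] this[of "-1"] show ?thesis by simp
  qed
  have full: "z \<in> K" if w: "w \<in> K" and eq: "inner n z = inner n w" for z w
  proof -
    obtain s where "z - w = s *\<^sub>R \<beta>"
      using perp_parallel[OF n\<beta> _ n(1) \<beta>, of "z - w"] eq by (auto simp: inner_diff_right)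
    then have "z = w + s *\<^sub>R \<beta>" by (simp add: algebra_simps)
    then show ?thesis using inv[OF w] by simp
  qed
  define c where "c = inner n x0"
  have x0K: "x0 \<in> K" using \<open>x0 \<in> frontier K\<close> frK by blast
  have ub: "inner n z \<le> c" if "z \<in> K" for z
    using n(2) that by (auto simp: outer_normal_def c_def inner_diff_right)
  define q where "q r = (r / inner n n) *\<^sub>R n" for r
  have nq: "inner n (q r) = r" for r using n(1) by (simp add: q_def)
  define I where "I = {r. q r \<in> K}"
  have KI: "z \<in> K \<longleftrightarrow> inner n z \<in> I" for z
    using full[of z "q (inner n z)"] full[of "q (inner n z)" z] by (auto simp: I_def nq)
  have conv: "r \<in> I" if "a \<in> I" "b \<in> I" "a \<le> r" "r \<le> b" for a b r
  proof (cases "a = b")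
    case False
    then have ab: "a < b" using that by simp
    define e where "e = (r - a) / (b - a)"
    have e: "0 \<le> e" "e \<le> 1" "e * (b - a) = r - a" using that ab by (auto simp: e_def)
    have "(1 - e) *\<^sub>R q a + e *\<^sub>R q b \<in> K" using that e K(2) by (intro convexD) (auto simp: I_def)
    moreover have "inner n ((1 - e) *\<^sub>R q a + e *\<^sub>R q b) = r"
      using e(3) by (simp add: inner_add_right nq algebra_simps)
    ultimately show ?thesis by (simp add: KI)
  qed (use that in auto)
  have cI: "c \<in> I" using x0K by (simp add: KI c_def)
  have ubI: "r \<le> c" if "r \<in> I" for r using ub[of "q r"] that by (simp add: I_def nq)
  show ?thesis
  proof (cases "bdd_below I")
    case False
    have "K = {x. inner n x \<le> c}"
    proof (intro set_eqI iffI)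
      fix z assume "z \<in> {x. inner n x \<le> c}"
      moreover obtain a where "a \<in> I" "a \<le> inner n z"
        using False by (metis bdd_belowI linear)
      ultimately show "z \<in> K" using conv[of a c "inner n z"] cI KI by simp
    qed (use ub in auto)
    then show ?thesis using n(1) by blast
  next
    case True
    have "closed I"
    proof -
      have "closed (q -` K)" unfolding q_def[abs_def]
        by (intro closed_vimage K continuous_intros) (use n in auto)
      then show ?thesis by (simp add: I_def vimage_def)
    qed
    define b where "b = Inf I"
    have bI: "b \<in> I" unfolding b_def using closed_contains_Inf[OF _ True \<open>closed I\<close>] cI by blast
    have lb: "b \<le> r" if "r \<in> I" for r unfolding b_def using that True by (rule cInf_lower)
    have Keq: "K = {x. b \<le> inner n x \<and> inner n x \<le> c}"
      using conv[OF bI cI] lb ubI by (auto simp: KI)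
    have "b < c"
    proof (rule ccontr)
      assume "\<not> b < c"
      then have "K \<subseteq> {x. inner n x = c}" using Keq by auto
      then have "interior K \<subseteq> interior {x. inner n x = c}" by (rule interior_mono)
      then show False using K(3) n(1) by (simp add: interior_hyperplane)
    qed
    then show ?thesis using Keq n(1) by blast
  qed
qed

theorem disc_strip_or_half_plane:
  assumes K: "closed K" "convex K" "interior K \<noteq> {}" "K \<noteq> UNIV"
    and loc: "\<And>x. x \<in> frontier K \<Longrightarrow> \<exists>r>0. \<exists>\<omega> \<beta>. (\<omega> \<noteq> 0 \<or> \<beta> \<noteq> 0) \<and> tangent_on K \<omega> \<beta> (ball x r) \<and>
      (\<exists>m\<in>frontier K \<inter> ball x r. kfield \<omega> \<beta> m \<noteq> 0)"
  shows "(\<exists>p R. 0 < R \<and> K = cball p R) \<or>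
    (\<exists>a b c. a \<noteq> 0 \<and> b < c \<and> K = {x. b \<le> inner a x \<and> inner a x \<le> c}) \<or>
    (\<exists>a b. a \<noteq> 0 \<and> K = {x. inner a x \<le> b})"
proof -
  have "frontier K \<noteq> {}" using K frontier_eq_empty[of K] by auto
  then obtain x where x: "x \<in> frontier K" by blast
  from loc[OF x] obtain r \<omega> \<beta> where r: "r > 0" "\<omega> \<noteq> 0 \<or> \<beta> \<noteq> 0" "tangent_on K \<omega> \<beta> (ball x r)"
    and "\<exists>m\<in>frontier K \<inter> ball x r. kfield \<omega> \<beta> m \<noteq> 0"
    by (elim exE conjE) (rule that)
  then obtain m where m: "m \<in> frontier K" "dist x m < r" "kfield \<omega> \<beta> m \<noteq> 0" by auto
  have "ball m (r - dist x m) \<subseteq> ball x r"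
  proof
    fix w assume "w \<in> ball m (r - dist x m)"
    then show "w \<in> ball x r" using dist_triangle[of x w m] by simp
  qed
  then have tg: "tangent_on K \<omega> \<beta> (ball m (r - dist x m))" by (rule tangent_on_mono[OF r(3)])
  have fl: "flow \<omega> \<beta> t m \<in> frontier K" for t
  proof (rule flow_frontier[OF K(1-3) _ m(1) tg _ m(3)])
    show "\<exists>r>0. \<exists>\<omega> \<beta>. (\<omega> \<noteq> 0 \<or> \<beta> \<noteq> 0) \<and> tangent_on K \<omega> \<beta> (ball x r)" if "x \<in> frontier K" for x
      using loc[OF that] by (elim exE conjE) (intro exI conjI)
    show "0 < r - dist x m" using m(2) by simp
  qed
  show ?thesis
  proof (cases "\<omega> = 0")
    case True
    then have "\<beta> \<noteq> 0" using r by simp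
    then show ?thesis
      using strip_or_half_plane_of_line_frontier[OF K(1-3), of \<beta> m] fl True by (auto simp: flow_def)
  next
    case False
    define p where "p = \<i> * \<beta> / of_real \<omega>"
    have fl': "p + cis (\<omega> * t) * (m - p) \<in> frontier K" for t using fl[of t] False by (simp add: flow_def p_def)
    have mp: "m \<noteq> p" using m(3) unfolding kfield_center[OF False] by (auto simp: p_def)
    have "sphere p (cmod (m - p)) \<subseteq> frontier K"
    proof
      fix w assume "w \<in> sphere p (cmod (m - p))"
      then have "cmod ((w - p) / (m - p)) = 1" using mp by (simp add: norm_divide dist_norm norm_minus_commute)
      then obtain a where "(w - p) / (m - p) = cis a"
        by (metis rcis_cmod_Arg rcis_def mult_1 of_real_1)
      then have "w = p + cis (\<omega> * (a / \<omega>)) * (m - p)" using mp False by (simp add: field_simps)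
      then show "w \<in> frontier K" using fl'[of "a / \<omega>"] by simp
    qed
    then show ?thesis using disc_of_circle_frontier[OF K(1,2,4)] mp by (metis zero_less_norm_iff eq_iff_diff_eq_0)
  qed
qed

section \<open>Exclusion of corners\<close>

text \<open>\<open>t\<close> is the barycentric weight of \<open>C\<close>, the only vertex with a
  height over the line through \<open>A\<close> and \<open>B\<close>.\<close>

lemma triangle_coord:
  assumes "z \<in> convex hull {A, B, C}" "A \<noteq> (B::complex)"
  obtains t where "0 \<le> t" "Im ((z - A) / (B - A)) = t * Im ((C - A) / (B - A))" "t = 1 \<longrightarrow> z = C"
proof -
  obtain u v w where u: "z = u *\<^sub>R A + v *\<^sub>R B + w *\<^sub>R C" "0 \<le> u" "0 \<le> v" "0 \<le> w" "u + v + w = 1"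
    using assms(1) unfolding convex_hull_3 by auto
  then have "z - A = of_real v * (B - A) + of_real w * (C - A)"
  proof -
    have e: "u = 1 - v - w" using u by simp
    show ?thesis unfolding u(1) e by (simp add: scaleR_conv_of_real algebra_simps)
  qed
  then have "(z - A) / (B - A) = of_real v + of_real w * ((C - A) / (B - A))"
    using assms(2) by (simp add: add_divide_distrib)
  moreover have "Im (of_real v + of_real w * q) = w * Im q" for q by simp
  ultimately have "Im ((z - A) / (B - A)) = w * Im ((C - A) / (B - A))" by (simp only:)
  moreover have "z = C" if "w = 1"
  proof -
    have "u = 0" "v = 0" using u that by auto
    then show ?thesis unfolding u(1) using that by simp
  qed
  ultimately show thesis using that u by blast
qed

text \<open>The longest side is the only diameter, so \<open>G\<close> permutes \<open>A\<close> and
  \<open>B\<close>. Two of the four candidates would send \<open>C\<close> across this side. Only an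
  inclusion is assumed, because this is all that survives in a limit of symmetries.\<close>

lemma scalene_triangle_rigid:
  assumes G: "isom G" "G ` (convex hull {A, B, C}) \<subseteq> convex hull {A, B, C}"
    and d: "dist A C < dist A B" "dist B C < dist A B" "dist A C \<noteq> dist B C"
    and nc: "Im ((C - A) / (B - A)) \<noteq> 0"
  shows "G = id"
proof -
  define S where "S = {A, B, C}"
  have fS: "finite S" by (simp add: S_def)
  have AB: "A \<noteq> B" using d by auto
  have SS: "u \<in> S \<Longrightarrow> v \<in> S \<Longrightarrow> norm (u - v) \<le> dist A B" for u v
    using d by (auto simp: S_def dist_norm norm_minus_commute)
  have le: "norm (x - y) \<le> dist A B" if "x \<in> convex hull S" "y \<in> convex hull S" for x y
    using simplex_extremal_le_exists[OF fS that] SS by (meson order_trans)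
  have vert: "x \<in> S" if x: "x \<in> convex hull S" and y: "y \<in> convex hull S" and xy: "norm (x - y) = dist A B" for x y
  proof (rule ccontr)
    assume "x \<notin> S"
    then obtain x' where "x' \<in> convex hull S" "norm (x - y) < norm (x' - y)"
      using simplex_furthest_lt[OF fS, of y] x by blast
    then show False using le[of x' y] y xy by simp
  qed
  have hS: "A \<in> convex hull S" "B \<in> convex hull S" "C \<in> convex hull S"
    by (auto simp: S_def intro: hull_inc)
  have GS: "G z \<in> convex hull S" if "z \<in> convex hull S" for z
    using G(2) that by (auto simp: S_def)
  have dG: "norm (G A - G B) = dist A B" using G(1) by (simp add: isom_def dist_norm)
  have "G A \<in> S" "G B \<in> S"
    using vert[OF GS[OF hS(1)] GS[OF hS(2)] dG] vert[OF GS[OF hS(2)] GS[OF hS(1)]] dG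
    by (auto simp: norm_minus_commute)
  then have GAB: "{G A, G B} = {A, B}"
    using dG d AB by (auto simp: S_def dist_norm norm_minus_commute doubleton_eq_iff)
  define D where "D = B - A"
  have D: "D \<noteq> 0" using AB by (simp add: D_def)
  define g where "g = (\<lambda>\<zeta>. (G (A + D * \<zeta>) - A) / D)"
  have gi: "isom g" unfolding g_def by (rule isom_similarity) (use G D in auto)
  have "{g 0, g 1} = {0, 1}"
    using GAB D by (auto simp: g_def D_def doubleton_eq_iff)
  then have cases: "g = id \<or> g = cnj \<or> g = (\<lambda>z. 1 - z) \<or> g = (\<lambda>z. 1 - cnj z)"
    by (rule isom_permuting_01[OF gi])
  define R where "R = (C - A) / D"
  have gR: "g R = (G C - A) / D" using D by (simp add: g_def R_def)
  have R0: "Im R \<noteq> 0" using nc by (simp add: R_def D_def)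
  have GC: "G C \<in> convex hull {A, B, C}" using GS[OF hS(3)] by (simp add: S_def)
  obtain t where "0 \<le> t" "Im ((G C - A) / (B - A)) = t * Im ((C - A) / (B - A))" "t = 1 \<longrightarrow> G C = C"
    by (rule triangle_coord[OF GC AB])
  then have t: "0 \<le> t" "Im (g R) = t * Im R" "t = 1 \<Longrightarrow> G C = C"
    unfolding gR using R_def D_def by auto
  have "g = id"
  proof (rule ccontr)
    assume "g \<noteq> id"
    moreover have "g \<noteq> cnj"
    proof
      assume "g = cnj"
      then have "(t + 1) * Im R = 0" using t by (simp add: algebra_simps)
      then show False using t R0 by simp
    qed
    moreover have "g \<noteq> (\<lambda>z. 1 - z)"
    proof
      assume "g = (\<lambda>z. 1 - z)"
      then have "(t + 1) * Im R = 0" using t by (simp add: algebra_simps)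
      then show False using t R0 by simp
    qed
    \<comment> \<open>The reflection in the perpendicular bisector keeps the height of
      \<open>C\<close>, and the triangle has no other point of this height; so \<open>C\<close> is
      fixed and equidistant from \<open>A\<close> and \<open>B\<close>.\<close>
    ultimately have g: "g = (\<lambda>z. 1 - cnj z)" using cases by blast
    then have "Im R = t * Im R" using t by simp
    then have "t = 1" using R0 by simp
    then have "g R = R" using t gR by (simp add: R_def)
    then have "Re R = 1 / 2" by (simp add: g complex_eq_iff)
    then have "cmod R = cmod (R - 1)" by (simp add: cmod_eq_cmod_iff power2_eq_square algebra_simps)
    moreover have RD: "R * D = C - A" unfolding R_def using D by simp
    have "(R - 1) * D = R * D - D" by (simp add: left_diff_distrib)
    then have "(R - 1) * D = C - B" unfolding RD by (simp add: D_def)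
    with RD have "cmod R * cmod D = dist A C" "cmod (R - 1) * cmod D = dist B C"
      by (metis dist_commute dist_norm norm_mult)+
    ultimately show False using d(3) by simp
  qed
  have "G z = z" for z
  proof -
    have "g ((z - A) / D) = (z - A) / D" using \<open>g = id\<close> by simp
    then show ?thesis using D by (simp add: g_def)
  qed
  then show ?thesis by auto
qed

text \<open>Iterating a rotation moves it away from the identity, since \<open>|v + 1|\<^sup>2 + |v - 1|\<^sup>2 = 4\<close> on the unit circle.\<close>

lemma rotation_power_far:
  assumes u: "cmod u = 1" "u \<noteq> 1"
  shows "\<exists>k. 1 \<le> cmod (u ^ k - 1)"
proof (rule ccontr)
  assume "\<not> ?thesis"
  then have less: "cmod (u ^ k - 1) < 1" for k by (simp add: not_le)
  \<comment> \<open>Only exponents that are powers of two are followed. While the powers stay within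
    distance 1 of the identity, each squaring multiplies the squared distance by at least 3.\<close>
  define d where "d k = (cmod (u ^ (2 ^ k) - 1))\<^sup>2" for k
  have grow: "3 ^ k * d 0 \<le> d k" for k
  proof (induction k)
    case (Suc k)
    define v where "v = u ^ (2 ^ k)"
    have v: "cmod v = 1" using u by (simp add: v_def norm_power)
    have "(cmod (v + 1))\<^sup>2 + (cmod (v - 1))\<^sup>2 = 2 * (cmod v)\<^sup>2 + 2"
      unfolding cmod_power2 by (simp add: power2_eq_square algebra_simps)
    moreover have "(cmod (v - 1))\<^sup>2 < 1\<^sup>2"
      using less[of "2 ^ k"] by (intro power_strict_mono) (auto simp: v_def)
    ultimately have v3: "3 \<le> (cmod (v + 1))\<^sup>2" using v by simp
    have "u ^ (2 ^ Suc k) - 1 = (v + 1) * (v - 1)"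
      by (simp add: v_def power_mult[symmetric] power2_eq_square[symmetric] mult.commute algebra_simps)
    then have "d (Suc k) = (cmod (v + 1))\<^sup>2 * d k" by (simp add: d_def v_def norm_mult power_mult_distrib)
    also have "\<dots> \<ge> 3 * d k" using v3 by (intro mult_right_mono) (auto simp: d_def)
    finally show ?case using Suc by simp
  qed simp
  have d0: "0 < d 0" using u by (simp add: d_def)
  obtain k where "1 / d 0 < 3 ^ k" using real_arch_pow[of 3 "1 / d 0"] by auto
  then have "1 < d k" using d0 grow[of k] by (simp add: divide_less_eq)
  moreover have "d k < 1\<^sup>2" unfolding d_def using less[of "2 ^ k"] by (intro power_strict_mono) auto
  ultimately show False by simp
qed

text \<open>The Boolean marks orientation reversal, so that along a subsequence it is constant and
  only \<open>u\<close> and \<open>b\<close> have to converge.\<close>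

definition motion :: "bool \<Rightarrow> complex \<Rightarrow> complex \<Rightarrow> complex \<Rightarrow> complex" where
  "motion r u b z = u * (if r then cnj z else z) + b"

lemma isom_motion: "cmod u = 1 \<Longrightarrow> isom (motion r u b)"
proof -
  assume u: "cmod u = 1"
  have "cmod (u * (cnj z - cnj w)) = cmod (z - w)" for z w
    by (metis u complex_cnj_diff complex_mod_cnj mult_1 norm_mult)
  then show ?thesis using u
    by (auto simp: motion_def isom_def dist_norm right_diff_distrib[symmetric] norm_mult)
qed

lemma translate_unbounded:
  assumes "bounded A" "z \<in> A" "\<And>k::nat. z + of_nat k * b \<in> A"
  shows "b = (0::complex)"
proof (rule ccontr)
  assume b: "b \<noteq> 0"
  obtain B where B: "\<And>x. x \<in> A \<Longrightarrow> norm x \<le> B" using assms(1) by (auto simp: bounded_iff)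
  obtain k :: nat where k: "(2 * B + 1) / cmod b < real k" using reals_Archimedean2 by blast
  have "real k * cmod b = cmod ((z + of_nat k * b) - z)" by (simp add: norm_mult)
  also have "\<dots> \<le> B + B" using B[OF assms(3)[of k]] B[OF assms(2)] norm_triangle_ineq4[of "z + of_nat k * b" z] by linarith
  finally show False using k b by (simp add: divide_less_eq)
qed

text \<open>Orientation reversing symmetries have no identity limit anyway, translations are
  impossible for a bounded set, and a rotation is replaced by a power far from the identity.\<close>

lemma far_symmetry:
  assumes F: "isom F" "F \<noteq> id" "F ` A = A" and A: "bounded A" "A \<noteq> {}"
  obtains r u b where "cmod u = 1" "r \<or> 1 \<le> cmod (u - 1)" "motion r u b ` A = A"
  using F(1)
proof (cases rule: isom_cases)
  case (2 u b)
  then have "motion True u b = F" by (simp add: motion_def fun_eq_iff)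
  then show thesis using 2 F(3) by (intro that[of u True b]) auto
next
  case (1 u b)
  have pow: "(F ^^ k) ` A = A" for k
  proof (induction k)
    case (Suc k)
    have "(F ^^ Suc k) ` A = F ` ((F ^^ k) ` A)" by (simp add: image_comp)
    then show ?case using Suc F(3) by simp
  qed simp
  have form: "\<exists>c. F ^^ k = (\<lambda>z. u ^ k * z + c)" for k
  proof (induction k)
    case 0
    then show ?case by (intro exI[of _ 0]) (auto simp: fun_eq_iff)
  next
    case (Suc k)
    then obtain c where "F ^^ k = (\<lambda>z. u ^ k * z + c)" by blast
    then have "F ^^ Suc k = (\<lambda>z. u ^ Suc k * z + (u * c + b))"
      by (simp add: fun_eq_iff 1 algebra_simps)
    then show ?case by blast
  qed
  have "u \<noteq> 1"
  proof
    assume u1: "u = 1"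
    obtain z where z: "z \<in> A" using A by blast
    have "(F ^^ k) z = z + of_nat k * b" for k by (induction k) (auto simp: 1 u1 algebra_simps)
    then have "z + of_nat k * b \<in> A" for k using pow[of k] z by (metis imageI)
    then have "b = 0" using translate_unbounded[OF A(1) z] by blast
    then show False using F(2) 1 u1 by auto
  qed
  then obtain k where k: "1 \<le> cmod (u ^ k - 1)" using rotation_power_far 1 by blast
  obtain c where "F ^^ k = (\<lambda>z. u ^ k * z + c)" using form by blast
  then have "F ^^ k = motion False (u ^ k) c" by (simp add: motion_def fun_eq_iff)
  then show thesis using k pow[of k] 1 by (intro that[of "u ^ k" False c]) (auto simp: norm_power)
qed

text \<open>No convergence in a metric of sets is needed: the \<open>A k\<close> stay in
  \<open>T\<close> and eventually contain each point of a set whose closure covers \<open>T\<close>.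
  A point of \<open>D\<close> has its images in \<open>T\<close> from some index on, hence also its
  limit image.\<close>

lemma limit_of_symmetric_sets:
  fixes A :: "nat \<Rightarrow> complex set"
  assumes T: "compact T" "T \<subseteq> closure D" "z0 \<in> D"
    and A: "\<And>k. A k \<subseteq> T" "\<And>z. z \<in> D \<Longrightarrow> eventually (\<lambda>k. z \<in> A k) sequentially"
    and sym: "\<And>k. A k \<noteq> {} \<Longrightarrow> \<exists>F. isom F \<and> F \<noteq> id \<and> F ` A k = A k"
  obtains G where "isom G" "G \<noteq> id" "G ` T \<subseteq> T"
proof -
  obtain k0 where k0: "\<And>k. k0 \<le> k \<Longrightarrow> z0 \<in> A k"
    using A(2)[OF T(3)] by (auto simp: eventually_sequentially)
  have "\<exists>r u b. cmod u = 1 \<and> (r \<or> 1 \<le> cmod (u - 1)) \<and> motion r u b ` A (k0 + k) = A (k0 + k)" for k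
  proof -
    have ne: "A (k0 + k) \<noteq> {}" using k0[of "k0 + k"] by auto
    obtain F where "isom F" "F \<noteq> id" "F ` A (k0 + k) = A (k0 + k)" using sym[OF ne] by blast
    then show ?thesis
      using far_symmetry[of F "A (k0 + k)"] ne bounded_subset[OF compact_imp_bounded[OF T(1)] A(1)] by metis
  qed
  then obtain r u b where h: "\<And>k. cmod (u k) = 1" "\<And>k. r k \<or> 1 \<le> cmod (u k - 1)"
    "\<And>k. motion (r k) (u k) (b k) ` A (k0 + k) = A (k0 + k)" by metis
  obtain B where B: "\<And>x. x \<in> T \<Longrightarrow> norm x \<le> B" using compact_imp_bounded[OF T(1)] by (auto simp: bounded_iff)
  \<comment> \<open>The translation parts are bounded because the image of the common point
    \<open>z0\<close> stays in \<open>T\<close>.\<close>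
  have bB: "cmod (b k) \<le> B + cmod z0" for k
  proof -
    have "motion (r k) (u k) (b k) z0 \<in> motion (r k) (u k) (b k) ` A (k0 + k)"
      using k0[of "k0 + k"] by (intro imageI) simp
    then have "motion (r k) (u k) (b k) z0 \<in> T" using A(1)[of "k0 + k"] unfolding h(3) by (rule rev_subsetD)
    then have "cmod (motion (r k) (u k) (b k) z0) \<le> B" by (rule B)
    moreover have "b k = motion (r k) (u k) (b k) z0 - u k * (if r k then cnj z0 else z0)" by (simp add: motion_def)
    ultimately show ?thesis
      using norm_triangle_ineq4[of "motion (r k) (u k) (b k) z0" "u k * (if r k then cnj z0 else z0)"] h(1)[of k]
      by (simp add: norm_mult split: if_splits)
  qed
  have "infinite {k. r k} \<or> infinite {k. \<not> r k}"
  proof -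
    have "(UNIV :: nat set) = {k. r k} \<union> {k. \<not> r k}" by auto
    then show ?thesis by (metis finite_UnI infinite_UNIV_nat)
  qed
  then obtain q where "infinite {k. r k = q}"
  proof
    assume "infinite {k. r k}" then show thesis using that[of True] by simp
  next
    assume "infinite {k. \<not> r k}" then show thesis using that[of False] by simp
  qed
  then obtain s :: "nat \<Rightarrow> nat" where s: "strict_mono s" "\<And>k. r (s k) = q"
    using infinite_enumerate[of "{k. r k = q}"] by auto
  have "bounded (range (\<lambda>k. (u (s k), b (s k))))"
  proof (rule boundedI)
    fix x assume "x \<in> range (\<lambda>k. (u (s k), b (s k)))"
    then obtain k where "x = (u (s k), b (s k))" by auto
    then show "norm x \<le> 1 + (B + cmod z0)"
      using norm_Pair_le[of "u (s k)" "b (s k)"] h(1)[of "s k"] bB[of "s k"] by simp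
  qed
  then obtain l p where p: "strict_mono p" "((\<lambda>k. (u (s k), b (s k))) \<circ> p) \<longlonglongrightarrow> l"
    using bounded_imp_convergent_subsequence by blast
  define t where "t = s \<circ> p"
  have t: "strict_mono t" unfolding t_def using s(1) p(1) by (rule strict_mono_o)
  have rt: "r (t k) = q" for k by (simp add: t_def s)
  have ul: "(\<lambda>k. u (t k)) \<longlonglongrightarrow> fst l" and bl: "(\<lambda>k. b (t k)) \<longlonglongrightarrow> snd l"
    using tendsto_fst[OF p(2)] tendsto_snd[OF p(2)] by (simp_all add: o_def t_def)
  have ml: "(\<lambda>k. motion q (u (t k)) (b (t k)) z) \<longlonglongrightarrow> motion q (fst l) (snd l) z" for z
    unfolding motion_def by (intro tendsto_intros ul bl)
  have nl: "cmod (fst l) = 1"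
    using tendsto_norm[OF ul] h(1) by (simp add: LIMSEQ_const_iff)
  show thesis
  proof
    show "isom (motion q (fst l) (snd l))" using nl by (rule isom_motion)
    show "motion q (fst l) (snd l) \<noteq> id"
    proof
      assume id: "motion q (fst l) (snd l) = id"
      have e: "motion q (fst l) (snd l) z = z" for z using id by simp
      have "fst l = 1" using e[of 0] e[of 1] by (auto simp: motion_def split: if_splits)
      moreover have "\<not> q"
      proof
        assume q
        then have "fst l * (- \<i>) = \<i>" using e[of 0] e[of \<i>] by (simp add: motion_def)
        then show False using \<open>fst l = 1\<close> by (simp add: complex_eq_iff)
      qed
      then have "1 \<le> cmod (u (t k) - 1)" for k using h(2)[of "t k"] rt[of k] by auto
      moreover have "(\<lambda>k. cmod (u (t k) - 1)) \<longlonglongrightarrow> cmod (fst l - 1)" by (intro tendsto_intros ul)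
      ultimately have "1 \<le> cmod (fst l - 1)" by (intro LIMSEQ_le_const) auto
      then show False using \<open>fst l = 1\<close> by simp
    qed
    have "motion q (fst l) (snd l) ` D \<subseteq> T"
    proof (rule image_subsetI)
      fix z assume z: "z \<in> D"
      have "eventually (\<lambda>k. z \<in> A (k0 + k)) sequentially"
        using A(2)[OF z] by (simp add: eventually_sequentially) (meson le_add2 order_trans trans_le_add2)
      then have "eventually (\<lambda>k. z \<in> A (k0 + t k)) sequentially" using eventually_subseq[OF t] by blast
      then have "eventually (\<lambda>k. motion q (u (t k)) (b (t k)) z \<in> T) sequentially"
      proof eventually_elim
        case (elim k)
        then have "motion (r (t k)) (u (t k)) (b (t k)) z \<in> motion (r (t k)) (u (t k)) (b (t k)) ` A (k0 + t k)"
          by (rule imageI)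
        then have "motion (r (t k)) (u (t k)) (b (t k)) z \<in> T"
          using A(1)[of "k0 + t k"] unfolding h(3) by (rule rev_subsetD)
        then show ?case by (simp add: rt)
      qed
      then show "motion q (fst l) (snd l) z \<in> T"
        by (intro Lim_in_closed_set[OF compact_imp_closed[OF T(1)] _ _ ml]) auto
    qed
    moreover have "continuous_on (closure D) (motion q (fst l) (snd l))"
      by (cases q) (auto simp: motion_def[abs_def] intro!: continuous_intros)
    ultimately show "motion q (fst l) (snd l) ` T \<subseteq> T"
      using image_closure_subset[of D "motion q (fst l) (snd l)" T] T compact_imp_closed by blast
  qed
qed

text \<open>Separate \<open>K\<close> from the open ray. Letting the point of the ray tend to
  \<open>x\<close> shows that the separating direction is a normal at \<open>x\<close>
  itself.\<close>

lemma ray_or_normal: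
  assumes "convex K" "x \<in> K" and miss: "\<And>t. 0 < t \<Longrightarrow> x + t *\<^sub>R w \<notin> K"
  obtains a where "a \<noteq> 0" "outer_normal K x a" "0 \<le> inner a w"
proof -
  define T where "T = (\<lambda>t. x + t *\<^sub>R w) ` {0<..}"
  have "convex ((\<lambda>z. x + z) ` ((\<lambda>t. t *\<^sub>R w) ` {0<..}))"
    by (intro convex_translation convex_linear_image linear_scaleR_left) simp
  then have "convex T" by (simp add: T_def image_image)
  moreover have "T \<noteq> {}" "K \<inter> T = {}" using miss by (auto simp: T_def)
  ultimately obtain a b where ab: "a \<noteq> 0" "\<forall>z\<in>K. inner a z \<le> b" "\<forall>z\<in>T. b \<le> inner a z"
    using separating_hyperplane_sets[of K T] assms by blast
  have le: "inner a (z - x) \<le> t * inner a w" if "z \<in> K" "0 < t" for z t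
  proof -
    have "inner a z \<le> b" using ab that by blast
    also have "b \<le> inner a (x + t *\<^sub>R w)" using ab that by (auto simp: T_def)
    finally show ?thesis by (simp add: inner_diff_right inner_add_right)
  qed
  have nn: "0 \<le> inner a w" using le[OF assms(2), of 1] by simp
  moreover have "outer_normal K x a"
    unfolding outer_normal_def
  proof
    fix z assume z: "z \<in> K"
    show "inner a (z - x) \<le> 0"
    proof (rule ccontr)
      assume pos: "\<not> inner a (z - x) \<le> 0"
      then have w: "0 < inner a w" using le[OF z, of 1] by simp
      then show False using le[OF z, of "inner a (z - x) / (2 * inner a w)"] pos by (simp add: divide_pos_pos)
    qed
  qed
  ultimately show thesis using ab that by blast
qed

lemma normal_interior:
  assumes "outer_normal K x a" "a \<noteq> 0" "z \<in> interior K"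
  shows "inner a (z - x) < 0"
proof -
  obtain e where e: "e > 0" "ball z e \<subseteq> K" using assms(3) by (auto simp: mem_interior)
  have "z + (e / 2 / norm a) *\<^sub>R a \<in> ball z e" using e assms by (simp add: dist_norm)
  then have "inner a (z + (e / 2 / norm a) *\<^sub>R a - x) \<le> 0" using e assms(1) by (auto simp: outer_normal_def)
  moreover have "inner a (z + (e / 2 / norm a) *\<^sub>R a - x) = inner a (z - x) + e / 2 * norm a"
    using assms(2) by (simp add: inner_diff_right inner_add_right power2_norm_eq_inner[symmetric] power2_eq_square)
  moreover have "0 < e / 2 * norm a" using e assms by simp
  ultimately show ?thesis by linarith
qed

text \<open>\<open>y\<close> is the boundary point nearest to some interior point, so a disc about
  the latter touches the boundary at \<open>y\<close> from inside. Equality in the Cauchy-Schwarz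
  inequality makes the normal at \<open>y\<close> parallel to the radius.\<close>

lemma inner_ball:
  assumes "closed L" "convex L" "interior L \<noteq> {}" "L \<noteq> UNIV"
  obtains y c \<rho> where "cmod c = 1" "0 < \<rho>" "\<And>z. z \<in> frame y c L \<Longrightarrow> 0 \<le> Im z"
    "cball (\<i> * of_real \<rho>) \<rho> \<subseteq> frame y c L"
proof -
  obtain z0 where z0: "z0 \<in> interior L" using assms by blast
  have "frontier L \<noteq> {}" using assms frontier_eq_empty[of L] by auto
  then obtain y where y: "y \<in> frontier L" "\<And>z. z \<in> frontier L \<Longrightarrow> dist z0 y \<le> dist z0 z"
    using distance_attains_inf[OF frontier_closed] by metis
  define \<rho> where "\<rho> = dist z0 y"
  have \<rho>: "\<rho> > 0" using z0 y(1) by (auto simp: \<rho>_def frontier_def)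
  have "ball z0 \<rho> \<subseteq> L"
  proof (rule ccontr)
    assume "\<not> ball z0 \<rho> \<subseteq> L"
    then have "ball z0 \<rho> - L \<noteq> {}" by blast
    moreover have "ball z0 \<rho> \<inter> L \<noteq> {}" using z0 \<rho> interior_subset by (metis IntI centre_in_ball empty_iff subsetD)
    ultimately have "ball z0 \<rho> \<inter> frontier L \<noteq> {}" by (intro connected_Int_frontier) auto
    then show False using y(2) by (force simp: \<rho>_def)
  qed
  then have cb: "cball z0 \<rho> \<subseteq> L" using closure_minimal[OF _ assms(1)] \<rho> by (metis closure_ball)
  obtain n where n: "n \<noteq> 0" "outer_normal L y n" using outer_normal_exists[OF assms(2,3) y(1)] .
  have ny: "norm (y - z0) = \<rho>" by (simp add: \<rho>_def dist_norm norm_minus_commute)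
  have "z0 + (\<rho> / norm n) *\<^sub>R n \<in> L" using cb n \<rho> by (auto simp: dist_norm subset_eq)
  then have "inner n (z0 + (\<rho> / norm n) *\<^sub>R n - y) \<le> 0" using n by (simp add: outer_normal_def)
  moreover have "inner n (z0 + (\<rho> / norm n) *\<^sub>R n - y) = \<rho> * norm n - inner n (y - z0)"
    using n by (simp add: inner_diff_right inner_add_right power2_norm_eq_inner[symmetric] power2_eq_square)
  ultimately have "norm n * norm (y - z0) \<le> inner n (y - z0)" by (simp add: ny mult.commute)
  then have "inner n (y - z0) = norm n * norm (y - z0)" using norm_cauchy_schwarz[of n "y - z0"] by linarith
  then have par: "norm n *\<^sub>R (y - z0) = \<rho> *\<^sub>R n" using norm_cauchy_schwarz_eq[of n "y - z0"] unfolding ny by blast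
  define c where "c = \<i> * (y - z0) / of_real \<rho>"
  have c: "cmod c = 1" using ny \<rho> by (simp add: c_def norm_mult norm_divide)
  have yz: "y - z0 = - \<i> * of_real \<rho> * c" using \<rho> by (simp add: c_def)
  show thesis
  proof
    show "cmod c = 1" "0 < \<rho>" by fact+
    show "0 \<le> Im z" if "z \<in> frame y c L" for z
    proof -
      have "inner n (c * z) \<le> 0" using n(2) that by (auto simp: outer_normal_def frame_def)
      then have "norm n * inner (y - z0) (c * z) \<le> 0"
        using par \<rho> by (metis inner_scaleR_left mult_le_0_iff less_imp_le not_le)
      then have "inner (y - z0) (c * z) \<le> 0" using n by (simp add: mult_le_0_iff)
      then have "inner ((y - z0) / c) z \<le> 0" using c by (simp add: inner_rotate)
      moreover have "(y - z0) / c = - \<i> * of_real \<rho>" using yz c by auto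
      ultimately show ?thesis using \<rho> by (simp add: inner_complex_def zero_le_mult_iff)
    qed
    show "cball (\<i> * of_real \<rho>) \<rho> \<subseteq> frame y c L"
    proof
      fix z assume z: "z \<in> cball (\<i> * of_real \<rho>) \<rho>"
      have "z0 - (y + c * z) = c * (\<i> * of_real \<rho> - z)" using yz by (simp add: algebra_simps)
      then have "y + c * z \<in> cball z0 \<rho>" using z c by (simp add: dist_norm norm_mult)
      then show "z \<in> frame y c L" using cb by (auto simp: frame_def)
    qed
  qed
qed

text \<open>Under magnification \<open>K\<close> tends to its tangent cone and \<open>L\<close>, touched from inside by a disc, to a
  half-plane; the half-plane is placed so that it cuts a scalene triangle off the cone. The side ratio
  \<open>\<tau>\<close> is \<open>3\<close>, or \<open>4\<close> in the one case in which \<open>3\<close> gives an isosceles triangle.\<close>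

lemma corner_contradiction:
  assumes S: "sym_inter K L" and K: "convex K" "0 \<in> K"
    and h: "0 < h" "Complex 0 h \<in> interior K"
    and cone: "\<sigma>1 < \<sigma>2" "\<And>z. z \<in> K \<Longrightarrow> \<sigma>1 * Re z \<le> Im z \<and> \<sigma>2 * Re z \<le> Im z"
      "\<And>w. \<sigma>1 * Re w < Im w \<Longrightarrow> \<sigma>2 * Re w < Im w \<Longrightarrow> \<exists>t>0. t *\<^sub>R w \<in> K"
    and L: "\<And>z. z \<in> L \<Longrightarrow> 0 \<le> Im z" "0 < \<rho>" "cball (\<i> * of_real \<rho>) \<rho> \<subseteq> L"
  shows False
proof -
  define \<Delta> where "\<Delta> = \<sigma>2 - \<sigma>1"
  have \<Delta>: "\<Delta> > 0" using cone by (simp add: \<Delta>_def)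
  \<comment> \<open>The directions of the two edges: left of the imaginary axis the line of slope
    \<open>\<sigma>1\<close> bounds the cone, right of it the line of slope
    \<open>\<sigma>2\<close>.\<close>
  define r1 r2 where "r1 = Complex (-1) (-\<sigma>1)" and "r2 = Complex 1 \<sigma>2"
  have r: "cmod r1 > 0" "cmod r2 > 0" by (auto simp: r1_def r2_def complex_eq_iff)
  define c where "c = inner r1 r2 / (cmod r1 * cmod r2)"
  have c1: "c \<le> 1" using norm_cauchy_schwarz[of r1 r2] r by (simp add: c_def)
  \<comment> \<open>With sides 1 and \<open>\<tau>\<close> at the apex and cosine \<open>c\<close>,
    the third side equals \<open>\<tau>\<close> exactly if \<open>2 * \<tau> * c = 1\<close>, for
    \<open>\<tau> = 3\<close> if \<open>c = 1/6\<close>. It equals 1 only if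
    \<open>\<tau> = 2 * c\<close>, which \<open>\<tau> \<ge> 3\<close> excludes.\<close>
  define \<tau> :: real where "\<tau> = (if c = 1/6 then 4 else 3)"
  have \<tau>: "3 \<le> \<tau>" "2 * (\<tau> * c) \<noteq> 1" by (auto simp: \<tau>_def)
  define p1 p2 where "p1 = 1 / cmod r1" and "p2 = \<tau> / cmod r2"
  have p: "p1 > 0" "p2 > 0" using r \<tau> by (auto simp: p1_def p2_def)
  define v1 v2 where "v1 = p1 *\<^sub>R r1" and "v2 = p2 *\<^sub>R r2"
  have nv: "cmod v1 = 1" "cmod v2 = \<tau>" using r \<tau> by (auto simp: v1_def v2_def p1_def p2_def)
  have "inner v1 v2 = \<tau> * c" using r by (simp add: v1_def v2_def p1_def p2_def c_def field_simps)
  moreover have "(cmod (a - b))\<^sup>2 = (cmod a)\<^sup>2 + (cmod b)\<^sup>2 - 2 * inner a b" for a b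
    unfolding cmod_power2 by (simp add: inner_complex_def power2_eq_square algebra_simps)
  ultimately have dv: "(dist v1 v2)\<^sup>2 = 1 + \<tau>\<^sup>2 - 2 * (\<tau> * c)"
    unfolding dist_norm by (simp add: nv)
  have v12: "Re v1 = - p1" "Im v1 = - (p1 * \<sigma>1)" "Re v2 = p2" "Im v2 = p2 * \<sigma>2"
    by (simp_all add: v1_def v2_def r1_def r2_def)
  have cross: "Im v1 * Re v2 - Re v1 * Im v2 = p1 * p2 * \<Delta>" by (simp add: v12 \<Delta>_def algebra_simps)
  have cr0: "p1 * p2 * \<Delta> > 0" using p \<Delta> by simp
  define T where "T = convex hull {0, v1, v2}"
  have rigid: "G = id" if G: "isom G" "G ` T \<subseteq> T" for G
  proof (cases "dist v1 v2 < \<tau>")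
    case True
    have T': "T = convex hull {0, v2, v1}" by (simp add: T_def insert_commute)
    have "(dist v1 v2)\<^sup>2 \<noteq> 1\<^sup>2"
    proof -
      have "\<tau> * c \<le> \<tau> * 1" using c1 \<tau> by (intro mult_left_mono) auto
      moreover have "3 * \<tau> \<le> \<tau>\<^sup>2" using \<tau> unfolding power2_eq_square by (intro mult_right_mono) auto
      ultimately have "2 * (\<tau> * c) < \<tau>\<^sup>2" using \<tau>(1) by linarith
      then show ?thesis using dv by simp
    qed
    then have "dist v1 v2 \<noteq> 1" by auto
    moreover have "Im ((v1 - 0) / (v2 - 0)) \<noteq> 0"
      using cross cr0 by (simp add: Im_divide complex_eq_iff sum_power2_eq_zero_iff) (use v12 p in auto)
    ultimately show ?thesis using True nv \<tau> G unfolding T'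
      by (intro scalene_triangle_rigid[of G 0 v2 v1]) (auto simp: dist_commute)
  next
    case False
    have T': "T = convex hull {v1, v2, 0}" by (simp add: T_def insert_commute)
    have "(dist v1 v2)\<^sup>2 \<noteq> \<tau>\<^sup>2" using dv \<tau> by simp
    then have "\<tau> < dist v1 v2" using False by (cases "dist v1 v2 = \<tau>") auto
    moreover have "v2 \<noteq> v1" using nv \<tau> by auto
    then have "Im ((0 - v1) / (v2 - v1)) \<noteq> 0"
      using cross cr0 by (simp add: Im_divide complex_eq_iff sum_power2_eq_zero_iff algebra_simps) (use p \<Delta> in auto)
    ultimately show ?thesis using nv \<tau> G unfolding T'
      by (intro scalene_triangle_rigid[of G v1 v2 0]) auto
  qed
  \<comment> \<open>The solution of \<open>inner g v1 = inner g v2 = 1\<close>: the third side of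
    \<open>T\<close> lies on the line \<open>inner g z = 1\<close>.\<close>
  define g where "g = Complex (- (\<sigma>2 / p1 + \<sigma>1 / p2) / \<Delta>) ((1 / p1 + 1 / p2) / \<Delta>)"
  have gv: "inner g v1 = 1" "inner g v2 = 1"
    using p \<Delta> by (simp_all add: inner_complex_def v12 g_def field_simps) (simp_all add: \<Delta>_def algebra_simps)
  have Img: "Im g > 0" using p \<Delta> by (simp add: g_def add_pos_pos)
  then have ng: "cmod g > 0" by (auto simp: complex_eq_iff)
  have repr: "z = ((Im z - \<sigma>2 * Re z) / (p1 * \<Delta>)) *\<^sub>R v1 + ((Im z - \<sigma>1 * Re z) / (p2 * \<Delta>)) *\<^sub>R v2" for z
    using p \<Delta> by (simp add: complex_eq_iff v12 field_simps) (simp add: \<Delta>_def algebra_simps)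
  have inT: "z \<in> T" if z: "\<sigma>1 * Re z \<le> Im z" "\<sigma>2 * Re z \<le> Im z" "inner g z \<le> 1" for z
  proof -
    define b1 b2 where "b1 = (Im z - \<sigma>2 * Re z) / (p1 * \<Delta>)" and "b2 = (Im z - \<sigma>1 * Re z) / (p2 * \<Delta>)"
    have b: "b1 \<ge> 0" "b2 \<ge> 0" using z p \<Delta> by (auto simp: b1_def b2_def)
    have zb: "z = b1 *\<^sub>R v1 + b2 *\<^sub>R v2" using repr[of z] by (simp only: b1_def b2_def)
    then have "inner g z = b1 + b2" by (simp add: inner_add_right gv)
    then have "b1 + b2 \<le> 1" using z by simp
    then show ?thesis unfolding T_def convex_hull_3 using b
      by (intro CollectI exI[of _ "1 - b1 - b2"] exI[of _ b1] exI[of _ b2]) (simp add: zb[symmetric])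
  qed
  \<comment> \<open>The open triangle. Its points are strictly inside the cone and the half-plane,
    so the magnified intersections eventually contain them.\<close>
  define D where "D = {b1 *\<^sub>R v1 + b2 *\<^sub>R v2 | b1 b2. 0 < b1 \<and> 0 < b2 \<and> b1 + b2 < 1}"
  have inD: "\<sigma>1 * Re z < Im z \<and> \<sigma>2 * Re z < Im z \<and> inner g z < 1" if zD: "z \<in> D" for z
  proof -
    obtain b1 b2 where b: "z = b1 *\<^sub>R v1 + b2 *\<^sub>R v2" "0 < b1" "0 < b2" "b1 + b2 < 1" using zD by (auto simp: D_def)
    have "Im z - \<sigma>1 * Re z = b2 * (p2 * \<Delta>)" "Im z - \<sigma>2 * Re z = b1 * (p1 * \<Delta>)"
      by (simp_all add: b(1) v12 \<Delta>_def algebra_simps)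
    moreover have "0 < b2 * (p2 * \<Delta>)" "0 < b1 * (p1 * \<Delta>)" using b p \<Delta> by auto
    ultimately show ?thesis using b(4) by (simp add: b(1) inner_add_right gv)
  qed
  have gD: "(1/3) *\<^sub>R v1 + (1/3) *\<^sub>R v2 \<in> D" unfolding D_def by (intro CollectI exI[of _ "1/3"]) auto
  have TD: "T \<subseteq> closure D"
  proof
    fix z assume "z \<in> T"
    then obtain a b1 b2 where b: "z = b1 *\<^sub>R v1 + b2 *\<^sub>R v2" "0 \<le> a" "0 \<le> b1" "0 \<le> b2" "a + b1 + b2 = 1"
      unfolding T_def convex_hull_3 by auto
    define s where "s k = inverse (real (Suc k))" for k
    have s: "0 < s k" "s k \<le> 1" for k by (auto simp: s_def inverse_le_1_iff)
    have "(\<lambda>k. ((1 - s k) * b1 + s k / 3) *\<^sub>R v1 + ((1 - s k) * b2 + s k / 3) *\<^sub>R v2) \<longlonglongrightarrow>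
        ((1 - 0) * b1 + 0 / 3) *\<^sub>R v1 + ((1 - 0) * b2 + 0 / 3) *\<^sub>R v2"
      unfolding s_def by (intro tendsto_intros LIMSEQ_inverse_real_of_nat) simp_all
    moreover have "((1 - s k) * b1 + s k / 3) *\<^sub>R v1 + ((1 - s k) * b2 + s k / 3) *\<^sub>R v2 \<in> D" for k
    proof -
      have "(1 - s k) * (b1 + b2) \<le> (1 - s k) * 1" using b s[of k] by (intro mult_left_mono) auto
      moreover have "0 \<le> (1 - s k) * b1" "0 \<le> (1 - s k) * b2" using b s[of k] by auto
      ultimately show ?thesis unfolding D_def using s[of k]
        by (intro CollectI exI[of _ "(1 - s k) * b1 + s k / 3"] exI[of _ "(1 - s k) * b2 + s k / 3"])
          (auto simp: algebra_simps)
    qed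
    ultimately show "z \<in> closure D" unfolding closure_sequential by (intro exI conjI allI) (auto simp: b)
  qed
  \<comment> \<open>The motion of \<open>L\<close> used at scale \<open>1 / N\<close> sends 0 to
    \<open>e / N\<close> and the direction \<open>\<i>\<close> to that of \<open>- g\<close>. The
    upper half-plane, which contains \<open>L\<close>, becomes \<open>inner g z \<le> 1 / N\<close>,
    and the touching disc gets the centre \<open>cN N\<close>.\<close>
  define e where "e = (1/2) *\<^sub>R (v1 + v2)"
  have ge: "inner g e = 1" by (simp add: e_def inner_add_right gv)
  define w where "w = \<i> * g / of_real (cmod g)"
  have w: "cmod w = 1" using ng by (simp add: w_def norm_mult norm_divide)
  have w0: "w \<noteq> 0" using w by auto
  have gw: "g / w = - \<i> * of_real (cmod g)" using ng by (simp add: w_def divide_eq_eq)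
  define M where "M N = K \<inter> (\<lambda>z. w * z + e / of_real N) ` L" for N :: real
  define cN where "cN N = e / of_real N - of_real \<rho> * (g / of_real (cmod g))" for N :: real
  have ballL: "ball (cN N) \<rho> \<subseteq> (\<lambda>z. w * z + e / of_real N) ` L" for N
  proof
    fix x assume x: "x \<in> ball (cN N) \<rho>"
    define \<zeta> where "\<zeta> = (x - e / of_real N) / w"
    have x\<zeta>: "x = w * \<zeta> + e / of_real N" using w0 by (simp add: \<zeta>_def)
    have "cN N - x = w * (\<i> * of_real \<rho> - \<zeta>)"
    proof -
      have "\<i> * g * (\<i> * of_real \<rho>) = - (of_real \<rho> * g)" by (simp add: complex_eq_iff)
      then have "w * (\<i> * of_real \<rho>) = - of_real \<rho> * (g / of_real (cmod g))" by (simp add: w_def)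
      then show ?thesis by (simp add: x\<zeta> cN_def algebra_simps)
    qed
    then have "dist (\<i> * of_real \<rho>) \<zeta> < \<rho>" using x w by (simp add: dist_norm norm_mult)
    then have "\<zeta> \<in> L" using L(3) by auto
    then show "x \<in> (\<lambda>z. w * z + e / of_real N) ` L" using x\<zeta> by blast
  qed
  have near: "\<exists>N1. \<forall>N\<ge>N1. 0 < N \<longrightarrow> z / of_real N \<in> ball (cN N) \<rho>" if z: "inner g z < 1" for z
  proof -
    define q where "q = (1 - inner g z) / cmod g"
    have q: "q > 0" using z ng by (simp add: q_def)
    \<comment> \<open>The squared distance of \<open>z / N\<close> from \<open>cN N\<close> is
      \<open>\<rho>\<close> squared, minus \<open>2 * \<rho> * q / N\<close>, plus the square of
      \<open>|z - e| / N\<close>. For these \<open>N\<close> the last term is the smaller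
      one.\<close>
    define N1 where "N1 = (cmod (z - e))\<^sup>2 / (2 * \<rho> * q) + 1"
    show ?thesis
    proof (intro exI[of _ N1] allI impI)
      fix N assume N: "N1 \<le> N" "0 < N"
      have "(cmod (z - e))\<^sup>2 / (2 * \<rho> * q) < N" using N by (simp add: N1_def)
      then have lt: "(cmod (z - e))\<^sup>2 < N * (2 * \<rho> * q)" using q L(2) by (simp add: divide_less_eq)
      define y where "y = (1 / N) *\<^sub>R (z - e)"
      define a where "a = (\<rho> / cmod g) *\<^sub>R g"
      have na: "cmod a = \<rho>" using ng L(2) by (simp add: a_def)
      have "z / of_real N - cN N = y + a"
        by (simp add: y_def a_def cN_def scaleR_conv_of_real diff_divide_distrib)
      moreover have "(cmod (y + a))\<^sup>2 = (cmod y)\<^sup>2 + 2 * inner y a + (cmod a)\<^sup>2"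
        unfolding cmod_power2 by (simp add: inner_complex_def power2_eq_square algebra_simps)
      moreover have "inner y a = - (\<rho> * q / N)"
      proof -
        have "inner y a = \<rho> / cmod g * (1 / N) * (inner g z - 1)"
          by (simp add: y_def a_def inner_commute[of _ g] inner_diff_right ge)
        then show ?thesis using N ng by (simp add: q_def field_simps)
      qed
      moreover have "(cmod y)\<^sup>2 < 2 * (\<rho> * q / N)"
      proof -
        have "(cmod y)\<^sup>2 = (cmod (z - e))\<^sup>2 / (N * N)" using N by (simp add: y_def power_divide power2_eq_square)
        also have "\<dots> < N * (2 * \<rho> * q) / (N * N)" using lt N by (intro divide_strict_right_mono) auto
        also have "\<dots> = 2 * (\<rho> * q / N)" using N by simp
        finally show ?thesis .
      qed
      ultimately have "(cmod (z / of_real N - cN N))\<^sup>2 < \<rho>\<^sup>2" using na by simp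
      then have "cmod (z / of_real N - cN N) < \<rho>" using L(2) by (simp add: power2_less_imp_less)
      then show "z / of_real N \<in> ball (cN N) \<rho>" by (simp add: dist_norm norm_minus_commute)
    qed
  qed
  \<comment> \<open>Here \<open>inner g z1 = 1/2\<close>, and \<open>z1\<close> is on the axis
    through the interior point \<open>Complex 0 h\<close>; scaled down, it is interior to both
    sets.\<close>
  define z1 where "z1 = Complex 0 (1 / (2 * Im g))"
  have gz1: "inner g z1 < 1" using Img by (simp add: z1_def inner_complex_def)
  obtain N1 where N1: "\<And>N. N1 \<le> N \<Longrightarrow> 0 < N \<Longrightarrow> z1 / of_real N \<in> ball (cN N) \<rho>" using near[OF gz1] by blast
  obtain N0 :: nat where N0: "max (max 1 N1) (1 / (2 * Im g * h)) \<le> real N0" using real_arch_simple by blast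
  define NN where "NN k = real (N0 + k)" for k :: nat
  have NN: "1 \<le> NN k" "N1 \<le> NN k" "1 / (2 * Im g * h) \<le> NN k" for k using N0 by (auto simp: NN_def)
  have intM: "interior (M (NN k)) \<noteq> {}" for k
  proof -
    define s where "s = 1 / (2 * Im g * h * NN k)"
    have s: "0 < s" "s \<le> 1"
    proof -
      have pos: "0 < 2 * Im g * h" using Img h by simp
      then show "0 < s" using NN(1)[of k] by (simp add: s_def)
      have "1 \<le> NN k * (2 * Im g * h)" using NN(3)[of k] pos by (simp add: divide_le_eq)
      then show "s \<le> 1" using pos NN(1)[of k] by (simp add: s_def divide_le_eq mult.commute)
    qed
    have "0 - s *\<^sub>R (0 - Complex 0 h) \<in> interior K"
      by (rule mem_interior_convex_shrink[OF K(1) h(2) K(2) s])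
    moreover have "0 - s *\<^sub>R (0 - Complex 0 h) = z1 / of_real (NN k)"
      using h Img NN(1)[of k] by (simp add: complex_eq_iff z1_def s_def Re_divide_of_real Im_divide_of_real)
    ultimately have "z1 / of_real (NN k) \<in> interior K" by simp
    moreover have "z1 / of_real (NN k) \<in> interior ((\<lambda>z. w * z + e / of_real (NN k)) ` L)"
    proof -
      have "z1 / of_real (NN k) \<in> ball (cN (NN k)) \<rho>" using N1[OF NN(2)[of k]] NN(1)[of k] by simp
      then show ?thesis using interior_maximal[OF ballL open_ball, of "NN k"] by blast
    qed
    ultimately show ?thesis by (auto simp: M_def)
  qed
  define A where "A k = {z. z / of_real (NN k) \<in> M (NN k)}" for k
  have AT: "A k \<subseteq> T" for k
  proof
    fix z assume "z \<in> A k"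
    then have zM: "z / of_real (NN k) \<in> K" "z / of_real (NN k) \<in> (\<lambda>z. w * z + e / of_real (NN k)) ` L"
      by (auto simp: A_def M_def)
    have pos: "0 < NN k" using NN(1)[of k] by simp
    have "\<sigma>1 * Re z \<le> Im z" "\<sigma>2 * Re z \<le> Im z"
      using cone(2)[OF zM(1)] pos by (auto simp: Re_divide_of_real Im_divide_of_real divide_le_cancel)
    moreover have "inner g z \<le> 1"
    proof -
      obtain \<zeta> where \<zeta>: "\<zeta> \<in> L" "z / of_real (NN k) = w * \<zeta> + e / of_real (NN k)" using zM(2) by auto
      have "z = of_real (NN k) * (z / of_real (NN k))" using pos by simp
      also have "\<dots> = NN k *\<^sub>R (w * \<zeta>) + e" unfolding \<zeta>(2) using pos by (simp add: scaleR_conv_of_real distrib_left)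
      finally have "inner g z = NN k * inner g (w * \<zeta>) + 1" by (simp add: inner_add_right ge)
      also have "inner g (w * \<zeta>) = - (cmod g * Im \<zeta>)"
        unfolding inner_rotate[OF w] gw by (simp add: inner_complex_def)
      finally show ?thesis using L(1)[OF \<zeta>(1)] pos ng by simp
    qed
    ultimately show "z \<in> T" by (rule inT)
  qed
  have ev: "eventually (\<lambda>k. z \<in> A k) sequentially" if z: "z \<in> D" for z
  proof -
    obtain t where t: "t > 0" "t *\<^sub>R z \<in> K" using cone(3) inD[OF z] by blast
    obtain N2 where N2: "\<And>N. N2 \<le> N \<Longrightarrow> 0 < N \<Longrightarrow> z / of_real N \<in> ball (cN N) \<rho>"
      using near inD[OF z] by blast
    obtain k0 :: nat where k0: "max N2 (1 / t) \<le> real k0" using real_arch_simple by blast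
    show ?thesis
      unfolding eventually_sequentially
    proof (intro exI[of _ k0] allI impI)
      fix k assume "k0 \<le> k"
      then have k: "N2 \<le> NN k" "1 / t \<le> NN k" using k0 by (auto simp: NN_def)
      have pos: "0 < NN k" using NN(1)[of k] by simp
      have "(1 / (t * NN k)) *\<^sub>R (t *\<^sub>R z) + (1 - 1 / (t * NN k)) *\<^sub>R 0 \<in> K"
      proof (rule convexD[OF K(1) t(2) K(2)])
        show "0 \<le> 1 - 1 / (t * NN k)" using k(2) t pos by (simp add: divide_le_eq mult.commute)
      qed (use t pos in auto)
      moreover have "(1 / (t * NN k)) *\<^sub>R (t *\<^sub>R z) = z / of_real (NN k)"
        using t pos by (simp add: scaleR_conv_of_real)
      ultimately have "z / of_real (NN k) \<in> K" by simp
      moreover have "z / of_real (NN k) \<in> (\<lambda>z. w * z + e / of_real (NN k)) ` L"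
        using N2[OF k(1) pos] ballL by blast
      ultimately show "z \<in> A k" by (simp add: A_def M_def)
    qed
  qed
  have sy: "\<exists>F. isom F \<and> F \<noteq> id \<and> F ` A k = A k" for k
  proof -
    define N where "N = NN k"
    have N: "N > 0" using NN(1)[of k] by (simp add: N_def)
    obtain F where F: "isom F" "F \<noteq> id" "F ` M N = M N"
      using S w intM[of k] unfolding sym_inter_def inter_all_def M_def N_def by blast
    define G where "G = (\<lambda>z. (F (0 + of_real (1 / N) * z) - 0) / of_real (1 / N))"
    have Gi: "isom G" unfolding G_def by (rule isom_similarity) (use F N in auto)
    have FG: "F (z / of_real N) = G z / of_real N" for z using N by (simp add: G_def)
    have "G \<noteq> id"
    proof
      assume "G = id"
      then have "F z = z" for z using FG[of "of_real N * z"] N by simp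
      then show False using F by auto
    qed
    moreover have "G ` A k = A k"
    proof (intro equalityI subsetI)
      fix y assume "y \<in> G ` A k"
      then obtain z where z: "z / of_real N \<in> M N" "y = G z" by (auto simp: A_def N_def)
      have "F (z / of_real N) \<in> F ` M N" using z by blast
      then show "y \<in> A k" by (simp add: F(3) FG A_def z(2) flip: N_def)
    next
      fix y assume "y \<in> A k"
      then have "y / of_real N \<in> F ` M N" by (simp add: A_def F(3) flip: N_def)
      then obtain x where x: "x \<in> M N" "y / of_real N = F x" by blast
      then have "G (of_real N * x) / of_real N = y / of_real N" using FG[of "of_real N * x"] N by simp
      then have "G (of_real N * x) = y" using N by simp
      moreover have "of_real N * x \<in> A k" using x N by (simp add: A_def flip: N_def)
      ultimately show "y \<in> G ` A k" by blast
    qed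
    ultimately show ?thesis using Gi by blast
  qed
  have cT: "compact T" unfolding T_def by (intro finite_imp_compact_convex_hull) simp
  obtain G where "isom G" "G \<noteq> id" "G ` T \<subseteq> T"
    by (rule limit_of_symmetric_sets[OF cT TD gD AT ev sy])
  then show False using rigid by blast
qed

text \<open>In coordinates with an interior point straight above \<open>x\<close>, no supporting
  line at \<open>x\<close> is vertical. The extreme slopes \<open>\<sigma>1\<close> and
  \<open>\<sigma>2\<close> of supporting lines describe the tangent cone; if they differ there is a
  corner, otherwise the single supporting line makes \<open>x\<close> smooth.\<close>

lemma smooth_everywhere:
  assumes S: "sym_inter K L" and K: "closed K" "convex K" "interior K \<noteq> {}" and x: "x \<in> frontier K"
    and L: "closed L" "convex L" "interior L \<noteq> {}" "L \<noteq> UNIV"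
  shows "smooth_at K x"
proof -
  have xK: "x \<in> K" using x frontier_subset_closed[OF K(1)] by blast
  obtain z0 where z0: "z0 \<in> interior K" using K by blast
  have "x \<noteq> z0" using x z0 by (auto simp: frontier_def)
  define h where "h = dist z0 x"
  have h: "h > 0" using \<open>x \<noteq> z0\<close> by (simp add: h_def)
  define c where "c = - \<i> * (z0 - x) / of_real h"
  have c: "cmod c = 1" using h by (simp add: c_def norm_mult norm_divide) (simp add: h_def dist_norm)
  have c0: "c \<noteq> 0" using c by auto
  define K1 where "K1 = frame x c K"
  have K1: "convex K1" "0 \<in> K1" using K xK by (auto simp: K1_def frame_def intro: convex_frame[unfolded frame_def])
  have "c * Complex 0 h = z0 - x"
  proof -
    have "Complex 0 h = \<i> * of_real h" by (simp add: complex_eq_iff)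
    then show ?thesis using h by (simp add: c_def) (simp add: complex_eq_iff)
  qed
  then have ih: "Complex 0 h \<in> interior K1"
    unfolding K1_def interior_frame[OF c] using z0 by (simp add: frame_def)
  define \<Sigma> where "\<Sigma> = {\<sigma>. \<forall>z\<in>K1. \<sigma> * Re z \<le> Im z}"
  have slope: "Im a < 0 \<and> - Re a / Im a \<in> \<Sigma>" if a: "outer_normal K1 0 a" "a \<noteq> 0" for a
  proof -
    have "Im a * h < 0" using normal_interior[OF a ih] by (simp add: inner_complex_def)
    then have i: "Im a < 0" using h by (simp add: mult_less_0_iff)
    moreover have "- Re a / Im a * Re z \<le> Im z" if "z \<in> K1" for z
    proof -
      have "Re a * Re z + Im a * Im z \<le> 0" using a that by (simp add: outer_normal_def inner_complex_def)
      then show ?thesis using i by (simp add: field_simps)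
    qed
    ultimately show ?thesis by (simp add: \<Sigma>_def)
  qed
  have "0 \<in> frontier K1" unfolding K1_def frontier_frame[OF c K(1)] using x by (simp add: frame_def)
  then obtain a0 where a0: "a0 \<noteq> 0" "outer_normal K1 0 a0"
    using outer_normal_exists[OF K1(1) _] ih by blast
  have ne: "\<Sigma> \<noteq> {}" using slope[OF a0(2,1)] by blast
  have "closed \<Sigma>"
  proof -
    have "\<Sigma> = (\<Inter>z\<in>K1. {\<sigma>. \<sigma> * Re z \<le> Im z})" by (auto simp: \<Sigma>_def)
    then show ?thesis by (auto intro!: closed_INT closed_Collect_le continuous_intros)
  qed
  obtain e where e: "e > 0" "ball (Complex 0 h) e \<subseteq> K1" using ih by (auto simp: mem_interior)
  \<comment> \<open>Two points of \<open>K1\<close> at height \<open>h\<close> on both sides of the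
    axis bound the slopes of supporting lines through 0.\<close>
  have "Complex (e / 2) h \<in> K1" "Complex (- e / 2) h \<in> K1"
    using e by (auto intro!: subsetD[OF e(2)] simp: dist_norm cmod_def)
  then have bd: "\<bar>\<sigma>\<bar> \<le> 2 * h / e" if "\<sigma> \<in> \<Sigma>" for \<sigma>
    using that e unfolding \<Sigma>_def by (auto simp: abs_le_iff field_simps)
  have bdd: "bdd_below \<Sigma>" "bdd_above \<Sigma>"
    using bd by (auto intro!: bdd_belowI[of _ "- (2 * h / e)"] bdd_aboveI[of _ "2 * h / e"] simp: abs_le_iff minus_le_iff)
  define \<sigma>1 \<sigma>2 where "\<sigma>1 = Inf \<Sigma>" and "\<sigma>2 = Sup \<Sigma>"
  have \<sigma>: "\<sigma>1 \<in> \<Sigma>" "\<sigma>2 \<in> \<Sigma>" unfolding \<sigma>1_def \<sigma>2_def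
    using closed_contains_Inf[OF ne bdd(1) \<open>closed \<Sigma>\<close>] closed_contains_Sup[OF ne bdd(2) \<open>closed \<Sigma>\<close>] by auto
  have between: "\<sigma>1 \<le> s \<and> s \<le> \<sigma>2" if "s \<in> \<Sigma>" for s
    unfolding \<sigma>1_def \<sigma>2_def using that bdd by (auto intro: cInf_lower cSup_upper)
  have ray: "\<exists>t>0. t *\<^sub>R w \<in> K1" if w: "\<sigma>1 * Re w < Im w" "\<sigma>2 * Re w < Im w" for w
  proof (rule ccontr)
    assume "\<not> ?thesis"
    then obtain a where a: "a \<noteq> 0" "outer_normal K1 0 a" "0 \<le> inner a w"
      using ray_or_normal[OF K1, of w] by auto
    define s where "s = - Re a / Im a"
    have s: "Im a < 0" "s \<in> \<Sigma>" using slope[OF a(2,1)] by (auto simp: s_def)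
    have "0 \<le> Re a * Re w + Im a * Im w" using a(3) by (simp add: inner_complex_def)
    then have "Im w \<le> s * Re w" using s(1) by (simp add: s_def field_simps)
    moreover have "s * Re w \<le> max (\<sigma>1 * Re w) (\<sigma>2 * Re w)"
      using between[OF s(2)] mult_right_mono[of s \<sigma>2 "Re w"] mult_right_mono_neg[of \<sigma>1 s "Re w"]
      by (cases "0 \<le> Re w") auto
    ultimately show False using w by auto
  qed
  have "\<not> \<sigma>1 < \<sigma>2"
  proof
    assume lt: "\<sigma>1 < \<sigma>2"
    obtain y c' \<rho> where y: "cmod c' = 1" "0 < \<rho>" "\<And>z. z \<in> frame y c' L \<Longrightarrow> 0 \<le> Im z"
      "cball (\<i> * of_real \<rho>) \<rho> \<subseteq> frame y c' L" using inner_ball[OF L] by metis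
    have S1: "sym_inter K1 (frame y c' L)" unfolding K1_def by (rule sym_inter_frame[OF S c y(1)])
    show False
      by (rule corner_contradiction[OF S1 K1 h ih lt _ ray y(3,2,4)]) (use \<sigma> in \<open>auto simp: \<Sigma>_def\<close>)
  qed
  then have eq: "\<sigma>2 = \<sigma>1" using between[OF \<sigma>(1)] by auto
  define n where "n = Complex \<sigma>1 (-1)"
  have n0: "n \<noteq> 0" by (simp add: n_def complex_eq_iff)
  define \<nu> where "\<nu> = (c * n) / of_real (cmod n)"
  have \<nu>: "cmod \<nu> = 1" using n0 c by (simp add: \<nu>_def norm_mult norm_divide)
  have in\<nu>: "inner \<nu> w = inner n (w / c) / cmod n" for w
  proof -
    have "inner \<nu> w = inner \<nu> (c * (w / c))" using c0 by simp
    also have "\<dots> = inner (\<nu> / c) (w / c)" by (rule inner_rotate[OF c])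
    also have "\<nu> / c = (1 / cmod n) *\<^sub>R n" using c0 by (simp add: \<nu>_def scaleR_conv_of_real)
    finally show ?thesis by simp
  qed
  show ?thesis
    unfolding smooth_at_def
  proof (intro exI[of _ \<nu>] conjI allI impI \<nu>)
    show "outer_normal K x \<nu>"
      unfolding outer_normal_def
    proof
      fix z assume "z \<in> K"
      then have "(z - x) / c \<in> K1" using c0 by (simp add: K1_def frame_def)
      then have "\<sigma>1 * Re ((z - x) / c) \<le> Im ((z - x) / c)" using \<sigma>(1) by (simp add: \<Sigma>_def)
      then have "inner n ((z - x) / c) \<le> 0" by (simp add: n_def inner_complex_def)
      then show "inner \<nu> (z - x) \<le> 0" unfolding in\<nu> by (simp add: divide_le_0_iff)
    qed
    fix w assume "inner \<nu> w < 0"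
    then have "inner n (w / c) < 0" unfolding in\<nu> using n0 by (simp add: divide_less_0_iff)
    then have "\<sigma>1 * Re (w / c) < Im (w / c)" by (simp add: n_def inner_complex_def)
    then obtain t where t: "t > 0" "t *\<^sub>R (w / c) \<in> K1" using ray[of "w / c"] eq by auto
    have "c * (t *\<^sub>R (w / c)) = t *\<^sub>R w" using c0 by (simp add: scaleR_conv_of_real)
    then show "\<exists>t>0. x + t *\<^sub>R w \<in> K" using t by (auto simp: K1_def frame_def)
  qed
qed

section \<open>Special positions of discs, strips and half-planes\<close>

definition half0 :: "complex set" where "half0 = {z. 0 \<le> Im z}"

definition strip0 :: "real \<Rightarrow> complex set" where "strip0 w = {z. 0 \<le> Im z \<and> Im z \<le> w}"

lemma strip_frame:
  assumes "a \<noteq> 0"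
  obtains x k where "cmod k = 1" "frame x k {z. b \<le> inner a z \<and> inner a z \<le> c} = strip0 ((c - b) / cmod a)"
    "frame x k {z. b \<le> inner a z} = half0"
proof -
  define k where "k = - \<i> * (a / of_real (cmod a))"
  define x where "x = (b / (cmod a)\<^sup>2) *\<^sub>R a"
  have k: "cmod k = 1" using assms by (simp add: k_def norm_mult norm_divide)
  have "a / k = \<i> * of_real (cmod a)" using assms by (simp add: k_def divide_eq_eq)
  then have "inner a (k * z) = cmod a * Im z" for z
    unfolding inner_rotate[OF k] by (simp add: inner_complex_def)
  moreover have "inner a x = b" using assms by (simp add: x_def power2_norm_eq_inner)
  ultimately have ip: "inner a (x + k * z) = b + cmod a * Im z" for z by (simp add: inner_add_right)
  have "0 < cmod a" using assms by simp
  then have "frame x k {z. b \<le> inner a z \<and> inner a z \<le> c} = strip0 ((c - b) / cmod a)"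
    unfolding frame_def strip0_def mem_Collect_eq ip by (auto simp: zero_le_mult_iff field_simps)
  moreover have "frame x k {z. b \<le> inner a z} = half0"
    using \<open>0 < cmod a\<close> unfolding frame_def half0_def mem_Collect_eq ip by (auto simp: zero_le_mult_iff)
  ultimately show thesis using that k by blast
qed

lemma disc_frame: "frame p 1 (cball p R) = cball 0 R"
  by (auto simp: frame_def dist_norm)

lemma mem_motion_image:
  assumes "u \<noteq> (0::complex)"
  shows "z \<in> (\<lambda>z. u * z + b) ` S \<longleftrightarrow> (z - b) / u \<in> S"
proof
  assume "(z - b) / u \<in> S"
  then show "z \<in> (\<lambda>z. u * z + b) ` S" using assms by (intro image_eqI[of _ _ "(z - b) / u"]) auto
qed (use assms in auto)

text \<open>The rotation by 135 degrees. Its inverse \<open>cnj kdiag\<close> turns the upper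
  half-plane into the half-plane below the diagonal \<open>Im z = Re z\<close>.\<close>

definition kdiag :: complex where "kdiag = Complex (- (1 / sqrt 2)) (1 / sqrt 2)"

lemma kdiag: "cmod (cnj kdiag) = 1" "z / cnj kdiag = z * kdiag" "Im (z * kdiag) = (Re z - Im z) / sqrt 2"
proof -
  have "(cmod kdiag)\<^sup>2 = 1" unfolding cmod_power2 by (simp add: kdiag_def power_divide)
  then have n: "cmod kdiag = 1" by (simp add: power2_eq_1_iff) (metis norm_ge_zero not_one_le_zero neg_0_le_iff_le)
  then show "cmod (cnj kdiag) = 1" by simp
  have "kdiag * cnj kdiag = 1" using n by (simp add: complex_norm_square[symmetric])
  then show "z / cnj kdiag = z * kdiag" by (metis divide_eq_eq mult.assoc mult.right_neutral mult_zero_right zero_neq_one)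
  show "Im (z * kdiag) = (Re z - Im z) / sqrt 2" by (simp add: kdiag_def diff_divide_distrib)
qed

text \<open>For convex sets these are the extreme points. The midpoint form is invariant under
  isometries because they are affine.\<close>

definition tip :: "complex set \<Rightarrow> complex \<Rightarrow> bool" where
  "tip M p \<longleftrightarrow> p \<in> M \<and> (\<forall>v. p + v \<in> M \<longrightarrow> p - v \<in> M \<longrightarrow> v = 0)"

lemma tip_isom:
  assumes F: "isom F" "F ` M = M" and p: "tip M p"
  shows "tip M (F p)"
proof -
  have inj: "F z \<in> M \<Longrightarrow> z \<in> M" for z
  proof -
    assume "F z \<in> M"
    then obtain w where "w \<in> M" "F z = F w" using F(2) by blast
    moreover have "dist z w = 0" using \<open>F z = F w\<close> F(1) unfolding isom_def by (metis dist_self)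
    ultimately show "z \<in> M" by simp
  qed
  have mid: "\<exists>v'. F (p + v') = F p + v \<and> F (p - v') = F p - v \<and> (v' = 0 \<longrightarrow> v = 0)" for v
    using F(1)
  proof (cases rule: isom_cases)
    case (1 u b)
    then have "u \<noteq> 0" by auto
    then show ?thesis by (intro exI[of _ "v / u"]) (auto simp: 1 algebra_simps)
  next
    case (2 u b)
    then have "u \<noteq> 0" by auto
    then show ?thesis by (intro exI[of _ "cnj (v / u)"]) (auto simp: 2 algebra_simps simp del: complex_cnj_divide)
  qed
  have "F p \<in> M" using F(2) p by (auto simp: tip_def)
  moreover have "v = 0" if "F p + v \<in> M" "F p - v \<in> M" for v
  proof -
    obtain v' where v': "F (p + v') = F p + v" "F (p - v') = F p - v" "v' = 0 \<longrightarrow> v = 0" using mid by blast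
    then have "p + v' \<in> M" "p - v' \<in> M" using inj that by metis+
    then show ?thesis using p v'(3) unfolding tip_def by blast
  qed
  ultimately show ?thesis by (simp add: tip_def)
qed

text \<open>Cutting the strip at 45 degrees leaves two corners, 0 and \<open>q\<close>, with
  different angles. A symmetry permutes them, and each of the three candidates moves a distant point
  of the lower edge out of the intersection.\<close>

lemma not_sym_inter_strip_half:
  assumes "0 < w"
  shows "\<not> sym_inter (strip0 w) half0"
proof
  assume S: "sym_inter (strip0 w) half0"
  define M where "M = strip0 w \<inter> (\<lambda>z. cnj kdiag * z + 0) ` half0"
  have mem: "z \<in> M \<longleftrightarrow> 0 \<le> Im z \<and> Im z \<le> w \<and> Im z \<le> Re z" for z
  proof -
    have "cnj kdiag \<noteq> 0" using kdiag(1) by auto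
    then show ?thesis unfolding M_def Int_iff mem_motion_image[OF \<open>cnj kdiag \<noteq> 0\<close>]
        diff_zero kdiag(2) half0_def strip0_def mem_Collect_eq kdiag(3) by (auto simp: zero_le_divide_iff)
  qed
  have "interior M \<noteq> {}"
  proof -
    define U where "U = {z. 0 < Im z} \<inter> {z. Im z < w} \<inter> {z. Im z < Re z}"
    have "open U" unfolding U_def
      by (intro open_Int open_Collect_less continuous_intros)
    moreover have "U \<subseteq> M" by (auto simp: U_def mem)
    ultimately have "U \<subseteq> interior M" by (simp add: interior_maximal)
    moreover have "Complex w (w / 2) \<in> U" using assms by (simp add: U_def)
    ultimately show ?thesis by blast
  qed
  then obtain F where F: "isom F" "F \<noteq> id" "F ` M = M"
    using S kdiag(1) unfolding sym_inter_def inter_all_def M_def by blast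
  define q where "q = Complex w w"
  have q0: "q \<noteq> 0" using assms by (simp add: q_def complex_eq_iff)
  have tips: "tip M 0" "tip M q"
    using assms by (auto simp: tip_def mem q_def complex_eq_iff)
  have only: "p = 0 \<or> p = q" if "tip M p" for p
  proof (rule ccontr)
    assume ne: "\<not> (p = 0 \<or> p = q)"
    have p: "0 \<le> Im p" "Im p \<le> w" "Im p \<le> Re p" using that by (auto simp: tip_def mem)
    have none: "v = 0" if "p + v \<in> M" "p - v \<in> M" for v using that \<open>tip M p\<close> unfolding tip_def by blast
    consider "0 < Im p" "Im p < w" | "Im p = 0" | "Im p = w" using p by linarith
    then show False
    proof cases
      case 1
      define e where "e = min (Im p) (w - Im p)"
      have "e > 0" "e \<le> Im p" "e \<le> w - Im p" using 1 by (auto simp: e_def)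
      then show False using none[of "Complex e e"] p by (auto simp: mem complex_eq_iff)
    next
      case 2
      then have "Re p > 0" using ne p by (auto simp: complex_eq_iff)
      then show False using none[of "of_real (Re p)"] p 2 by (auto simp: mem)
    next
      case 3
      then have "Re p > w" using ne p by (auto simp: complex_eq_iff q_def)
      then show False using none[of "of_real (Re p - w)"] p 3 by (auto simp: mem)
    qed
  qed
  have "F 0 \<noteq> F q" using F(1) q0 unfolding isom_def by (metis dist_eq_0_iff)
  then have F0q: "{F 0, F q} = {0, q}"
    using only[OF tip_isom[OF F(1,3) tips(1)]] only[OF tip_isom[OF F(1,3) tips(2)]] by auto
  define G where "G = (\<lambda>z. (F (0 + q * z) - 0) / q)"
  have G: "isom G" unfolding G_def by (rule isom_similarity) (use F q0 in auto)
  have "{G 0, G 1} = {0, 1}" using F0q q0 by (auto simp: G_def doubleton_eq_iff)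
  note Gcases = isom_permuting_01[OF G this]
  have FG: "F z = q * G (z / q)" for z using q0 by (simp add: G_def)
  have "G \<noteq> id"
  proof
    assume "G = id"
    then have "F z = z" for z using FG[of z] q0 by simp
    then show False using F by auto
  qed
  define z where "z = complex_of_real (5 * w)"
  have "z \<in> M" using assms by (simp add: mem z_def)
  then have Fz: "F z \<in> M" using F(3) by blast
  \<comment> \<open>The reflection in the diagonal through 0 and \<open>q\<close> turns real numbers
    into imaginary ones.\<close>
  have qc: "q * cnj (z / q) = \<i> * z"
  proof -
    have "cnj q * \<i> = q" by (simp add: q_def complex_eq_iff)
    then have "q / cnj q = \<i>" using q0 by (simp add: divide_eq_eq mult.commute)
    moreover have "q * cnj (z / q) = (q / cnj q) * z" by (simp add: z_def)
    ultimately show ?thesis by simp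
  qed
  from Gcases \<open>G \<noteq> id\<close> consider "G = cnj" | "G = (\<lambda>z. 1 - z)" | "G = (\<lambda>z. 1 - cnj z)" by blast
  then show False
  proof cases
    case 1
    then have "F z = \<i> * z" using FG[of z] qc by simp
    then show False using Fz assms by (simp add: mem z_def)
  next
    case 2
    then have "F z = q - z" using FG[of z] q0 by (simp add: right_diff_distrib)
    then show False using Fz assms by (simp add: mem z_def q_def)
  next
    case 3
    then have "F z = q - \<i> * z" using FG[of z] qc by (simp add: right_diff_distrib)
    then show False using Fz assms by (simp add: mem z_def q_def)
  qed
qed

text \<open>\<open>c\<close> is twice the centre. The inclusion suffices since the point reflection
  is its own inverse.\<close>

definition central :: "complex set \<Rightarrow> bool" where
  "central M \<longleftrightarrow> (\<exists>c. \<forall>z\<in>M. c - z \<in> M)"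

lemma central_frame:
  assumes "central M" "cmod k = 1"
  shows "central (frame x k M)"
proof -
  have k0: "k \<noteq> 0" using assms by auto
  obtain c where c: "\<And>z. z \<in> M \<Longrightarrow> c - z \<in> M" using assms(1) by (auto simp: central_def)
  have "x + k * ((c - 2 * x) / k - z) \<in> M" if "x + k * z \<in> M" for z
  proof -
    have "x + k * ((c - 2 * x) / k - z) = c - (x + k * z)"
      using k0 by (simp add: right_diff_distrib[of k "(c - 2 * x) / k"])
    then show ?thesis using c[OF that] by (simp only:)
  qed
  then show ?thesis unfolding central_def frame_def by blast
qed

text \<open>The top of the cap forces \<open>Im c \<ge> R + h\<close>. The image of either end of
  the straight edge must lie in the disc, hence must be the top itself, and this cannot hold for
  both ends.\<close>

lemma cap_not_central:
  assumes "- R < h" "h < R"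
  shows "\<not> central (cball 0 R \<inter> {z. h \<le> Im z})"
proof
  assume "central (cball 0 R \<inter> {z. h \<le> Im z})"
  then obtain c where "\<forall>z\<in>cball 0 R \<inter> {z. h \<le> Im z}. c - z \<in> cball 0 R \<inter> {z. h \<le> Im z}"
    unfolding central_def by blast
  then have c: "cmod (c - z) \<le> R \<and> h \<le> Im c - Im z" if "cmod z \<le> R" "h \<le> Im z" for z
    using that by (auto dest: bspec[of _ _ z])
  have "0 < (R - h) * (R + h)" using assms by simp
  then have "h\<^sup>2 < R\<^sup>2" by (simp add: power2_eq_square algebra_simps)
  define s where "s = sqrt (R\<^sup>2 - h\<^sup>2)"
  have s: "s > 0" "s\<^sup>2 = R\<^sup>2 - h\<^sup>2" using \<open>h\<^sup>2 < R\<^sup>2\<close> by (auto simp: s_def)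
  have top: "Im c \<ge> R + h" using c[of "Complex 0 R"] assms by (simp add: cmod_def)
  have "c = Complex t h + Complex 0 R" if "t\<^sup>2 = s\<^sup>2" for t
  proof -
    have "cmod (Complex t h) = sqrt (R\<^sup>2)" using that s by (simp add: cmod_def)
    also have "\<dots> = R" using assms by simp
    finally have le: "cmod (c - Complex t h) \<le> R" using c[of "Complex t h"] by simp
    then have "Im c - h \<le> R" using abs_Im_le_cmod[of "c - Complex t h"] by simp
    then have im: "Im c = R + h" using top by simp
    have "(cmod (c - Complex t h))\<^sup>2 \<le> R\<^sup>2" using le by (intro power_mono) auto
    then have "(Re c - t)\<^sup>2 \<le> 0" unfolding cmod_power2 by (simp add: im)
    then show ?thesis using im by (simp add: complex_eq_iff)
  qed
  from this[of s] this[of "- s"] show False using s by (simp add: complex_eq_iff)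
qed

lemma not_central_disc_half: "0 < R \<Longrightarrow> \<not> inter_all central (cball 0 R) half0"
proof
  assume R: "0 < R" and S: "inter_all central (cball 0 R) half0"
  have eq: "cball 0 R \<inter> (\<lambda>z. 1 * z + \<i> * of_real 0) ` half0 = cball 0 R \<inter> {z. 0 \<le> Im z}" by (auto simp: half0_def)
  have "ball 0 R \<inter> {z. 0 < Im z} \<subseteq> interior (cball 0 R \<inter> {z. 0 \<le> Im z})"
    by (intro interior_maximal open_Int open_halfspace_Im_gt) auto
  moreover have "Complex 0 (R / 2) \<in> ball 0 R \<inter> {z. 0 < Im z}" using R by (simp add: cmod_def)
  ultimately have "interior (cball 0 R \<inter> {z. 0 \<le> Im z}) \<noteq> {}" by blast
  then have "central (cball 0 R \<inter> {z. 0 \<le> Im z})"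
    using S[unfolded inter_all_def, rule_format, of 1 "\<i> * of_real 0"] unfolding eq by simp
  then show False using cap_not_central[of R 0] R by simp
qed

lemma not_central_disc_strip: "0 < R \<Longrightarrow> 0 < w \<Longrightarrow> \<not> inter_all central (cball 0 R) (strip0 w)"
proof
  assume R: "0 < R" and w: "0 < w" and S: "inter_all central (cball 0 R) (strip0 w)"
  \<comment> \<open>The lower edge of the strip cuts the disc, while its upper edge is not below the
    top of the disc; the intersection is a cap.\<close>
  define h where "h = max 0 (R - w)"
  have h: "0 \<le> h" "h < R" "R \<le> h + w" using R w by (auto simp: h_def)
  have "cball 0 R \<inter> (\<lambda>z. 1 * z + \<i> * of_real h) ` strip0 w = cball 0 R \<inter> {z. h \<le> Im z}"
  proof (intro set_eqI)
    fix z :: complex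
    have "Im z \<le> h + w" if "cmod z \<le> R" using abs_Im_le_cmod[of z] that h by linarith
    then show "z \<in> cball 0 R \<inter> (\<lambda>z. 1 * z + \<i> * of_real h) ` strip0 w \<longleftrightarrow> z \<in> cball 0 R \<inter> {z. h \<le> Im z}"
      unfolding Int_iff mem_motion_image[OF one_neq_zero] by (auto simp: strip0_def)
  qed
  note eq = this
  have "ball 0 R \<inter> {z. h < Im z} \<subseteq> interior (cball 0 R \<inter> {z. h \<le> Im z})"
    by (intro interior_maximal open_Int open_halfspace_Im_gt) auto
  moreover have "Complex 0 ((h + R) / 2) \<in> ball 0 R \<inter> {z. h < Im z}" using R h by (simp add: cmod_def)
  ultimately have "interior (cball 0 R \<inter> {z. h \<le> Im z}) \<noteq> {}" by blast
  then have "central (cball 0 R \<inter> {z. h \<le> Im z})"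
    using S[unfolded inter_all_def, rule_format, of 1 "\<i> * of_real h"] unfolding eq by simp
  then show False using cap_not_central[of R h] R h by simp
qed

text \<open>The larger circle is made to pass through the centre of the smaller one. The points 0
  and \<open>- r\<close> of the intersection then leave only \<open>c = - r\<close>, which fails at
  a common point of the two circles.\<close>

lemma not_central_discs: "0 < r \<Longrightarrow> r < R \<Longrightarrow> \<not> inter_all central (cball 0 r) (cball 0 R)"
proof
  assume r: "0 < r" "r < R" and S: "inter_all central (cball 0 r) (cball 0 R)"
  define M :: "complex set" where "M = cball 0 r \<inter> (\<lambda>z. 1 * z + of_real (- R)) ` cball 0 R"
  have mem: "z \<in> M \<longleftrightarrow> cmod z \<le> r \<and> cmod (z + of_real R) \<le> R" for z
    unfolding M_def Int_iff mem_motion_image[OF one_neq_zero] by simp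
  define U where "U = ball 0 r \<inter> ball (of_real (- R) :: complex) R"
  have "U \<subseteq> M" by (auto simp: U_def mem dist_norm norm_minus_commute add.commute)
  then have "U \<subseteq> interior M" by (intro interior_maximal) (auto simp: U_def)
  moreover have "of_real (- r / 2) \<in> U"
  proof -
    have "cmod (of_real (- R) - of_real (- r / 2)) = \<bar>- R - - r / 2\<bar>" by (metis norm_of_real of_real_diff)
    then show ?thesis using r by (simp add: U_def dist_norm)
  qed
  ultimately have "interior M \<noteq> {}" by blast
  then have "central M" using S[unfolded inter_all_def, rule_format, of 1 "of_real (- R)"] by (simp add: M_def)
  then obtain c where c: "\<And>z. z \<in> M \<Longrightarrow> c - z \<in> M" by (auto simp: central_def)
  have "0 \<in> M" using r by (simp add: mem)
  have mr: "of_real (- r) \<in> M"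
  proof -
    have "cmod (of_real (- r) + of_real R) = \<bar>- r + R\<bar>" by (metis norm_of_real of_real_add)
    then show ?thesis using r by (simp add: mem)
  qed
  have nonpos: "Re z \<le> 0" if "z \<in> M" for z
  proof -
    have "Re (z + of_real R) \<le> R" using that complex_Re_le_cmod[of "z + of_real R"] by (auto simp: mem)
    then show ?thesis by simp
  qed
  have c1: "cmod c \<le> r" using c[OF \<open>0 \<in> M\<close>] by (simp add: mem)
  have "Re c \<le> - r" using nonpos[OF c[OF mr]] by simp
  then have re: "Re c = - r" using abs_Re_le_cmod[of c] c1 by simp
  have "(cmod c)\<^sup>2 \<le> r\<^sup>2" using c1 by (intro power_mono) auto
  then have "Im c = 0" unfolding cmod_power2 by (simp add: re)
  then have ceq: "c = of_real (- r)" using re by (simp add: complex_eq_iff)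
  \<comment> \<open>The abscissa of the common points of the circles \<open>|z| = r\<close> and
    \<open>|z + R| = R\<close>.\<close>
  define x where "x = - r\<^sup>2 / (2 * R)"
  have xR: "2 * R * x = - r\<^sup>2" using r by (simp add: x_def)
  have "r\<^sup>2 < 2 * R * r" using r by (simp add: power2_eq_square)
  then have "\<bar>x\<bar> \<le> r" using r by (simp add: x_def divide_le_eq mult.commute[of r])
  then have "x\<^sup>2 \<le> r\<^sup>2" by (metis abs_ge_zero power2_abs power_mono)
  define p where "p = Complex x (sqrt (r\<^sup>2 - x\<^sup>2))"
  have p1: "(cmod p)\<^sup>2 = r\<^sup>2" unfolding cmod_power2 using \<open>x\<^sup>2 \<le> r\<^sup>2\<close> by (simp add: p_def)
  have p2: "(cmod (p + of_real R))\<^sup>2 = R\<^sup>2" unfolding cmod_power2 using \<open>x\<^sup>2 \<le> r\<^sup>2\<close> xR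
    by (simp add: p_def power2_sum) (simp add: mult.commute mult.left_commute)
  have "cmod p = r" "cmod (p + of_real R) = R" using p1 p2 r by (simp_all add: power2_eq_iff_nonneg)
  then have "p \<in> M" by (simp add: mem)
  then have "cmod (c - p) \<le> r" using c by (simp add: mem)
  then have "(cmod (c - p))\<^sup>2 \<le> r\<^sup>2" by (intro power_mono) auto
  moreover have "(cmod (c - p))\<^sup>2 = 2 * r\<^sup>2 + 2 * r * x"
    unfolding cmod_power2 using \<open>x\<^sup>2 \<le> r\<^sup>2\<close> by (simp add: p_def ceq power2_diff)
  ultimately have "r\<^sup>2 + 2 * r * x \<le> 0" by simp
  then have "R * (r\<^sup>2 + 2 * r * x) \<le> 0" using r by (simp add: mult_le_0_iff)
  moreover have "R * (r\<^sup>2 + 2 * r * x) = R * r\<^sup>2 + r * (2 * R * x)" by (simp add: algebra_simps)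
  ultimately have "r\<^sup>2 * (R - r) \<le> 0" unfolding xR by (simp add: algebra_simps power2_eq_square)
  then show False using r by (simp add: mult_le_0_iff)
qed

lemma not_central_halves: "\<not> inter_all central half0 half0"
proof
  assume S: "inter_all central half0 half0"
  have eq: "half0 \<inter> (\<lambda>z. 1 * z + 0) ` half0 = half0" by simp
  have "{z. 0 < Im z} \<subseteq> interior half0" by (intro interior_maximal open_halfspace_Im_gt) (auto simp: half0_def)
  moreover have "\<i> \<in> {z. 0 < Im z}" by simp
  ultimately have "interior half0 \<noteq> {}" by blast
  then have "central half0" using S[unfolded inter_all_def, rule_format, of 1 0] unfolding eq by simp
  then obtain c where "\<forall>z\<in>half0. c - z \<in> half0" unfolding central_def by blast
  then have c: "0 \<le> Im c - Im z" if "0 \<le> Im z" for z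
    using that by (auto simp: half0_def dest: bspec[of _ _ z])
  then show False using c[of "Complex 0 (\<bar>Im c\<bar> + 1)"] by simp
qed

definition axial :: "complex set \<Rightarrow> bool" where
  "axial M \<longleftrightarrow> (\<exists>v b. cmod v = 1 \<and> (\<lambda>z. v * cnj z + b) ` M = M)"

lemma axial_frame:
  assumes "axial M" "cmod k = 1"
  shows "axial (frame x k M)"
proof -
  have k0: "k \<noteq> 0" using assms by auto
  obtain v b where v: "cmod v = 1" "(\<lambda>z. v * cnj z + b) ` M = M" using assms(1) by (auto simp: axial_def)
  have i: "isom (\<lambda>z. v * cnj z + b)" using isom_motion[OF v(1), of True b] by (simp add: motion_def[abs_def])
  have "(\<lambda>z. (v * cnj (x + k * z) + b - x) / k) = (\<lambda>z. v * cnj k / k * cnj z + (v * cnj x + b - x) / k)"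
    using k0 by (auto simp: fun_eq_iff field_simps)
  moreover have "cmod (v * cnj k / k) = 1" using v assms(2) by (simp add: norm_mult norm_divide)
  ultimately show ?thesis using isom_frame(2)[OF i v(2) k0, of x] unfolding axial_def by metis
qed

text \<open>The strips cross at \<open>45\<close> degrees. A symmetry of the parallelogram maps the long diagonal to itself;
  if it reverses the orientation, it then makes two adjacent sides equal.\<close>

lemma axial_strips_width:
  assumes S: "inter_all axial (strip0 w) (strip0 w')" and w: "0 < w" "0 < w'"
  shows "w = w'"
proof (rule ccontr)
  assume ww: "w \<noteq> w'"
  \<comment> \<open>The parallelogram has the vertices 0, \<open>t\<close>,
    \<open>Complex w w\<close> and \<open>Complex (t + w) w\<close>. Its sides have lengths
    \<open>t\<close> and \<open>sqrt 2 * w\<close>, which differ because the widths do.\<close>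
  define t where "t = sqrt 2 * w'"
  have t: "t > 0" "t \<noteq> sqrt 2 * w" using w ww by (auto simp: t_def)
  define M where "M = strip0 w \<inter> (\<lambda>z. cnj kdiag * z + 0) ` strip0 w'"
  have mem: "z \<in> M \<longleftrightarrow> 0 \<le> Im z \<and> Im z \<le> w \<and> Im z \<le> Re z \<and> Re z - Im z \<le> t" for z
  proof -
    have "cnj kdiag \<noteq> 0" using kdiag(1) by auto
    then show ?thesis unfolding M_def Int_iff mem_motion_image[OF \<open>cnj kdiag \<noteq> 0\<close>]
        diff_zero kdiag(2) strip0_def mem_Collect_eq kdiag(3) t_def
      by (auto simp: zero_le_divide_iff pos_divide_le_eq mult.commute)
  qed
  have "interior M \<noteq> {}"
  proof -
    define U where "U = {z. 0 < Im z} \<inter> {z. Im z < w} \<inter> {z. Im z < Re z} \<inter> {z. Re z - Im z < t}"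
    have "open U" unfolding U_def
      by (intro open_Int open_Collect_less continuous_intros)
    moreover have "U \<subseteq> M" by (auto simp: U_def mem)
    ultimately have "U \<subseteq> interior M" by (simp add: interior_maximal)
    moreover have "Complex (w / 2 + t / 2) (w / 2) \<in> U" using w t by (simp add: U_def)
    ultimately show ?thesis by blast
  qed
  then obtain v b where v: "cmod v = 1" "(\<lambda>z. v * cnj z + b) ` M = M"
    using S kdiag(1) unfolding inter_all_def M_def axial_def by blast
  define F where "F = (\<lambda>z. v * cnj z + b)"
  have F: "isom F" using isom_motion[OF v(1), of True b] by (simp add: motion_def[abs_def] F_def)
  have FM: "z \<in> M \<Longrightarrow> F z \<in> M" for z using v(2) unfolding F_def by blast
  define q where "q = Complex (t + w) w"
  have q0: "q \<noteq> 0" using w by (simp add: q_def complex_eq_iff)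
  have diam: "{x, y} = {0, q}" if xy: "x \<in> M" "y \<in> M" "dist x y = cmod q" for x y
  proof -
    have *: "x = 0 \<and> y = q" if "x \<in> M" "y \<in> M" "dist x y = cmod q" "Im x \<le> Im y" for x y
    proof -
      define d where "d = y - x"
      have d: "0 \<le> Im d" "Im d \<le> w" "\<bar>Re d - Im d\<bar> \<le> t" using that by (auto simp: mem d_def)
      have "(cmod d)\<^sup>2 = (cmod q)\<^sup>2" using that by (simp add: d_def dist_norm norm_minus_commute)
      then have eq: "(Re d)\<^sup>2 + (Im d)\<^sup>2 = (t + w)\<^sup>2 + w\<^sup>2" unfolding cmod_power2 by (simp add: q_def)
      have "\<bar>Re d\<bar> \<le> t + w" using d by linarith
      then have r2: "(Re d)\<^sup>2 \<le> (t + w)\<^sup>2" by (metis abs_ge_zero power2_abs power_mono)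
      have i2: "(Im d)\<^sup>2 \<le> w\<^sup>2" using d by (intro power_mono) auto
      have "(Im d)\<^sup>2 = w\<^sup>2" "(Re d)\<^sup>2 = (t + w)\<^sup>2" using eq r2 i2 by linarith+
      then have "Im d = w" "\<bar>Re d\<bar> = t + w" using d w t by (auto simp: power2_eq_iff_nonneg) (metis abs_ge_zero add_nonneg_nonneg less_imp_le power2_abs power2_eq_iff_nonneg)
      moreover have "Re d \<noteq> - (t + w)" using d \<open>Im d = w\<close> w t by auto
      ultimately have "Im d = w" "Re d = t + w" by auto
      then show ?thesis using that by (auto simp: mem d_def q_def complex_eq_iff)
    qed
    show ?thesis using *[of x y] *[of y x] xy by (cases "Im x \<le> Im y") (auto simp: dist_commute)
  qed
  have inM: "0 \<in> M" "q \<in> M" using w t by (auto simp: mem q_def)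
  have F0q: "{F 0, F q} = {0, q}"
    using F by (intro diam FM inM) (simp add: isom_def dist_norm)
  define G where "G = (\<lambda>z. (F (0 + q * z) - 0) / q)"
  have G: "isom G" unfolding G_def by (rule isom_similarity) (use F q0 in auto)
  have "{G 0, G 1} = {0, 1}" using F0q q0 by (auto simp: G_def doubleton_eq_iff)
  note Gcases = isom_permuting_01[OF G this]
  have FG: "F z = q * G (z / q)" for z using q0 by (simp add: G_def)
  have Gf: "G z = (v * cnj q / q) * cnj z + b / q" for z using q0 by (simp add: G_def F_def add_divide_distrib)
  \<comment> \<open>Reversal of orientation: the images of two orthogonal unit vectors are again
    orthogonal, in the opposite sense. It rules out the identity and the half-turn.\<close>
  have rev: "cnj (G \<i> - G 0) = \<i> * cnj (G 1 - G 0)"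
    by (simp add: Gf)
  have "G = cnj \<or> G = (\<lambda>z. 1 - cnj z)"
  proof -
    have "G \<noteq> id" "G \<noteq> (\<lambda>z. 1 - z)" using rev by (auto simp: complex_eq_iff)
    then show ?thesis using Gcases by blast
  qed
  define T where "T = complex_of_real t"
  have TM: "T \<in> M" using w t by (simp add: mem T_def)
  have FT: "F T \<in> M" by (rule FM[OF TM])
  \<comment> \<open>Up to a factor, the signed distance from the long diagonal. Among the points of
    the parallelogram it takes its extreme values only at the two vertices off that diagonal, so it
    identifies the image of the vertex \<open>T\<close>.\<close>
  define X where "X z = Im (cnj q * z)" for z
  have X: "X z = (t + w) * Im z - w * Re z" for z by (simp add: X_def q_def)
  have XT: "X T = - (w * t)" by (simp add: X T_def)
  have Xq: "X (q * cnj (z / q)) = - X z" for z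
  proof -
    have "cnj q * (q * cnj (z / q)) = q * cnj z" using q0 by simp
    then show ?thesis by (simp add: X_def)
  qed
  have dF: "dist (F x) (F y) = dist x y" for x y using F by (simp add: isom_def)
  have nTq: "dist T q = sqrt 2 * w" using w by (simp add: dist_norm cmod_def T_def q_def real_sqrt_mult power2_eq_square flip: mult_2)
  from \<open>G = cnj \<or> G = (\<lambda>z. 1 - cnj z)\<close> show False
  proof
    assume "G = cnj"
    then have Fc: "F z = q * cnj (z / q)" for z using FG[of z] by simp
    then have "X (F T) = w * t" using Xq[of T] XT by simp
    then have "(t * (w - Im (F T)) + w * (Re (F T) - Im (F T))) = 0" by (simp add: X algebra_simps)
    moreover have "0 \<le> t * (w - Im (F T))" "0 \<le> w * (Re (F T) - Im (F T))" using FT w t by (auto simp: mem)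
    ultimately have "t * (w - Im (F T)) = 0" "w * (Re (F T) - Im (F T)) = 0" by linarith+
    then have "F T = Complex w w" using w t by (simp add: complex_eq_iff)
    moreover have "F 0 = 0" using Fc[of 0] by simp
    ultimately have "cmod (Complex w w) = t" using dF[of T 0] t by (simp add: dist_norm T_def)
    moreover have "cmod (Complex w w) = sqrt 2 * w" using w by (simp add: cmod_def real_sqrt_mult power2_eq_square flip: mult_2)
    ultimately show False using t by simp
  next
    assume "G = (\<lambda>z. 1 - cnj z)"
    then have Fc: "F z = q - q * cnj (z / q)" for z using FG[of z] by (simp add: right_diff_distrib)
    have "X (F T) = X q - X (q * cnj (T / q))" unfolding Fc by (simp add: X_def right_diff_distrib)
    also have "\<dots> = - (w * t)" unfolding Xq XT by (simp add: X q_def)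
    finally have "(t * Im (F T)) + w * (t - (Re (F T) - Im (F T))) = 0" by (simp add: X algebra_simps)
    moreover have "0 \<le> t * Im (F T)" "0 \<le> w * (t - (Re (F T) - Im (F T)))" using FT w t by (auto simp: mem)
    ultimately have "t * Im (F T) = 0" "w * (t - (Re (F T) - Im (F T))) = 0" by linarith+
    then have "F T = T" using w t by (simp add: complex_eq_iff T_def)
    moreover have "F 0 = q" using Fc[of 0] by simp
    ultimately have "dist T q = t" using dF[of T 0] t by (simp add: dist_norm T_def)
    then show False using nTq t by simp
  qed
qed

section \<open>Classification\<close>

lemma disc_strip_or_half_plane_of_sym_inter:
  assumes S: "sym_inter K L" "sym_inter L K"
    and K: "closed K" "convex K" "interior K \<noteq> {}" "K \<noteq> UNIV"
    and L: "closed L" "convex L" "interior L \<noteq> {}" "L \<noteq> UNIV"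
  shows "(\<exists>p R. 0 < R \<and> K = cball p R) \<or>
    (\<exists>a b c. a \<noteq> 0 \<and> b < c \<and> K = {x. b \<le> inner a x \<and> inner a x \<le> c}) \<or>
    (\<exists>a b. a \<noteq> 0 \<and> K = {x. inner a x \<le> b})"
proof (rule disc_strip_or_half_plane[OF K])
  fix x assume x: "x \<in> frontier K"
  have "frontier L \<noteq> {}" using L frontier_eq_empty[of L] by auto
  then obtain y where y: "y \<in> frontier L" by blast
  have xK: "x \<in> K" and yL: "y \<in> L" using x y frontier_subset_closed K(1) L(1) by blast+
  obtain r \<omega> \<beta> where "0 < r" "\<omega> \<noteq> 0 \<or> \<beta> \<noteq> 0" "tangent_on K \<omega> \<beta> (ball x r)"
    "\<exists>m\<in>frontier K \<inter> ball x r. kfield \<omega> \<beta> m \<noteq> 0"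
    by (rule tangent_near[OF S(1) K(1,2) xK smooth_everywhere[OF S(1) K(1-3) x L]
          L(1,2) yL smooth_everywhere[OF S(2) L(1-3) y K]])
  then show "\<exists>r>0. \<exists>\<omega> \<beta>. (\<omega> \<noteq> 0 \<or> \<beta> \<noteq> 0) \<and> tangent_on K \<omega> \<beta> (ball x r) \<and>
      (\<exists>m\<in>frontier K \<inter> ball x r. kfield \<omega> \<beta> m \<noteq> 0)"
    by (intro exI conjI)
qed

section \<open>Transfer between \<open>real^2\<close> and the complex plane\<close>

definition toC :: "real^2 \<Rightarrow> complex" where "toC x = Complex (x $ 1) (x $ 2)"

definition fromC :: "complex \<Rightarrow> real^2" where "fromC z = vector [Re z, Im z]"

lemma toC_fromC [simp]: "toC (fromC z) = z"
  by (simp add: toC_def fromC_def)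

lemma fromC_toC [simp]: "fromC (toC x) = x"
  by (simp add: toC_def fromC_def vec_eq_iff forall_2)

lemma toC_inject [simp]: "toC x = toC y \<longleftrightarrow> x = y"
  by (metis fromC_toC)

lemma inner_toC [simp]: "inner (toC x) (toC y) = inner x y"
  by (simp add: toC_def inner_complex_def inner_vec_def sum_2)

lemma toC_linear [simp]: "toC (x + y) = toC x + toC y" "toC (x - y) = toC x - toC y"
  "toC (c *\<^sub>R x) = c *\<^sub>R toC x" "toC 0 = 0"
  by (simp_all add: toC_def complex_eq_iff)

lemma norm_toC [simp]: "cmod (toC x) = norm x"
  by (simp add: norm_eq_sqrt_inner)

lemma dist_toC [simp]: "dist (toC x) (toC y) = dist x y"
  by (simp add: dist_norm flip: toC_linear)

lemma dist_fromC [simp]: "dist (fromC z) (fromC w) = dist z w"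
  by (metis dist_toC toC_fromC)

lemma toC_image_iff: "z \<in> toC ` S \<longleftrightarrow> fromC z \<in> S"
  by (metis fromC_toC image_iff toC_fromC)

lemma interior_isometry:
  fixes f :: "'a :: metric_space \<Rightarrow> 'b :: metric_space"
  assumes f: "\<And>x y. dist (f x) (f y) = dist x y" "surj f"
  shows "interior (f ` S) = f ` interior S"
proof -
  have ball: "ball (f x) e \<subseteq> f ` S \<longleftrightarrow> ball x e \<subseteq> S" for x e
  proof
    assume h: "ball (f x) e \<subseteq> f ` S"
    show "ball x e \<subseteq> S"
    proof
      fix y assume "y \<in> ball x e"
      then have "f y \<in> f ` S" using h f(1) by auto
      then obtain z where "z \<in> S" "f y = f z" by auto
      then show "y \<in> S" using f(1)[of y z] by simp
    qed
  next
    assume h: "ball x e \<subseteq> S"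
    show "ball (f x) e \<subseteq> f ` S"
    proof
      fix w assume "w \<in> ball (f x) e"
      moreover obtain y where "w = f y" using f(2) by (metis surjD)
      ultimately show "w \<in> f ` S" using h f(1) by auto
    qed
  qed
  show ?thesis
  proof (intro set_eqI)
    fix w
    obtain x where x: "w = f x" using f(2) by (metis surjD)
    have "f x \<in> f ` interior S \<longleftrightarrow> x \<in> interior S"
    proof
      assume "f x \<in> f ` interior S"
      then obtain z where "z \<in> interior S" "f x = f z" by auto
      then show "x \<in> interior S" using f(1)[of x z] by simp
    qed auto
    then show "w \<in> interior (f ` S) \<longleftrightarrow> w \<in> f ` interior S" by (simp add: x mem_interior ball)
  qed
qed

lemma surj_toC: "surj toC" by (metis surjI toC_fromC)

lemma interior_toC: "interior (toC ` S) = toC ` interior S"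
  by (rule interior_isometry) (auto simp: surj_toC)

lemma closed_toC: "closed S \<Longrightarrow> closed (toC ` S)"
proof -
  assume "closed S"
  moreover have "continuous_on UNIV fromC"
    unfolding continuous_on_iff by (metis dist_fromC)
  ultimately have "closed (fromC -` S)" by (intro closed_vimage) auto
  moreover have "fromC -` S = toC ` S" by (auto simp: toC_image_iff)
  ultimately show ?thesis by simp
qed

lemma convex_toC: "convex S \<Longrightarrow> convex (toC ` S)"
  by (intro convex_linear_image linearI) simp_all

definition cmap :: "complex \<Rightarrow> complex \<Rightarrow> real^2 \<Rightarrow> real^2" where
  "cmap u b x = fromC (u * toC x + b)"

lemma congruence_cmap:
  assumes "cmod u = 1"
  shows "congruence (cmap u b)" "orientation_preserving (cmap u b)"
proof -
  have u0: "u \<noteq> 0" using assms by auto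
  have "u * z + b - (u * w + b) = u * (z - w)" for z w by (simp add: algebra_simps)
  then have "dist (cmap u b x) (cmap u b y) = dist x y" for x y
    unfolding cmap_def dist_fromC dist_norm[of "u * toC x + b"] using assms
    by (simp add: norm_mult dist_norm flip: toC_linear)
  moreover have "cmap u b (fromC ((toC y - b) / u)) = y" for y
    using u0 by (simp add: cmap_def)
  then have "surj (cmap u b)" by (rule surjI[where f = "\<lambda>y. fromC ((toC y - b) / u)"])
  ultimately show "congruence (cmap u b)" by (simp add: congruence_def)
  have e: "cmap u b x - cmap u b 0 = fromC (u * toC x)" for x
  proof -
    have "toC (cmap u b x - cmap u b 0) = u * toC x" by (simp add: cmap_def)
    then show ?thesis by (metis fromC_toC)
  qed
  have "toC (axis 1 1) = 1" "toC (axis 2 1) = \<i>" by (simp_all add: toC_def axis_def complex_eq_iff)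
  then have "det (matrix (\<lambda>x. cmap u b x - cmap u b 0)) = (Re u)\<^sup>2 + (Im u)\<^sup>2"
    by (simp add: e det_2 matrix_def fromC_def power2_eq_square)
  also have "\<dots> = 1" using assms by (metis cmod_power2 power_one)
  finally show "orientation_preserving (cmap u b)" by (simp add: orientation_preserving_def)
qed

lemma inter_all_of_intersections:
  assumes S: "intersections_satisfy P K L" and PQ: "\<And>M. P M \<Longrightarrow> Q (toC ` M)"
  shows "inter_all Q (toC ` K) (toC ` L)"
  unfolding inter_all_def
proof (intro allI impI)
  fix u b :: complex assume u: "cmod u = 1"
  define M where "M = cmap 1 0 ` K \<inter> cmap u b ` L"
  have id: "cmap 1 0 ` K = K" by (simp add: cmap_def)
  have "toC ` M = toC ` K \<inter> toC ` (cmap u b ` L)"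
    unfolding M_def id by (rule image_Int) (simp add: inj_on_def)
  also have "toC ` (cmap u b ` L) = (\<lambda>z. u * z + b) ` toC ` L" by (simp add: image_image cmap_def)
  finally have eq: "toC ` M = toC ` K \<inter> (\<lambda>z. u * z + b) ` toC ` L" .
  assume "interior (toC ` K \<inter> (\<lambda>z. u * z + b) ` toC ` L) \<noteq> {}"
  then have "interior M \<noteq> {}" unfolding eq[symmetric] interior_toC by simp
  then have "P M" using S congruence_cmap[OF u, of b] congruence_cmap[of 1 0]
    unfolding intersections_satisfy_def M_def by simp
  then show "Q (toC ` K \<inter> (\<lambda>z. u * z + b) ` toC ` L)" unfolding eq[symmetric] by (rule PQ)
qed

lemma sym_inter_of_intersections:
  assumes "intersections_satisfy has_nontrivial_symmetry K L"
  shows "sym_inter (toC ` K) (toC ` L)"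
  unfolding sym_inter_def
proof (rule inter_all_of_intersections[OF assms])
  fix M assume "has_nontrivial_symmetry M"
  then obtain f where f: "congruence f" "f \<noteq> id" "f ` M = M" by (auto simp: has_nontrivial_symmetry_def)
  define F where "F z = toC (f (fromC z))" for z
  have "isom F" using f(1) by (simp add: isom_def F_def congruence_def)
  moreover have "F \<noteq> id"
  proof
    assume "F = id"
    then have "F (toC x) = toC x" for x by simp
    then show False using f(2) by (auto simp: F_def)
  qed
  moreover have "F ` toC ` M = toC ` f ` M" by (simp add: F_def image_image)
  ultimately show "\<exists>F. isom F \<and> F \<noteq> id \<and> F ` toC ` M = toC ` M" using f(3) by auto
qed

lemma central_toC:
  assumes "centrally_symmetric M"
  shows "central (toC ` M)"
proof -
  obtain c where c: "point_reflection c ` M = M" using assms by (auto simp: centrally_symmetric_def)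
  have "toC (2 *\<^sub>R c) - toC x \<in> toC ` M" if "x \<in> M" for x
  proof -
    have "point_reflection c x \<in> M" using c that by blast
    then show ?thesis unfolding point_reflection_def toC_linear(2)[symmetric] by (rule imageI)
  qed
  then show ?thesis unfolding central_def by blast
qed

lemma toC_line_reflection:
  assumes "norm u = 1"
  shows "toC (line_reflection p u x) = (toC u)\<^sup>2 * cnj (toC x - toC p) + toC p"
proof -
  define U w where "U = toC u" and "w = toC x - toC p"
  have "(cmod U)\<^sup>2 = 1" using assms by (simp add: U_def)
  then have U: "U * cnj U = 1" by (metis complex_norm_square of_real_1)
  have "2 *\<^sub>R (inner w U *\<^sub>R U) = (w * cnj U + cnj w * U) * U"
  proof -
    have "w * cnj U + cnj w * U = of_real (2 * inner w U)" by (simp add: complex_eq_iff inner_complex_def)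
    then show ?thesis by (simp add: scaleR_conv_of_real)
  qed
  also have "\<dots> = w * (U * cnj U) + U\<^sup>2 * cnj w" by (simp add: algebra_simps power2_eq_square)
  finally have "2 *\<^sub>R (inner w U *\<^sub>R U) - w = U\<^sup>2 * cnj w" by (simp add: U)
  moreover have "toC (line_reflection p u x) = toC p + (2 *\<^sub>R (inner w U *\<^sub>R U) - w)"
  proof -
    have "inner (x - p) u = inner w U" by (simp add: U_def w_def flip: toC_linear(2))
    then show ?thesis unfolding line_reflection_def toC_linear by (simp add: U_def w_def scaleR_add_right scaleR_2)
  qed
  ultimately show ?thesis by (simp add: U_def w_def)
qed

lemma axial_toC:
  assumes "axially_symmetric M"
  shows "axial (toC ` M)"
proof -
  obtain p u where u: "norm u = 1" "line_reflection p u ` M = M" using assms by (auto simp: axially_symmetric_def)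
  define v where "v = (toC u)\<^sup>2"
  have "(\<lambda>z. v * cnj z + (toC p - v * cnj (toC p))) ` toC ` M = toC ` (line_reflection p u ` M)"
    by (simp add: image_image toC_line_reflection[OF u(1)] v_def algebra_simps)
  moreover have "cmod v = 1" using u by (simp add: v_def norm_power)
  ultimately show ?thesis unfolding axial_def u(2) by blast
qed

lemma congruence_line_reflection:
  assumes u: "norm u = 1"
  shows "congruence (line_reflection p u)" "line_reflection p u \<noteq> id"
    "line_reflection p u (line_reflection p u x) = x"
proof -
  define U where "U = toC u"
  have U: "cmod U = 1" using u by (simp add: U_def)
  have UU: "U * cnj U = 1" using U by (simp add: complex_norm_square[symmetric])
  note tr = toC_line_reflection[OF u, folded U_def]
  have "U\<^sup>2 * cnj (U\<^sup>2 * cnj w) = (U * cnj U) * (U * cnj U) * w" for w by (simp add: power2_eq_square algebra_simps)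
  then have inv: "U\<^sup>2 * cnj (U\<^sup>2 * cnj w) = w" for w unfolding UU by simp
  have invol: "line_reflection p u (line_reflection p u x) = x" for x
  proof -
    have "toC (line_reflection p u (line_reflection p u x)) = toC x" by (simp only: tr add_diff_cancel_right' inv) simp
    then show ?thesis by simp
  qed
  then show "line_reflection p u (line_reflection p u x) = x" .
  have "dist (line_reflection p u x) (line_reflection p u y) = dist x y" for x y
  proof -
    have "toC (line_reflection p u x) - toC (line_reflection p u y) = U\<^sup>2 * cnj (toC (x - y))"
      by (simp add: tr algebra_simps)
    then have "dist (toC (line_reflection p u x)) (toC (line_reflection p u y)) = cmod (U\<^sup>2 * cnj (toC (x - y)))"
      by (simp only: dist_norm)
    also have "\<dots> = norm (x - y)" by (simp only: norm_mult norm_power U complex_mod_cnj norm_toC) simp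
    finally show ?thesis unfolding dist_toC dist_norm[of x y] .
  qed
  moreover have "surj (line_reflection p u)" by (rule surjI[where f = "line_reflection p u"]) (rule invol)
  ultimately show "congruence (line_reflection p u)" by (simp add: congruence_def)
  show "line_reflection p u \<noteq> id"
  proof
    assume "line_reflection p u = id"
    then have "toC (line_reflection p u (p + fromC (\<i> * U))) = toC (p + fromC (\<i> * U))" by simp
    then have "U\<^sup>2 * cnj (\<i> * U) = \<i> * U" by (simp add: tr)
    moreover have "U\<^sup>2 * cnj (\<i> * U) = - \<i> * U * (U * cnj U)" by (simp add: power2_eq_square)
    ultimately have "\<i> * U = 0" unfolding UU by simp
    then show False using U by auto
  qed
qed

lemma nontrivial_of_axial: "axially_symmetric M \<Longrightarrow> has_nontrivial_symmetry M"
  unfolding axially_symmetric_def has_nontrivial_symmetry_def using congruence_line_reflection by blast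

lemma nontrivial_of_central: "centrally_symmetric M \<Longrightarrow> has_nontrivial_symmetry M"
proof -
  assume "centrally_symmetric M"
  then obtain c where c: "point_reflection c ` M = M" by (auto simp: centrally_symmetric_def)
  have "point_reflection c (point_reflection c x) = x" for x by (simp add: point_reflection_def)
  then have "surj (point_reflection c)" by (rule surjI[where f = "point_reflection c"])
  moreover have "dist (point_reflection c x) (point_reflection c y) = dist x y" for x y
    by (simp add: point_reflection_def dist_norm norm_minus_commute)
  moreover have "point_reflection c \<noteq> id"
  proof
    assume "point_reflection c = id"
    then have "point_reflection c (c + axis 1 1) = c + axis 1 1" by simp
    then have "(2::real) *\<^sub>R axis 1 1 = (0 :: real^2)" by (simp add: point_reflection_def scaleR_2 algebra_simps)
    then show False by (simp add: axis_eq_0_iff)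
  qed
  ultimately show "has_nontrivial_symmetry M" using c unfolding has_nontrivial_symmetry_def congruence_def by blast
qed

lemma intersections_satisfy_mono:
  "intersections_satisfy P K L \<Longrightarrow> (\<And>M. P M \<Longrightarrow> Q M) \<Longrightarrow> intersections_satisfy Q K L"
  unfolding intersections_satisfy_def by blast

lemma intersections_satisfy_commute: "intersections_satisfy P K L \<longleftrightarrow> intersections_satisfy P L K"
  unfolding intersections_satisfy_def by (metis Int_commute)

section \<open>Shapes and their normal forms in the complex plane\<close>

lemma toC_disc: "is_disc K \<longleftrightarrow> (\<exists>p R. 0 < R \<and> toC ` K = cball p R)"
proof
  assume "is_disc K"
  then obtain c r where K: "0 < r" "K = cball c r" by (auto simp: is_disc_def)
  have "toC ` K = cball (toC c) r" unfolding K(2) by (auto simp: toC_image_iff) (metis dist_toC toC_fromC)+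
  then show "\<exists>p R. 0 < R \<and> toC ` K = cball p R" using K by blast
next
  assume "\<exists>p R. 0 < R \<and> toC ` K = cball p R"
  then obtain p R where K: "0 < R" "toC ` K = cball p R" by blast
  have "x \<in> K \<longleftrightarrow> toC x \<in> cball p R" for x unfolding K(2)[symmetric] by (simp add: toC_image_iff)
  moreover have "dist p (toC x) = dist (fromC p) x" for x by (metis dist_toC toC_fromC)
  ultimately have "K = cball (fromC p) R" by (simp add: set_eq_iff)
  then show "is_disc K" using K unfolding is_disc_def by blast
qed

lemma toC_strip_eq: "K = {x. P (inner a x)} \<longleftrightarrow> toC ` K = {z. P (inner (toC a) z)}"
proof -
  have "toC ` {x. P (inner a x)} = {z. P (inner (toC a) z)}"
    by (auto simp: toC_image_iff) (metis inner_toC toC_fromC)+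
  moreover have "toC ` A = toC ` B \<longleftrightarrow> A = B" for A B by (metis set_eq_iff toC_image_iff fromC_toC)
  ultimately show ?thesis by metis
qed

lemma ex_toC: "(\<exists>z. Q z) \<longleftrightarrow> (\<exists>x. Q (toC x))"
proof
  assume "\<exists>z. Q z"
  then obtain z where "Q (toC (fromC z))" by auto
  then show "\<exists>x. Q (toC x)" by blast
qed blast

lemma toC_strip: "is_strip K \<longleftrightarrow> (\<exists>a b c. a \<noteq> 0 \<and> b < c \<and> toC ` K = {x. b \<le> inner a x \<and> inner a x \<le> c})"
proof -
  have "K = {x. b \<le> inner a x \<and> inner a x \<le> c} \<longleftrightarrow> toC ` K = {z. b \<le> inner (toC a) z \<and> inner (toC a) z \<le> c}" for a b c
    by (rule toC_strip_eq[of K "\<lambda>t. b \<le> t \<and> t \<le> c"])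
  moreover have "toC a \<noteq> 0 \<longleftrightarrow> a \<noteq> 0" for a by (metis toC_inject toC_linear(4))
  ultimately show ?thesis unfolding is_strip_def by (subst ex_toC) simp
qed

lemma toC_half_plane: "is_half_plane K \<longleftrightarrow> (\<exists>a b. a \<noteq> 0 \<and> toC ` K = {x. inner a x \<le> b})"
proof -
  have "K = {x. inner a x \<le> b} \<longleftrightarrow> toC ` K = {z. inner (toC a) z \<le> b}" for a b
    by (rule toC_strip_eq[of K "\<lambda>t. t \<le> b"])
  moreover have "toC a \<noteq> 0 \<longleftrightarrow> a \<noteq> 0" for a by (metis toC_inject toC_linear(4))
  ultimately show ?thesis unfolding is_half_plane_def by (subst ex_toC) simp
qed

lemma disc_normal_form: "is_disc K \<Longrightarrow> \<exists>x k R. cmod k = 1 \<and> 0 < R \<and> frame x k (toC ` K) = cball 0 R"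
  using disc_frame unfolding toC_disc by (metis norm_one)

lemma strip_normal_form: "is_strip K \<Longrightarrow> \<exists>x k w. cmod k = 1 \<and> 0 < w \<and> frame x k (toC ` K) = strip0 w"
proof -
  assume "is_strip K"
  then obtain a b c where a: "a \<noteq> 0" "b < c" "toC ` K = {x. b \<le> inner a x \<and> inner a x \<le> c}" unfolding toC_strip by blast
  obtain x k where "cmod k = 1" "frame x k {z. b \<le> inner a z \<and> inner a z \<le> c} = strip0 ((c - b) / cmod a)"
    using strip_frame[OF a(1)] by metis
  moreover have "0 < (c - b) / cmod a" using a by simp
  ultimately show ?thesis unfolding a(3) by blast
qed

lemma half_plane_normal_form: "is_half_plane K \<Longrightarrow> \<exists>x k. cmod k = 1 \<and> frame x k (toC ` K) = half0"
proof -
  assume "is_half_plane K"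
  then obtain a b where a: "a \<noteq> 0" "toC ` K = {x. inner a x \<le> b}" unfolding toC_half_plane by blast
  have "{x. inner a x \<le> b} = {x. - b \<le> inner (- a) x}" by auto
  moreover obtain x k where "cmod k = 1" "frame x k {x. - b \<le> inner (- a) x} = half0"
    using strip_frame[of "- a" "- b"] a(1) by (metis neg_equal_0_iff_equal)
  ultimately show ?thesis unfolding a(2) by metis
qed

lemma congruent_of_frames:
  assumes k: "cmod k = 1" "cmod k' = 1" and eq: "frame x k (toC ` K) = frame y k' (toC ` L)"
  shows "congruent_sets K L"
proof -
  have k0: "k \<noteq> 0" "k' \<noteq> 0" using k by auto
  define u b where "u = k' / k" and "b = y - k' * x / k"
  have u: "cmod u = 1" using k by (simp add: u_def norm_divide)
  have f: "u * z + b = y + k' * ((z - x) / k)" for z by (simp add: u_def b_def diff_divide_distrib right_diff_distrib)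
  have "toC ` (cmap u b ` K) = (\<lambda>z. u * z + b) ` toC ` K" by (simp add: image_image cmap_def)
  also have "toC ` K = (\<lambda>z. x + k * z) ` frame x k (toC ` K)" using frame_image[OF k0(1)] by metis
  also have "(\<lambda>z. u * z + b) ` (\<lambda>z. x + k * z) ` frame x k (toC ` K) = (\<lambda>z. y + k' * z) ` frame y k' (toC ` L)"
    unfolding image_image f eq using k0 by simp
  also have "\<dots> = toC ` L" by (rule frame_image[OF k0(2)])
  finally have "cmap u b ` K = L" by (metis set_eq_iff toC_image_iff fromC_toC)
  then show ?thesis unfolding congruent_sets_def using congruence_cmap(1)[OF u] by blast
qed

text \<open>Both sets are discs, strips or half-planes by the same argument with exchanged roles.
  The only combination outside the list is a strip with a half-plane.\<close>

lemma classified_of_nontrivial: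
  assumes S: "intersections_satisfy has_nontrivial_symmetry K L"
    and K: "closed K" "convex K" "interior K \<noteq> {}" "K \<noteq> UNIV"
    and L: "closed L" "convex L" "interior L \<noteq> {}" "L \<noteq> UNIV"
  shows "classified_pair K L"
proof -
  have S1: "sym_inter (toC ` K) (toC ` L)" by (rule sym_inter_of_intersections[OF S])
  have S2: "sym_inter (toC ` L) (toC ` K)"
    using S unfolding intersections_satisfy_commute[of _ K L] by (rule sym_inter_of_intersections)
  have props: "closed (toC ` A) \<and> convex (toC ` A) \<and> interior (toC ` A) \<noteq> {} \<and> toC ` A \<noteq> UNIV"
    if A: "closed A" "convex A" "interior A \<noteq> {}" "A \<noteq> UNIV" for A
  proof -
    obtain x where "x \<notin> A" using A(4) by blast
    then have "toC x \<notin> toC ` A" by (simp add: toC_image_iff)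
    then show ?thesis using A by (auto simp: closed_toC convex_toC interior_toC)
  qed
  note pK = props[OF K] and pL = props[OF L]
  have shapeK: "is_disc K \<or> is_strip K \<or> is_half_plane K"
    unfolding toC_disc toC_strip toC_half_plane
    by (rule disc_strip_or_half_plane_of_sym_inter[OF S1 S2]) (use pK pL in auto)
  have shapeL: "is_disc L \<or> is_strip L \<or> is_half_plane L"
    unfolding toC_disc toC_strip toC_half_plane
    by (rule disc_strip_or_half_plane_of_sym_inter[OF S2 S1]) (use pK pL in auto)
  have no: False if AB: "sym_inter (toC ` A) (toC ` B)" and A: "is_strip A" and B: "is_half_plane B" for A B
  proof -
    obtain x k w where k: "cmod k = 1" "0 < w" "frame x k (toC ` A) = strip0 w" using strip_normal_form[OF A] by blast
    obtain y k' where k': "cmod k' = 1" "frame y k' (toC ` B) = half0" using half_plane_normal_form[OF B] by blast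
    show False using sym_inter_frame[OF AB k(1) k'(1), of x y] not_sym_inter_strip_half[OF k(2)] by (simp add: k k')
  qed
  show ?thesis unfolding classified_pair_def using shapeK shapeL no[OF S1] no[OF S2] by blast
qed

section \<open>Symmetries of the classified intersections\<close>

lemma congruence_linear_part:
  assumes "congruence \<phi>"
  obtains A where "\<And>x y. inner (A x) (A y) = inner x y" "\<And>x. \<phi> x = A x + \<phi> 0"
    "\<And>x. norm (A x) = norm x" "surj \<phi>"
proof -
  define A where "A = (\<lambda>x. \<phi> x - \<phi> 0)"
  have "orthogonal_transformation A"
    using assms unfolding orthogonal_transformation_isometry congruence_def A_def by (simp add: dist_norm)
  then show thesis
  proof (intro that[of A])
    show "inner (A x) (A y) = inner x y" for x y
      using \<open>orthogonal_transformation A\<close> by (simp add: orthogonal_transformation_def)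
    show "\<phi> x = A x + \<phi> 0" for x by (simp add: A_def)
    show "surj \<phi>" using assms by (simp add: congruence_def)
  qed (simp add: orthogonal_transformation)
qed

lemma congruence_halfspaces:
  assumes "congruence \<phi>" "a \<noteq> 0"
  obtains a' s where "a' \<noteq> 0" "\<And>P. \<phi> ` {x. P (inner a x)} = {y. P (inner a' y - s)}"
proof -
  obtain A where A: "\<And>x y. inner (A x) (A y) = inner x y" "\<And>x. \<phi> x = A x + \<phi> 0"
    "\<And>x. norm (A x) = norm x" "surj \<phi>" using congruence_linear_part[OF assms(1)] by blast
  have e: "inner (A a) (\<phi> x) - inner (A a) (\<phi> 0) = inner a x" for x
    by (subst A(2)) (simp add: inner_add_right A(1))
  show thesis
  proof
    show "A a \<noteq> 0" using A(3)[of a] assms(2) by auto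
    fix P
    show "\<phi> ` {x. P (inner a x)} = {y. P (inner (A a) y - inner (A a) (\<phi> 0))}"
    proof (intro set_eqI iffI)
      fix y assume "y \<in> {y. P (inner (A a) y - inner (A a) (\<phi> 0))}"
      moreover obtain x where "y = \<phi> x" using A(4) by (metis surjD)
      ultimately show "y \<in> \<phi> ` {x. P (inner a x)}" by (simp add: e)
    qed (auto simp: e)
  qed
qed

lemma congruence_disc: "congruence \<phi> \<Longrightarrow> is_disc S \<Longrightarrow> is_disc (\<phi> ` S)"
proof -
  assume \<phi>: "congruence \<phi>" and "is_disc S"
  then obtain c r where S: "0 < r" "S = cball c r" by (auto simp: is_disc_def)
  have "\<phi> ` S = cball (\<phi> c) r"
  proof (intro set_eqI iffI)
    fix y assume y: "y \<in> cball (\<phi> c) r"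
    moreover obtain x where "y = \<phi> x" using \<phi> by (metis congruence_def surjD)
    ultimately show "y \<in> \<phi> ` S" using \<phi> by (auto simp: S congruence_def)
  qed (use \<phi> in \<open>auto simp: S congruence_def\<close>)
  then show ?thesis using S unfolding is_disc_def by blast
qed

lemma congruence_strip: "congruence \<phi> \<Longrightarrow> is_strip S \<Longrightarrow> is_strip (\<phi> ` S)"
proof -
  assume \<phi>: "congruence \<phi>" and "is_strip S"
  then obtain a b c where S: "a \<noteq> 0" "b < c" "S = {x. b \<le> inner a x \<and> inner a x \<le> c}" by (auto simp: is_strip_def)
  obtain a' s where a': "a' \<noteq> 0" "\<And>P. \<phi> ` {x. P (inner a x)} = {y. P (inner a' y - s)}"
    using congruence_halfspaces[OF \<phi> S(1)] by blast
  have "\<phi> ` S = {y. b + s \<le> inner a' y \<and> inner a' y \<le> c + s}"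
    unfolding S(3) a'(2)[of "\<lambda>t. b \<le> t \<and> t \<le> c"] by (auto simp: algebra_simps)
  then show ?thesis using a'(1) S(2) unfolding is_strip_def
    by (intro exI[of _ a'] exI[of _ "b + s"] exI[of _ "c + s"]) simp
qed

lemma congruence_half_plane: "congruence \<phi> \<Longrightarrow> is_half_plane S \<Longrightarrow> is_half_plane (\<phi> ` S)"
proof -
  assume \<phi>: "congruence \<phi>" and "is_half_plane S"
  then obtain a b where S: "a \<noteq> 0" "S = {x. inner a x \<le> b}" by (auto simp: is_half_plane_def)
  obtain a' s where a': "a' \<noteq> 0" "\<And>P. \<phi> ` {x. P (inner a x)} = {y. P (inner a' y - s)}"
    using congruence_halfspaces[OF \<phi> S(1)] by blast
  have "\<phi> ` S = {y. inner a' y \<le> b + s}"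
    unfolding S(2) a'(2)[of "\<lambda>t. t \<le> b"] by (auto simp: algebra_simps)
  then show ?thesis using a'(1) unfolding is_half_plane_def by (intro exI[of _ a'] exI[of _ "b + s"]) simp
qed

section \<open>Axes and centres of the intersections\<close>

lemma axialI:
  assumes u: "norm u = 1" and M: "\<And>x. x \<in> M \<Longrightarrow> line_reflection p u x \<in> M"
  shows "axially_symmetric M"
proof -
  have "line_reflection p u ` M = M"
  proof (intro equalityI subsetI)
    fix x assume "x \<in> M"
    then show "x \<in> line_reflection p u ` M"
      using M[OF \<open>x \<in> M\<close>] congruence_line_reflection(3)[OF u, of p x] by (metis imageI)
  qed (use M in auto)
  then show ?thesis using u unfolding axially_symmetric_def by blast
qed

lemma inner_line_reflection:
  assumes "norm u = 1"
  shows "inner u (line_reflection p u x) = inner u x"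
proof -
  have "inner u u = 1" using assms by (simp add: norm_eq_1)
  then show ?thesis
    by (simp add: line_reflection_def inner_add_right inner_diff_right inner_diff_left inner_commute algebra_simps)
qed

lemma dist_line_reflection:
  assumes "norm u = 1"
  shows "dist (p + s *\<^sub>R u) (line_reflection p u x) = dist (p + s *\<^sub>R u) x"
proof -
  have "inner u u = 1" using assms by (simp add: norm_eq_1)
  then have "line_reflection p u (p + s *\<^sub>R u) = p + s *\<^sub>R u"
    by (simp add: line_reflection_def scaleR_2)
  then show ?thesis using congruence_line_reflection(1)[OF assms, of p] unfolding congruence_def by metis
qed

text \<open>The zero vector gets an arbitrary direction, so concentric discs need no separate
  treatment.\<close>

lemma direction_of:
  fixes a :: "real^2"
  obtains u s where "norm u = 1" "a = s *\<^sub>R u" "a \<noteq> 0 \<Longrightarrow> s \<noteq> 0"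
proof (cases "a = 0")
  case True
  have "norm (axis 1 1 :: real^2) = 1" by simp
  then show thesis using True that[of "axis 1 1" 0] by simp
next
  case False
  then show thesis using that[of "(1 / norm a) *\<^sub>R a" "norm a"] by simp
qed

text \<open>The determinant decides: if it vanishes, both vectors are orthogonal to a common
  non-zero vector; otherwise Cramer's rule solves the system.\<close>

lemma parallel_or_solvable:
  fixes a a' :: "real^2"
  assumes "a \<noteq> 0"
  shows "(\<exists>s. a' = s *\<^sub>R a) \<or> (\<forall>r r'. \<exists>p. inner a p = r \<and> inner a' p = r')"
proof (cases "a $ 1 * a' $ 2 = a $ 2 * a' $ 1")
  case True
  have "inner (fromC (\<i> * toC a)) a = 0" "inner (fromC (\<i> * toC a)) a' = 0"
    using True by (simp_all add: inner_vec_def sum_2 fromC_def toC_def algebra_simps)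
  then have "inner (\<i> * toC a) (toC a) = 0" "inner (\<i> * toC a) (toC a') = 0"
    by (metis inner_toC toC_fromC)+
  moreover have "toC a \<noteq> 0" using assms by (metis toC_inject toC_linear(4))
  ultimately obtain s where "toC a' = s *\<^sub>R toC a"
    using perp_parallel[of "\<i> * toC a" "toC a" "toC a'"] by auto
  then have "a' = s *\<^sub>R a" by (metis toC_inject toC_linear(3))
  then show ?thesis by blast
next
  case False
  define D where "D = a $ 1 * a' $ 2 - a $ 2 * a' $ 1"
  have D: "D \<noteq> 0" using False by (simp add: D_def)
  have "\<exists>p. inner a p = r \<and> inner a' p = r'" for r r'
  proof (intro exI conjI)
    let ?p = "vector [(r * a' $ 2 - r' * a $ 2) / D, (r' * a $ 1 - r * a' $ 1) / D] :: real^2"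
    have "D * inner a ?p = D * r" "D * inner a' ?p = D * r'"
      using D by (simp_all add: inner_vec_def sum_2 distrib_left) (simp_all add: D_def algebra_simps)
    then show "inner a ?p = r" "inner a' ?p = r'" using D by auto
  qed
  then show ?thesis by blast
qed

lemma disc_disc_symmetric: "is_disc A \<Longrightarrow> is_disc B \<Longrightarrow> axially_symmetric (A \<inter> B)"
proof -
  assume "is_disc A" "is_disc B"
  then obtain c r c' r' where AB: "A = cball c r" "B = cball c' r'" by (auto simp: is_disc_def)
  obtain u s where u: "norm u = 1" "c' - c = s *\<^sub>R u" using direction_of by metis
  have c': "c' = c + s *\<^sub>R u" "c = c + 0 *\<^sub>R u" using u(2) by (simp_all add: algebra_simps)
  show ?thesis
  proof (rule axialI[OF u(1)])
    fix x assume "x \<in> A \<inter> B"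
    then show "line_reflection c u x \<in> A \<inter> B"
      using dist_line_reflection[OF u(1), of c s x] dist_line_reflection[OF u(1), of c 0 x]
      by (simp add: AB c'(1))
  qed
qed

text \<open>The axis is the line through the centre in the direction of \<open>a\<close>, orthogonal
  to the edges. The predicate \<open>P\<close> covers strips and half-planes at once.\<close>

lemma disc_halfspaces_symmetric:
  assumes "is_disc A"
  shows "axially_symmetric (A \<inter> {x. P (inner a x)})"
proof -
  obtain c r where A: "A = cball c r" using assms by (auto simp: is_disc_def)
  obtain u s where u: "norm u = 1" "a = s *\<^sub>R u" using direction_of by metis
  show ?thesis
  proof (rule axialI[OF u(1)])
    fix x assume "x \<in> A \<inter> {x. P (inner a x)}"
    then show "line_reflection c u x \<in> A \<inter> {x. P (inner a x)}"
      using dist_line_reflection[OF u(1), of c 0 x] inner_line_reflection[OF u(1), of c x] by (simp add: A u(2))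
  qed
qed

lemma parallel_halfspaces_symmetric:
  "axially_symmetric ({x. P (inner a x)} \<inter> {x. Q (inner (k *\<^sub>R a) x)})"
proof -
  obtain u s where u: "norm u = 1" "a = s *\<^sub>R u" using direction_of by metis
  show ?thesis
  proof (rule axialI[OF u(1)])
    fix x assume "x \<in> {x. P (inner a x)} \<inter> {x. Q (inner (k *\<^sub>R a) x)}"
    then show "line_reflection 0 u x \<in> {x. P (inner a x)} \<inter> {x. Q (inner (k *\<^sub>R a) x)}"
      using inner_line_reflection[OF u(1), of 0 x] by (simp add: u(2))
  qed
qed

text \<open>Strips that are not parallel have a common centre where their middle lines cross; for
  parallel ones any line orthogonal to the edges is an axis.\<close>

lemma strip_strip_symmetric: "is_strip A \<Longrightarrow> is_strip B \<Longrightarrow> has_nontrivial_symmetry (A \<inter> B)"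
proof -
  assume "is_strip A" "is_strip B"
  then obtain a b c a' b' c' where A: "a \<noteq> 0" "A = {x. b \<le> inner a x \<and> inner a x \<le> c}"
    and B: "B = {x. b' \<le> inner a' x \<and> inner a' x \<le> c'}" by (auto simp: is_strip_def)
  from parallel_or_solvable[OF A(1), of a'] show ?thesis
  proof
    assume "\<exists>s. a' = s *\<^sub>R a"
    then obtain s where s: "a' = s *\<^sub>R a" by blast
    have "axially_symmetric (A \<inter> B)" unfolding A(2) B s
      using parallel_halfspaces_symmetric[of "\<lambda>t. b \<le> t \<and> t \<le> c" a "\<lambda>t. b' \<le> t \<and> t \<le> c'" s] .
    then show ?thesis by (rule nontrivial_of_axial)
  next
    assume "\<forall>r r'. \<exists>p. inner a p = r \<and> inner a' p = r'"
    then obtain p where p: "inner a p = (b + c) / 2" "inner a' p = (b' + c') / 2" by blast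
    have inv: "point_reflection p x \<in> A \<inter> B" if "x \<in> A \<inter> B" for x
    proof -
      have "inner a (point_reflection p x) = b + c - inner a x" "inner a' (point_reflection p x) = b' + c' - inner a' x"
        by (simp_all add: point_reflection_def inner_diff_right p field_simps)
      then show ?thesis using that by (simp add: A B)
    qed
    have "point_reflection p ` (A \<inter> B) = A \<inter> B"
    proof (intro equalityI subsetI)
      fix x assume "x \<in> A \<inter> B"
      then have "point_reflection p x \<in> A \<inter> B" by (rule inv)
      moreover have "x = point_reflection p (point_reflection p x)" by (simp add: point_reflection_def)
      ultimately show "x \<in> point_reflection p ` (A \<inter> B)" by blast
    qed (use inv in auto)
    then have "centrally_symmetric (A \<inter> B)" unfolding centrally_symmetric_def by blast
    then show ?thesis by (rule nontrivial_of_central)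
  qed
qed

text \<open>The axis of a wedge is the line through its apex in the direction of the sum of the unit
  normals; the reflection in it exchanges the normals. The sum is not zero because the normals are
  not parallel.\<close>

lemma half_half_symmetric: "is_half_plane A \<Longrightarrow> is_half_plane B \<Longrightarrow> axially_symmetric (A \<inter> B)"
proof -
  assume "is_half_plane A" "is_half_plane B"
  then obtain a b a' b' where A: "a \<noteq> 0" "A = {x. inner a x \<le> b}" and B: "a' \<noteq> 0" "B = {x. inner a' x \<le> b'}"
    by (auto simp: is_half_plane_def)
  from parallel_or_solvable[OF A(1), of a'] show ?thesis
  proof
    assume "\<exists>s. a' = s *\<^sub>R a"
    then obtain s where s: "a' = s *\<^sub>R a" by blast
    show ?thesis unfolding A(2) B(2) s
      using parallel_halfspaces_symmetric[of "\<lambda>t. t \<le> b" a "\<lambda>t. t \<le> b'" s] .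
  next
    assume sol: "\<forall>r r'. \<exists>p. inner a p = r \<and> inner a' p = r'"
    then obtain p where p: "inner a p = b" "inner a' p = b'" by blast
    define n n' where "n = (1 / norm a) *\<^sub>R a" and "n' = (1 / norm a') *\<^sub>R a'"
    have "norm n = 1" "norm n' = 1" using A(1) B(1) by (simp_all add: n_def n'_def)
    then have nn: "inner n n = 1" "inner n' n' = 1" by (simp_all only: norm_eq_1)
    define s where "s = n + n'"
    have "s \<noteq> 0"
    proof
      assume "s = 0"
      obtain q where q: "inner a q = norm a" "inner a' q = 0" using sol by blast
      have "inner s q = 1" using q A(1) by (simp add: s_def n_def n'_def inner_add_left)
      then show False using \<open>s = 0\<close> by simp
    qed
    define u where "u = (1 / norm s) *\<^sub>R s"
    have u: "norm u = 1" using \<open>s \<noteq> 0\<close> by (simp add: u_def)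
    have ss: "inner s s = 2 * inner n s" "inner s s = 2 * inner n' s"
      using nn by (simp_all add: s_def inner_add_left inner_add_right inner_commute)
    have s0: "inner s s \<noteq> 0" using \<open>s \<noteq> 0\<close> by simp
    have swap: "inner n (line_reflection p u x - p) = inner n' (x - p)"
      "inner n' (line_reflection p u x - p) = inner n (x - p)" for x
    proof -
      have "line_reflection p u x - p = 2 *\<^sub>R (inner (x - p) u *\<^sub>R u) - (x - p)"
        by (simp add: line_reflection_def scaleR_add_right scaleR_2)
      also have "inner (x - p) u *\<^sub>R u = (inner (x - p) s / inner s s) *\<^sub>R s"
        by (simp add: u_def power2_norm_eq_inner[symmetric] power2_eq_square)
      finally have e: "line_reflection p u x - p = 2 *\<^sub>R ((inner (x - p) s / inner s s) *\<^sub>R s) - (x - p)" .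
      have "inner n (line_reflection p u x - p) = inner (x - p) s * (2 * inner n s / inner s s) - inner n (x - p)"
        unfolding e by (simp add: inner_diff_right[of n _ "x - p"])
      then show "inner n (line_reflection p u x - p) = inner n' (x - p)"
        unfolding ss(1)[symmetric] using s0 by (simp add: s_def inner_add_right inner_commute)
      have "inner n' (line_reflection p u x - p) = inner (x - p) s * (2 * inner n' s / inner s s) - inner n' (x - p)"
        unfolding e by (simp add: inner_diff_right[of n' _ "x - p"])
      then show "inner n' (line_reflection p u x - p) = inner n (x - p)"
        unfolding ss(2)[symmetric] using s0 by (simp add: s_def inner_add_right inner_commute)
    qed
    have memA: "x \<in> A \<longleftrightarrow> inner n (x - p) \<le> 0" for x
      using A(1) by (simp add: A(2) n_def inner_diff_right p[symmetric] divide_le_cancel)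
    have memB: "x \<in> B \<longleftrightarrow> inner n' (x - p) \<le> 0" for x
      using B(1) by (simp add: B(2) n'_def inner_diff_right p[symmetric] divide_le_cancel)
    show ?thesis
      by (rule axialI[OF u, of _ p]) (simp add: memA memB swap)
  qed
qed

lemma classified_intersections:
  assumes "classified_pair K L"
  shows "intersections_satisfy has_nontrivial_symmetry K L"
  unfolding intersections_satisfy_def
proof (intro allI impI)
  fix \<phi> \<psi> assume "congruence \<phi> \<and> orientation_preserving \<phi> \<and> congruence \<psi> \<and> orientation_preserving \<psi> \<and>
    interior (\<phi> ` K \<inter> \<psi> ` L) \<noteq> {}"
  then have c: "congruence \<phi>" "congruence \<psi>" by auto
  have disc_other: "has_nontrivial_symmetry (A \<inter> B)" if "is_disc A" "is_strip B \<or> is_half_plane B" for A B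
    using that(2)
  proof
    assume "is_strip B"
    then obtain a b c where "B = {x. b \<le> inner a x \<and> inner a x \<le> c}" by (auto simp: is_strip_def)
    then show ?thesis
      using disc_halfspaces_symmetric[OF that(1), of "\<lambda>t. b \<le> t \<and> t \<le> c" a] by (auto intro: nontrivial_of_axial)
  next
    assume "is_half_plane B"
    then obtain a b where "B = {x. inner a x \<le> b}" by (auto simp: is_half_plane_def)
    then show ?thesis
      using disc_halfspaces_symmetric[OF that(1), of "\<lambda>t. t \<le> b" a] by (auto intro: nontrivial_of_axial)
  qed
  note im = congruence_disc[OF c(1)] congruence_disc[OF c(2)] congruence_strip[OF c(1)] congruence_strip[OF c(2)]
    congruence_half_plane[OF c(1)] congruence_half_plane[OF c(2)]
  from assms show "has_nontrivial_symmetry (\<phi> ` K \<inter> \<psi> ` L)"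
    unfolding classified_pair_def
  proof (elim disjE conjE)
    show ?thesis if "is_disc K" "is_disc L"
      using that im by (intro nontrivial_of_axial disc_disc_symmetric) auto
    show ?thesis if "is_disc K" "is_strip L" using that im by (intro disc_other) auto
    show ?thesis if "is_disc K" "is_half_plane L" using that im by (intro disc_other) auto
    show ?thesis if "is_disc L" "is_strip K" using that im by (subst Int_commute) (intro disc_other, auto)
    show ?thesis if "is_disc L" "is_half_plane K" using that im by (subst Int_commute) (intro disc_other, auto)
    show ?thesis if "is_strip K" "is_strip L" using that im by (intro strip_strip_symmetric) auto
    show ?thesis if "is_half_plane K" "is_half_plane L"
      using that im by (intro nontrivial_of_axial half_half_symmetric) auto
  qed
qed

section \<open>Consequences of central and of axial symmetry\<close>

lemma central_classification:
  assumes S: "intersections_satisfy centrally_symmetric K L" and cl: "classified_pair K L"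
  shows "(is_disc K \<and> is_disc L \<and> congruent_sets K L) \<or> (is_strip K \<and> is_strip L)"
proof -
  have frames: "inter_all central (frame x k (toC ` A)) (frame y k' (toC ` B))"
    if "intersections_satisfy centrally_symmetric A B" "cmod k = 1" "cmod k' = 1" for A B x y k k'
  proof (rule inter_all_frame)
    show "inter_all central (toC ` A) (toC ` B)"
      using that(1) by (rule inter_all_of_intersections) (rule central_toC)
  qed (use that in \<open>auto intro: central_frame\<close>)
  have S': "intersections_satisfy centrally_symmetric L K" using S by (simp add: intersections_satisfy_commute[of _ K])
  have no_disc_strip: False if A: "intersections_satisfy centrally_symmetric A B" "is_disc A" "is_strip B" for A B
  proof -
    obtain x k R where k: "cmod k = 1" "0 < R" "frame x k (toC ` A) = cball 0 R" using disc_normal_form[OF A(2)] by blast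
    obtain y k' w where k': "cmod k' = 1" "0 < w" "frame y k' (toC ` B) = strip0 w" using strip_normal_form[OF A(3)] by blast
    show False using frames[OF A(1) k(1) k'(1), of x y] not_central_disc_strip[OF k(2) k'(2)] by (simp add: k k')
  qed
  have no_disc_half: False if A: "intersections_satisfy centrally_symmetric A B" "is_disc A" "is_half_plane B" for A B
  proof -
    obtain x k R where k: "cmod k = 1" "0 < R" "frame x k (toC ` A) = cball 0 R" using disc_normal_form[OF A(2)] by blast
    obtain y k' where k': "cmod k' = 1" "frame y k' (toC ` B) = half0" using half_plane_normal_form[OF A(3)] by blast
    show False using frames[OF A(1) k(1) k'(1), of x y] not_central_disc_half[OF k(2)] by (simp add: k k')
  qed
  have no_half_half: False if A: "is_half_plane K" "is_half_plane L"
  proof -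
    obtain x k where k: "cmod k = 1" "frame x k (toC ` K) = half0" using half_plane_normal_form[OF A(1)] by blast
    obtain y k' where k': "cmod k' = 1" "frame y k' (toC ` L) = half0" using half_plane_normal_form[OF A(2)] by blast
    show False using frames[OF S k(1) k'(1), of x y] not_central_halves by (simp add: k k')
  qed
  have discs: "congruent_sets K L" if A: "is_disc K" "is_disc L"
  proof -
    obtain x k R where k: "cmod k = 1" "0 < R" "frame x k (toC ` K) = cball 0 R" using disc_normal_form[OF A(1)] by blast
    obtain y k' R' where k': "cmod k' = 1" "0 < R'" "frame y k' (toC ` L) = cball 0 R'" using disc_normal_form[OF A(2)] by blast
    have "\<not> R < R'" using frames[OF S k(1) k'(1), of x y] not_central_discs[OF k(2)] by (auto simp: k k')
    moreover have "\<not> R' < R" using frames[OF S' k'(1) k(1), of y x] not_central_discs[OF k'(2)] by (auto simp: k k')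
    ultimately have "R = R'" by simp
    then show ?thesis using congruent_of_frames[OF k(1) k'(1), of x K y L] by (simp add: k k')
  qed
  show ?thesis using cl discs no_disc_strip[OF S] no_disc_strip[OF S'] no_disc_half[OF S] no_disc_half[OF S'] no_half_half
    unfolding classified_pair_def by blast
qed

lemma axial_strips_congruent:
  assumes S: "intersections_satisfy axially_symmetric K L" and A: "is_strip K" "is_strip L"
  shows "congruent_sets K L"
proof -
  obtain x k w where k: "cmod k = 1" "0 < w" "frame x k (toC ` K) = strip0 w" using strip_normal_form[OF A(1)] by blast
  obtain y k' w' where k': "cmod k' = 1" "0 < w'" "frame y k' (toC ` L) = strip0 w'" using strip_normal_form[OF A(2)] by blast
  have "inter_all axial (frame x k (toC ` K)) (frame y k' (toC ` L))"
  proof (rule inter_all_frame)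
    show "inter_all axial (toC ` K) (toC ` L)"
      using S by (rule inter_all_of_intersections) (rule axial_toC)
  qed (use k k' in \<open>auto intro: axial_frame\<close>)
  then have "w = w'" using axial_strips_width[OF _ k(2) k'(2)] by (simp add: k k')
  then show ?thesis using congruent_of_frames[OF k(1) k'(1), of x K y L] by (simp add: k k')
qed

theorem theorem4:
  fixes K L :: "(real^2) set"
  assumes "closed K" and "convex K" and "interior K \<noteq> {}" and "K \<noteq> UNIV"
    and "closed L" and "convex L" and "interior L \<noteq> {}" and "L \<noteq> UNIV"
  shows "(intersections_satisfy has_nontrivial_symmetry K L \<longleftrightarrow> classified_pair K L) \<and>
    (intersections_satisfy centrally_symmetric K L \<longrightarrow>
       (is_disc K \<and> is_disc L \<and> congruent_sets K L) \<or> (is_strip K \<and> is_strip L)) \<and>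
    (intersections_satisfy axially_symmetric K L \<longrightarrow>
       classified_pair K L \<and> (is_strip K \<and> is_strip L \<longrightarrow> congruent_sets K L))"
proof (intro conjI impI iffI)
  show "classified_pair K L" if "intersections_satisfy has_nontrivial_symmetry K L"
    using classified_of_nontrivial[OF that assms] .
  show "intersections_satisfy has_nontrivial_symmetry K L" if "classified_pair K L"
    using classified_intersections[OF that] .
  show "(is_disc K \<and> is_disc L \<and> congruent_sets K L) \<or> (is_strip K \<and> is_strip L)"
    if "intersections_satisfy centrally_symmetric K L"
    using central_classification[OF that]
      classified_of_nontrivial[OF intersections_satisfy_mono[OF that nontrivial_of_central] assms] by blast
  show "classified_pair K L" if "intersections_satisfy axially_symmetric K L"
    using classified_of_nontrivial[OF intersections_satisfy_mono[OF that nontrivial_of_axial] assms] .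
  show "congruent_sets K L" if "intersections_satisfy axially_symmetric K L" "is_strip K \<and> is_strip L"
    using axial_strips_congruent[OF that(1)] that(2) by blast
qed

end
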